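(* Every Borel subset of $\mathbf{R}$ is diffeomorphic to a Salem set: for every Borel set $F\subset\mathbf{R}$ there is a $C^1$-diffeomorphism $f:\mathbf{R}\to\mathbf{R}$ such that $\dim_{\mathrm{F}} f(F) = \dim_{\mathrm{H}} f(F)$.
   Context: The Fourier transform of a Borel probability measure $\mu$ on $\mathbf{R}$ is $\widehat\mu(\xi) = \int e^{-2\pi i \xi x}\,\mathrm{d}\mu(x)$. The Fourier dimension of $\mu$ is $\dim_{\mathrm{F}} \mu = \sup\{ s \in [0,1] : |\widehat\mu(\xi)|\,|\xi|^{s/2} \text{ is bounded in } \xi\}$. The Fourier dimension of a Borel set $F \subset \mathbf{R}$ is $\dim_{\mathrm{F}} F = \sup\{\dim_{\mathrm{F}} \mu : \mu \text{ a Borel probability measure on } \mathbf{R},\ \mu(F) = 1\}$ (with value $0$ if $F=\emptyset$). $\dim_{\mathrm{H}}$ denotes Hausdorff dimension (with $\dim_{\mathrm{H}}\emptyset = 0$). A Borel set is a Salem set if its Fourier dimension equals its Hausdorff dimension. A $C^1$-diffeomorphism of $\mathbf{R}$ is a continuously differentiable bijection with continuously differentiable inverse. *)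

theory Defs
  imports "HOL-Probability.Probability"
begin

definition fourier_transform :: "real measure \<Rightarrow> real \<Rightarrow> complex" where
  "fourier_transform \<mu> \<xi> =
     (LINT x|\<mu>. exp (- 2 * complex_of_real pi * \<i> * complex_of_real \<xi> * complex_of_real x))"

(* The set below contains 0, so the supremum of reals is a genuine one. The library
   convention 0 powr 0 = 0 only affects the value at \<xi> = 0, not boundedness. *)
definition fourier_dim_measure :: "real measure \<Rightarrow> real" where
  "fourier_dim_measure \<mu> =
     Sup {s \<in> {0..1}. bounded (range (\<lambda>\<xi>. cmod (fourier_transform \<mu> \<xi>) * \<bar>\<xi>\<bar> powr (s / 2)))}"

(* real_distribution: a probability measure on the Borel sigma-algebra of the real line. *)
definition fourier_dim :: "real set \<Rightarrow> real" where
  "fourier_dim F =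
     (if F = {} then 0
      else Sup {fourier_dim_measure \<mu> | \<mu>. real_distribution \<mu> \<and> measure \<mu> F = 1})"

(* diam(U)^s with the usual conventions: the empty set contributes 0, and diam(U)^0 = 1
   for nonempty U (whereas 0 powr 0 = 0 in the library). *)
definition diam_pow :: "real \<Rightarrow> 'a::metric_space set \<Rightarrow> ennreal" where
  "diam_pow s U =
     (if U = {} then 0 else if s = 0 then 1 else ennreal (diameter U powr s))"

(* Boundedness is required explicitly since diameter is unspecified on unbounded sets. *)
definition hausdorff_content :: "real \<Rightarrow> real \<Rightarrow> 'a::metric_space set \<Rightarrow> ennreal" where
  "hausdorff_content s \<delta> A =
     Inf {(\<Sum>i. diam_pow s (U i)) | U :: nat \<Rightarrow> 'a set.
            A \<subseteq> (\<Union>i. U i) \<and> (\<forall>i. bounded (U i) \<and> diameter (U i) \<le> \<delta>)}"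

definition hausdorff_measure :: "real \<Rightarrow> 'a::metric_space set \<Rightarrow> ennreal" where
  "hausdorff_measure s A = (SUP \<delta>\<in>{0<..}. hausdorff_content s \<delta> A)"

(* Restricted to subsets of the line: there the set below contains every s > 1, so the
   infimum of reals is a genuine one. *)
definition hausdorff_dim :: "real set \<Rightarrow> real" where
  "hausdorff_dim A = Inf {s. 0 \<le> s \<and> hausdorff_measure s A = 0}"

definition salem_set :: "real set \<Rightarrow> bool" where
  "salem_set F \<longleftrightarrow> F \<in> sets borel \<and> fourier_dim F = hausdorff_dim F"

definition C1_diffeomorphism :: "(real \<Rightarrow> real) \<Rightarrow> bool" where
  "C1_diffeomorphism f \<longleftrightarrow>
     bij f \<and> f C1_differentiable_on UNIV \<and> inv f C1_differentiable_on UNIV"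

end

(* The diffeomorphism is random: f(x) = x + sum_l a_l c(l, floor(theta_l x)) sin^2(pi theta_l x),
   where theta_l runs through the dyadic scales (each scale occurs twice, shifted by half a period),
   the c(l, j) are independent truncated Gaussians, and a_l is 2^(-l/2) times a negative power of l;
   this gain over 2^(-l/2) is just enough for f to be C^1 and costs only a subpolynomial factor.

   If mu is a Frostman measure on F, mu(I) <= C |I|^t, then at a frequency slightly above 2^m the
   coefficients of scale 2^(-m) split the Fourier integral of f_* mu into independent summands of
   negligible mean, one per dyadic interval. Given all other coefficients, Hoeffding's inequality
   bounds the sum by about 2^(-mt/2), and Borel-Cantelli over a fine grid of frequencies makes this
   simultaneous almost surely. Countably many Frostman measures with exponents t -> dim_H F are served
   by the same f, and f is Lipschitz, so dim_F f(F) >= dim_H F >= dim_H f(F).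

   Frostman measures on a Borel set: F is the projection of a closed subset of R x N^N; since dyadic
   content is continuous along increasing sequences, F contains a compact K of positive content, and
   the content of K is turned into a measure by splitting mass down the dyadic tree in proportion to
   content. The inequality dim_F <= dim_H follows by averaging |mu^|^2 against a Gaussian, which bounds
   the mean mass of balls and hence feeds the mass distribution principle. *)
theory Submission
  imports Defs "HOL-Real_Asymp.Real_Asymp"
begin

text \<open>Hoeffding's inequality returns the exponent t because each summand is bounded by the
  mass of its interval, and the squares of the masses of disjoint intervals of total mass 1 sum to
  at most the largest mass, which is about 2^(-mt). The means are small only where the random part
  of the phase is large. Since sin^2 vanishes at the ends of every interval, each scale is doubled
  by a half-period shift, which exchanges sin^2 and cos^2: at every point one of the two waves has
  sin^2 at least 1/2. There the random phase has size about 2^(-m) m^(-3) times the frequency, so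
  the frequency has to exceed 2^m by a factor 2^(m \<eta>); this loss disappears as \<eta> tends to
  0. Gaussian coefficients are chosen for their fast decaying characteristic function. Truncation at
  height l + 1 makes them bounded, as C^1 smoothness demands, and changes the characteristic
  function by a multiple of e^(-l) only.\<close>

abbreviation "\<N> \<equiv> std_normal_distribution"

section \<open>Dyadic content\<close>

text \<open>The half-open dyadic interval of level \<open>n\<close> with left end
  \<open>i / 2 ^ n\<close>. The floor form gives each real exactly one cell per level and turns
  passage to a coarser level into integer division.\<close>

definition cell :: "nat \<times> int \<Rightarrow> real set" where
  "cell p = {x. \<lfloor>2 ^ fst p * x\<rfloor> = snd p}"

abbreviation cell_cost :: "real \<Rightarrow> nat \<times> int \<Rightarrow> ennreal" where
  "cell_cost t p \<equiv> ennreal (2 powr (- t * real (fst p)))"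

text \<open>Written as a measure with a density, so that additivity and continuity along increasing
  unions come from measure theory.\<close>

definition cost :: "real \<Rightarrow> (nat \<times> int) set \<Rightarrow> ennreal" where
  "cost t C = emeasure (density (count_space UNIV) (\<lambda>p. cell_cost t p)) C"

definition dyadic_content :: "real \<Rightarrow> real set \<Rightarrow> ennreal" where
  "dyadic_content t A = (INF C\<in>{C. A \<subseteq> (\<Union>p\<in>C. cell p)}. cost t C)"

lemma mem_cell: "x \<in> cell (n, \<lfloor>2 ^ n * x\<rfloor>)"
  by (simp add: cell_def)

lemma mem_cell_iff: "x \<in> cell p \<longleftrightarrow> p = (fst p, \<lfloor>2 ^ fst p * x\<rfloor>)"
  by (cases p) (auto simp: cell_def)

lemma floor_coarsen: "\<lfloor>2 ^ n * x\<rfloor> = \<lfloor>2 ^ (n + k) * x\<rfloor> div 2 ^ k" for x :: real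
proof -
  have "\<lfloor>2 ^ (n + k) * x\<rfloor> div 2 ^ k = \<lfloor>(2 ^ (n + k) * x) / real_of_int (2 ^ k)\<rfloor>"
    by (rule floor_divide_real_eq_div[symmetric]) simp
  also have "(2 ^ (n + k) * x) / real_of_int (2 ^ k) = 2 ^ n * x"
    by (simp add: power_add)
  finally show ?thesis by simp
qed

lemma cell_nested:
  assumes "x \<in> cell p" "x \<in> cell q" "fst p \<le> fst q"
  shows "cell q \<subseteq> cell p"
proof
  fix y assume "y \<in> cell q"
  obtain k where k: "fst q = fst p + k" using assms(3) le_Suc_ex by blast
  have "\<lfloor>2 ^ fst q * y\<rfloor> = \<lfloor>2 ^ fst q * x\<rfloor>"
    using \<open>y \<in> cell q\<close> assms by (simp add: cell_def)
  then have "\<lfloor>2 ^ fst p * y\<rfloor> = \<lfloor>2 ^ fst p * x\<rfloor>"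
    using floor_coarsen[of "fst p" _ k] k by metis
  then show "y \<in> cell p" using assms by (simp add: cell_def)
qed

lemma cost_Un_disjoint: "A \<inter> B = {} \<Longrightarrow> cost t (A \<union> B) = cost t A + cost t B"
  unfolding cost_def by (rule plus_emeasure[symmetric]) auto

lemma cost_Un_le: "cost t (A \<union> B) \<le> cost t A + cost t B"
  unfolding cost_def by (rule emeasure_subadditive) auto

lemma cost_mono: "A \<subseteq> B \<Longrightarrow> cost t A \<le> cost t B"
  unfolding cost_def by (rule emeasure_mono) auto

lemma cost_empty [simp]: "cost t {} = 0"
  unfolding cost_def by simp

lemma cost_eq_nn_integral:
  "cost t C = (\<integral>\<^sup>+p. cell_cost t p * indicator C p \<partial>count_space UNIV)"
  unfolding cost_def by (subst emeasure_density) auto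

lemma cost_singleton: "cost t {p} = cell_cost t p"
  unfolding cost_eq_nn_integral by (subst nn_integral_count_space'[where A="{p}"]) auto

lemma dyadic_content_le: "A \<subseteq> (\<Union>p\<in>C. cell p) \<Longrightarrow> dyadic_content t A \<le> cost t C"
  unfolding dyadic_content_def by (rule INF_lower) simp

lemma dyadic_content_mono: "A \<subseteq> B \<Longrightarrow> dyadic_content t A \<le> dyadic_content t B"
  unfolding dyadic_content_def by (rule INF_superset_mono) auto

lemma dyadic_content_empty [simp]: "dyadic_content t {} = 0"
  using dyadic_content_le[of "{}" "{}" t] by simp

lemma dyadic_content_less_imp_cover:
  assumes "dyadic_content t A < c"
  obtains C where "A \<subseteq> (\<Union>p\<in>C. cell p)" "cost t C < c"
  using assms unfolding dyadic_content_def INF_less_iff by auto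

lemma dyadic_content_Un_le: "dyadic_content t (A \<union> B) \<le> dyadic_content t A + dyadic_content t B"
proof (rule ennreal_le_epsilon)
  fix e :: real assume e: "0 < e" and fin: "dyadic_content t A + dyadic_content t B < top"
  have "dyadic_content t A < dyadic_content t A + ennreal (e/2)" "dyadic_content t B < dyadic_content t B + ennreal (e/2)"
    using fin e by (auto simp: ennreal_less_iff ennreal_add_less_top)
  then obtain C D where "A \<subseteq> (\<Union>p\<in>C. cell p)" "cost t C < dyadic_content t A + ennreal (e/2)"
    "B \<subseteq> (\<Union>p\<in>D. cell p)" "cost t D < dyadic_content t B + ennreal (e/2)"
    by (metis dyadic_content_less_imp_cover)
  then have "dyadic_content t (A \<union> B) \<le> cost t (C \<union> D)"
    by (intro dyadic_content_le) auto
  also have "\<dots> \<le> cost t C + cost t D" by (rule cost_Un_le)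
  also have "\<dots> \<le> (dyadic_content t A + ennreal (e/2)) + (dyadic_content t B + ennreal (e/2))"
    using \<open>cost t C < _\<close> \<open>cost t D < _\<close> by (intro add_mono) auto
  also have "\<dots> = dyadic_content t A + dyadic_content t B + (ennreal (e/2) + ennreal (e/2))"
    by (simp add: ac_simps)
  also have "ennreal (e/2) + ennreal (e/2) = ennreal e"
    using e by (simp flip: ennreal_plus)
  finally show "dyadic_content t (A \<union> B) \<le> dyadic_content t A + dyadic_content t B + ennreal e" .
qed

text \<open>Each cover drops its cells that lie in a cell of the other. The comparison is strict on
  one side only, so that a cell common to both covers is not removed altogether by its own
  copy.\<close>

definition merge_covers :: "(nat \<times> int) set \<Rightarrow> (nat \<times> int) set \<Rightarrow> (nat \<times> int) set" where
  "merge_covers E C =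
     {p \<in> E. \<not> (\<exists>q\<in>C. fst q < fst p \<and> cell p \<subseteq> cell q)} \<union>
     {q \<in> C. \<not> (\<exists>p\<in>E. fst p \<le> fst q \<and> cell q \<subseteq> cell p)}"

text \<open>A cell of least level among all those through \<open>x\<close> has nothing above it that
  could displace it. The bound on the level is what makes repeated merging converge: the least level
  at a point can only go down.\<close>

lemma merge_covers_coarsest:
  assumes "q \<in> E \<union> C" "x \<in> cell q"
  obtains r where "r \<in> merge_covers E C" "x \<in> cell r" "fst r \<le> fst q"
proof -
  define P where "P l \<longleftrightarrow> (\<exists>p\<in>E \<union> C. x \<in> cell p \<and> fst p = l)" for l
  define l where "l = (LEAST l. P l)"
  have "P (fst q)" using assms by (auto simp: P_def)
  then have "P l" and min: "\<And>k. P k \<Longrightarrow> l \<le> k"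
    unfolding l_def by (auto intro: LeastI Least_le)
  have min': "l \<le> fst p" if "p \<in> E \<union> C" "x \<in> cell p" for p
    using min that by (auto simp: P_def)
  define r where "r = (l, \<lfloor>2 ^ l * x\<rfloor>)"
  have r: "x \<in> cell r" "r \<in> E \<union> C" "fst r \<le> fst q"
    using \<open>P l\<close> min'[OF assms] mem_cell_iff[of x] by (auto simp: P_def r_def mem_cell)
  have "r \<in> merge_covers E C"
  proof (cases "r \<in> E")
    case True
    then show ?thesis using min' r by (fastforce simp: merge_covers_def r_def)
  next
    case False
    have "\<not> (\<exists>p\<in>E. fst p \<le> fst r \<and> cell r \<subseteq> cell p)"
    proof
      assume "\<exists>p\<in>E. fst p \<le> fst r \<and> cell r \<subseteq> cell p"
      then obtain p where p: "p \<in> E" "fst p \<le> l" "x \<in> cell p"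
        using r by (auto simp: r_def)
      with min'[of p] have "fst p = l" by auto
      with p have "p = r" using mem_cell_iff[of x p] by (simp add: r_def)
      with p False show False by simp
    qed
    then show ?thesis using False r by (auto simp: merge_covers_def)
  qed
  with r that show ?thesis by blast
qed

(* The intervals discarded by the merge still cover A, because through each point of A
   one of two nested intervals is discarded. *)
lemma merge_covers_cost:
  assumes "A \<subseteq> (\<Union>p\<in>E. cell p)" "A \<subseteq> (\<Union>p\<in>C. cell p)"
  shows "cost t (merge_covers E C) + dyadic_content t A \<le> cost t E + cost t C"
proof -
  let ?E1 = "{p \<in> E. \<not> (\<exists>q\<in>C. fst q < fst p \<and> cell p \<subseteq> cell q)}"
  let ?C1 = "{q \<in> C. \<not> (\<exists>p\<in>E. fst p \<le> fst q \<and> cell q \<subseteq> cell p)}"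
  let ?E2 = "E - ?E1" and ?C2 = "C - ?C1"
  have "A \<subseteq> (\<Union>p\<in>?E2 \<union> ?C2. cell p)"
  proof
    fix x assume "x \<in> A"
    then obtain p q where pq: "p \<in> E" "x \<in> cell p" "q \<in> C" "x \<in> cell q"
      using assms by blast
    show "x \<in> (\<Union>p\<in>?E2 \<union> ?C2. cell p)"
    proof (cases "fst p \<le> fst q")
      case True
      then have "q \<in> ?C2" using pq cell_nested[of x p q] by auto
      then show ?thesis using pq by blast
    next
      case False
      then have "fst q < fst p" "cell p \<subseteq> cell q" using pq cell_nested[of x q p] by auto
      then have "p \<in> ?E2" using pq by blast
      then show ?thesis using pq by blast
    qed
  qed
  then have "dyadic_content t A \<le> cost t ?E2 + cost t ?C2"
    by (meson dyadic_content_le cost_Un_le order_trans)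
  moreover have "cost t (merge_covers E C) \<le> cost t ?E1 + cost t ?C1"
    unfolding merge_covers_def by (rule cost_Un_le)
  ultimately have "cost t (merge_covers E C) + dyadic_content t A
      \<le> (cost t ?E1 + cost t ?C1) + (cost t ?E2 + cost t ?C2)"
    by (rule add_mono[rotated])
  also have "\<dots> = (cost t ?E1 + cost t ?E2) + (cost t ?C1 + cost t ?C2)"
    by (simp add: ac_simps)
  also have "cost t ?E1 + cost t ?E2 = cost t E"
    by (subst cost_Un_disjoint[symmetric]) (auto intro: arg_cong[where f="cost t"])
  also have "cost t ?C1 + cost t ?C2 = cost t C"
    by (subst cost_Un_disjoint[symmetric]) (auto intro: arg_cong[where f="cost t"])
  finally show ?thesis .
qed

text \<open>Near-optimal covers of the \<open>A n\<close> are merged successively. By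
  \<open>merge_covers_cost\<close> this accumulates only the errors of the single covers, and
  through each point some cell eventually stays forever, so the permanent cells cover the
  union.\<close>

lemma dyadic_content_incseq_UN:
  assumes inc: "incseq A"
  shows "dyadic_content t (\<Union>n. A n) = (SUP n. dyadic_content t (A n))"
proof (rule antisym)
  show "(SUP n. dyadic_content t (A n)) \<le> dyadic_content t (\<Union>n. A n)"
    by (intro SUP_least dyadic_content_mono) auto
  show "dyadic_content t (\<Union>n. A n) \<le> (SUP n. dyadic_content t (A n))"
  proof (rule ennreal_le_epsilon)
    fix e :: real assume e: "0 < e" and fin: "(SUP n. dyadic_content t (A n)) < top"
    have fin: "dyadic_content t (A n) < top" for n
      using fin by (meson SUP_upper UNIV_I order.strict_trans1)
    have "\<exists>C. A n \<subseteq> (\<Union>p\<in>C. cell p) \<and> cost t C < dyadic_content t (A n) + ennreal (e / 2 ^ Suc n)" for n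
    proof -
      have "dyadic_content t (A n) < dyadic_content t (A n) + ennreal (e / 2 ^ Suc n)"
        using fin[of n] e by (cases "dyadic_content t (A n)") (auto simp: ennreal_less_iff simp flip: ennreal_plus)
      then show ?thesis by (metis dyadic_content_less_imp_cover)
    qed
    then obtain C where C: "\<And>n. A n \<subseteq> (\<Union>p\<in>C n. cell p)"
      "\<And>n. cost t (C n) < dyadic_content t (A n) + ennreal (e / 2 ^ Suc n)"
      by metis
    define E where "E = rec_nat (C 0) (\<lambda>n X. merge_covers X (C (Suc n)))"
    have E0: "E 0 = C 0" and ES: "\<And>n. E (Suc n) = merge_covers (E n) (C (Suc n))"
      by (simp_all add: E_def)
    have Ecov: "A n \<subseteq> (\<Union>p\<in>E n. cell p)" for n
    proof (cases n)
      case 0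
      then show ?thesis using C(1)[of 0] by (simp add: E0)
    next
      case (Suc k)
      show ?thesis
      proof
        fix x assume "x \<in> A n"
        then obtain q where "q \<in> C n" "x \<in> cell q" using C(1) by blast
        then have "q \<in> E k \<union> C (Suc k)" using Suc by simp
        from this \<open>x \<in> cell q\<close> obtain r where "r \<in> E n" "x \<in> cell r"
          unfolding Suc ES by (rule merge_covers_coarsest)
        then show "x \<in> (\<Union>p\<in>E n. cell p)" by blast
      qed
    qed
    have Ecost: "cost t (E n) \<le> dyadic_content t (A n) + ennreal (e * (1 - 1 / 2 ^ Suc n))" for n
    proof (induction n)
      case 0
      then show ?case using C(2)[of 0] by (simp add: E0)
    next
      case (Suc n)
      have "cost t (E (Suc n)) + dyadic_content t (A n) \<le> cost t (E n) + cost t (C (Suc n))"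
        unfolding ES
        using C(1)[of "Suc n"] incseq_SucD[OF inc, of n] by (intro merge_covers_cost Ecov) blast
      also have "\<dots> \<le> (dyadic_content t (A n) + ennreal (e * (1 - 1 / 2 ^ Suc n)))
                      + (dyadic_content t (A (Suc n)) + ennreal (e / 2 ^ Suc (Suc n)))"
        using Suc C(2)[of "Suc n"] by (intro add_mono) auto
      also have "\<dots> = (dyadic_content t (A (Suc n)) + (ennreal (e * (1 - 1 / 2 ^ Suc n)) + ennreal (e / 2 ^ Suc (Suc n)))) + dyadic_content t (A n)"
        by (simp add: ac_simps)
      also have "ennreal (e * (1 - 1 / 2 ^ Suc n)) + ennreal (e / 2 ^ Suc (Suc n))
         = ennreal (e * (1 - 1 / 2 ^ Suc (Suc n)))"
      proof -
        have "(1::real) / 2 ^ Suc n \<le> 1"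
          using one_le_power[of "2::real" "Suc n"] by (simp add: divide_le_eq del: one_le_power)
        then have "0 \<le> e * (1 - 1 / 2 ^ Suc n)" using e by simp
        then have "ennreal (e * (1 - 1 / 2 ^ Suc n)) + ennreal (e / 2 ^ Suc (Suc n))
          = ennreal (e * (1 - 1 / 2 ^ Suc n) + e / 2 ^ Suc (Suc n))"
          using e by (subst ennreal_plus) auto
        also have "e * (1 - 1 / 2 ^ Suc n) + e / 2 ^ Suc (Suc n) = e * (1 - 1 / 2 ^ Suc (Suc n))"
          by (simp add: field_simps)
        finally show ?thesis .
      qed
      finally show ?case
        using fin[of n] by (auto simp: ennreal_add_left_cancel_le add.commute)
    qed
    \<comment> \<open>The lower limit of the sets \<open>E n\<close>. It is an increasing union of
      intersections, each no more expensive than a single \<open>E n\<close>.\<close>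
    let ?L = "\<Union>n. \<Inter>k\<in>{n..}. E k"
    have "(\<Union>n. A n) \<subseteq> (\<Union>p\<in>?L. cell p)"
    proof
      fix x assume "x \<in> (\<Union>n. A n)"
      then obtain N where N: "x \<in> A N" by blast
      \<comment> \<open>The levels reached at \<open>x\<close> from stage \<open>N\<close> on. A
        cell of the least such level survives every merge: the merged cover contains a cell through
        \<open>x\<close> of level no larger, minimality makes the levels equal, and a level
        determines the cell through \<open>x\<close>.\<close>
      define P where "P l \<longleftrightarrow> (\<exists>n\<ge>N. \<exists>p\<in>E n. x \<in> cell p \<and> fst p = l)" for l
      obtain q where "q \<in> E N" "x \<in> cell q" using Ecov[of N] N by blast
      then have "\<exists>l. P l" unfolding P_def by blast
      then have "P (LEAST l. P l)" by (rule LeastI_ex)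
      then obtain n p where p: "n \<ge> N" "p \<in> E n" "x \<in> cell p" "fst p = (LEAST l. P l)"
        by (auto simp: P_def)
      have "p \<in> E k" if "k \<ge> n" for k
        using that
      proof (induction k rule: dec_induct)
        case base
        then show ?case using p by simp
      next
        case (step k)
        have "p \<in> E k \<union> C (Suc k)" using step by simp
        then obtain r where r: "r \<in> E (Suc k)" "x \<in> cell r" "fst r \<le> fst p"
          unfolding ES using p(3) by (rule merge_covers_coarsest)
        have "N \<le> Suc k" using step(1) p(1) by simp
        then have "P (fst r)" using r unfolding P_def by blast
        with r have "fst r = fst p" using p(4) Least_le[of P "fst r"] by simp
        then have "r = p" using r p mem_cell_iff by metis
        then show ?case using r by simp
      qed
      then show "x \<in> (\<Union>p\<in>?L. cell p)" using p by blast
    qed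
    then have "dyadic_content t (\<Union>n. A n) \<le> cost t ?L" by (rule dyadic_content_le)
    also have "\<dots> = (SUP n. cost t (\<Inter>k\<in>{n..}. E k))"
      unfolding cost_def
      by (rule SUP_emeasure_incseq[symmetric]) (auto simp: incseq_def intro: order_trans)
    also have "\<dots> \<le> (SUP n. dyadic_content t (A n)) + ennreal e"
    proof (rule SUP_least)
      fix n
      have "cost t (\<Inter>k\<in>{n..}. E k) \<le> cost t (E n)" by (rule cost_mono) auto
      also have "\<dots> \<le> dyadic_content t (A n) + ennreal (e * (1 - 1 / 2 ^ Suc n))" by (rule Ecost)
      also have "\<dots> \<le> (SUP n. dyadic_content t (A n)) + ennreal e"
        using e by (intro add_mono SUP_upper ennreal_leI) auto
      finally show "cost t (\<Inter>k\<in>{n..}. E k) \<le> (SUP n. dyadic_content t (A n)) + ennreal e" .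
    qed
    finally show "dyadic_content t (\<Union>n. A n) \<le> (SUP n. dyadic_content t (A n)) + ennreal e" .
  qed
qed

section \<open>Null sets of dyadic content are Hausdorff null sets\<close>

lemma cell_eq: "cell (n, i) = {of_int i / 2 ^ n ..< (of_int i + 1) / 2 ^ n}"
proof -
  have "x \<in> cell (n, i) \<longleftrightarrow> of_int i \<le> 2 ^ n * x \<and> 2 ^ n * x < of_int i + 1" for x
    by (auto simp: cell_def floor_eq_iff)
  then show ?thesis
    by (intro set_eqI) (simp add: pos_divide_le_eq pos_less_divide_eq mult.commute)
qed

lemma cell_diameter: "bounded (cell p)" "diameter (cell p) \<le> 1 / 2 ^ fst p"
proof -
  obtain n i where p: "p = (n, i)" by force
  have "cell p \<subseteq> cbox (of_int i / 2 ^ n) ((of_int i + 1) / 2 ^ n)"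
    unfolding p cell_eq by auto
  then show "bounded (cell p)" by (meson bounded_cbox bounded_subset)
  show "diameter (cell p) \<le> 1 / 2 ^ fst p"
    unfolding p cell_eq by (rule diameter_le) (auto simp: abs_le_iff add_divide_distrib)
qed

lemma diam_pow_cell_le:
  assumes "0 < t"
  shows "diam_pow t (cell p) \<le> cell_cost t p"
proof -
  have "diameter (cell p) powr t \<le> (1 / 2 ^ fst p) powr t"
    using assms cell_diameter[of p] by (intro powr_mono2 diameter_ge_0) auto
  also have "(1 / 2 ^ fst p) powr t = 2 powr (- t * real (fst p))"
    by (simp add: powr_divide powr_powr powr_minus_divide mult.commute flip: powr_realpow)
  finally show ?thesis using assms by (auto simp: diam_pow_def intro: ennreal_leI)
qed

lemma cost_eq_suminf:
  "(\<Sum>i. cell_cost t (from_nat i) * indicator (to_nat ` C) i) = cost t C"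
  (is "(\<Sum>i. ?g i) = _")
proof -
  let ?w = "\<lambda>p :: nat \<times> int. cell_cost t p"
  have bij: "bij_betw to_nat C (to_nat ` C)"
    by (simp add: inj_on_imp_bij_betw)
  have "(\<Sum>i. ?g i) = (\<integral>\<^sup>+i. ?w (from_nat i) * indicator (to_nat ` C) i \<partial>count_space UNIV)"
    by (rule nn_integral_count_space_nat[symmetric])
  also have "\<dots> = (\<integral>\<^sup>+i. ?w (from_nat i) \<partial>count_space (to_nat ` C))"
    by (rule nn_integral_count_space_indicator[symmetric]) auto
  also have "\<dots> = (\<integral>\<^sup>+p. ?w (from_nat (to_nat p)) \<partial>count_space C)"
    by (rule nn_integral_bij_count_space[OF bij, symmetric])
  also have "\<dots> = cost t C"
    unfolding cost_eq_nn_integral by (simp add: nn_integral_count_space_indicator)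
  finally show ?thesis .
qed

text \<open>The cost of a single cell determines its diameter, so a cheap cover has only small
  cells. This is why null content, defined without any mesh bound, forces null Hausdorff
  measure.\<close>

lemma hausdorff_measure_eq_0_if_dyadic_content:
  assumes t: "0 < t" and F: "dyadic_content t F = 0"
  shows "hausdorff_measure t F = 0"
proof -
  have "hausdorff_content t \<delta> F = 0" if \<delta>: "\<delta> > 0" for \<delta>
  proof -
    have "hausdorff_content t \<delta> F \<le> 0"
    proof (rule ennreal_le_epsilon)
      fix e :: real assume e: "0 < e"
      \<comment> \<open>The second entry of the minimum keeps every cell of the cover below diameter
        \<delta>.\<close>
      have "dyadic_content t F < ennreal (min e (\<delta> powr t))" using F e \<delta> by simp
      then obtain C where C: "F \<subseteq> (\<Union>p\<in>C. cell p)" "cost t C < ennreal (min e (\<delta> powr t))"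
        by (rule dyadic_content_less_imp_cover)
      define U where "U i = (if i \<in> to_nat ` C then cell (from_nat i) else {})" for i
      have small: "1 / 2 ^ fst p \<le> \<delta>" if "p \<in> C" for p
      proof -
        have "cell_cost t p \<le> cost t C"
          using cost_mono[of "{p}" C t] that by (simp add: cost_singleton)
        also have "\<dots> < ennreal (\<delta> powr t)"
          using C(2) by (rule order.strict_trans2) (simp add: ennreal_leI)
        finally have "2 powr (- t * real (fst p)) < \<delta> powr t"
          by (simp add: ennreal_less_iff)
        then have "(2 powr (- real (fst p))) powr t < \<delta> powr t"
          by (simp add: powr_powr mult.commute)
        then have "2 powr (- real (fst p)) < \<delta>"
          using t \<delta> by (meson not_le powr_ge_zero powr_mono2 less_imp_le)
        then show ?thesis by (simp add: powr_minus_divide powr_realpow)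
      qed
      have "F \<subseteq> (\<Union>i. U i)"
      proof
        fix x assume "x \<in> F"
        then obtain p where "p \<in> C" "x \<in> cell p" using C(1) by blast
        then have "x \<in> U (to_nat p)" by (simp add: U_def)
        then show "x \<in> (\<Union>i. U i)" by blast
      qed
      moreover have "bounded (U i) \<and> diameter (U i) \<le> \<delta>" for i
        using small cell_diameter \<delta> by (fastforce simp: U_def intro: order_trans)
      ultimately have "hausdorff_content t \<delta> F \<le> (\<Sum>i. diam_pow t (U i))"
        unfolding hausdorff_content_def by (intro Inf_lower) blast
      also have "\<dots> \<le> (\<Sum>i. cell_cost t (from_nat i) * indicator (to_nat ` C) i)"
      proof (rule suminf_le)
        show "diam_pow t (U i) \<le> cell_cost t (from_nat i) * indicator (to_nat ` C) i" for i
          using diam_pow_cell_le[OF t, of "from_nat i"]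
          by (cases "i \<in> to_nat ` C") (simp_all add: U_def diam_pow_def[of _ "{}"])
      qed auto
      also have "\<dots> = cost t C" by (rule cost_eq_suminf)
      also have "\<dots> \<le> ennreal e"
        using C(2) by (rule order.trans[OF less_imp_le]) (simp add: ennreal_leI)
      finally show "hausdorff_content t \<delta> F \<le> 0 + ennreal e" by simp
    qed
    then show ?thesis by simp
  qed
  then show ?thesis unfolding hausdorff_measure_def by simp
qed

section \<open>Borel sets as projections of closed sets\<close>

definition analytic :: "real set \<Rightarrow> bool" where
  "analytic A \<longleftrightarrow> (\<exists>P :: (real \<times> (nat \<Rightarrow> nat)) set. closed P \<and> A = fst ` P)"

lemma closed_imp_analytic: "closed A \<Longrightarrow> analytic A"
  unfolding analytic_def by (rule exI[of _ "A \<times> UNIV"]) (auto simp: closed_Times)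

lemma continuous_on_snd_apply: "continuous_on UNIV (\<lambda>z :: real \<times> (nat \<Rightarrow> nat). snd z i)"
  by (rule continuous_on_product_then_coordinatewise) (intro continuous_intros)

lemma analytic_UN:
  assumes "\<And>n::nat. analytic (A n)"
  shows "analytic (\<Union>n. A n)"
proof -
  obtain P where P: "\<And>n. closed (P n :: (real \<times> (nat \<Rightarrow> nat)) set)" "\<And>n. A n = fst ` P n"
    using assms unfolding analytic_def by metis
  \<comment> \<open>Coordinate 0 of the code names one of the sets, and the remaining coordinates
    are a code for membership in it.\<close>
  define Q where "Q = {z :: real \<times> (nat \<Rightarrow> nat). (fst z, \<lambda>k. snd z (Suc k)) \<in> P (snd z 0)}"
  have "Q = (\<Inter>n. (\<lambda>z. snd z 0) -` (- {n}) \<union> (\<lambda>z. (fst z, \<lambda>k. snd z (Suc k))) -` P n)"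
    by (auto simp: Q_def)
  moreover have "closed \<dots>"
    by (intro closed_INT ballI closed_Un closed_vimage P continuous_on_snd_apply continuous_intros
        continuous_on_coordinatewise_then_product) (auto intro: Topological_Spaces.open_discrete)
  ultimately have "closed Q" by simp
  moreover have "(\<Union>n. A n) = fst ` Q"
  proof (intro equalityI subsetI)
    fix x assume "x \<in> (\<Union>n. A n)"
    then obtain n \<sigma> where "(x, \<sigma>) \<in> P n" by (auto simp: P)
    then have "(x, case_nat n \<sigma>) \<in> Q" by (simp add: Q_def)
    then show "x \<in> fst ` Q" by force
  next
    fix x assume "x \<in> fst ` Q"
    then obtain \<sigma> where "(x, \<lambda>k. \<sigma> (Suc k)) \<in> P (\<sigma> 0)" by (auto simp: Q_def)
    then have "x \<in> A (\<sigma> 0)" unfolding P by (metis fst_conv imageI)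
    then show "x \<in> (\<Union>n. A n)" by blast
  qed
  ultimately show ?thesis unfolding analytic_def by blast
qed

lemma analytic_INT:
  assumes "\<And>n::nat. analytic (A n)"
  shows "analytic (\<Inter>n. A n)"
proof -
  obtain P where P: "\<And>n. closed (P n :: (real \<times> (nat \<Rightarrow> nat)) set)" "\<And>n. A n = fst ` P n"
    using assms unfolding analytic_def by metis
  \<comment> \<open>Infinitely many codes are packed into one sequence by the pairing of naturals,
    while the real coordinate is shared.\<close>
  define Q where "Q = {z :: real \<times> (nat \<Rightarrow> nat). \<forall>n. (fst z, \<lambda>k. snd z (prod_encode (n, k))) \<in> P n}"
  have "Q = (\<Inter>n. (\<lambda>z. (fst z, \<lambda>k. snd z (prod_encode (n, k)))) -` P n)"
    by (auto simp: Q_def)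
  moreover have "closed \<dots>"
    by (intro closed_INT ballI closed_vimage P continuous_on_snd_apply continuous_intros
        continuous_on_coordinatewise_then_product)
  ultimately have "closed Q" by simp
  moreover have "(\<Inter>n. A n) = fst ` Q"
  proof (intro equalityI subsetI)
    fix x assume "x \<in> (\<Inter>n. A n)"
    then have "\<forall>n. \<exists>\<sigma>. (x, \<sigma>) \<in> P n" by (force simp: P)
    then obtain \<sigma> where \<sigma>: "\<And>n. (x, \<sigma> n) \<in> P n" by metis
    have "(x, \<lambda>i. case prod_decode i of (n, k) \<Rightarrow> \<sigma> n k) \<in> Q" using \<sigma> by (simp add: Q_def)
    then show "x \<in> fst ` Q" by force
  next
    fix x assume "x \<in> fst ` Q"
    then obtain \<sigma> where \<sigma>: "\<And>n. (x, \<lambda>k. \<sigma> (prod_encode (n, k))) \<in> P n" by (auto simp: Q_def)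
    have "x \<in> A n" for n using \<sigma>[of n] unfolding P by (metis fst_conv imageI)
    then show "x \<in> (\<Inter>n. A n)" by blast
  qed
  ultimately show ?thesis unfolding analytic_def by blast
qed

text \<open>Projections of closed sets are not closed under complement, so the induction carries the
  complement along. Complementation then just swaps the two claims, and a union needs both
  \<open>analytic_UN\<close> and \<open>analytic_INT\<close>.\<close>

lemma borel_imp_analytic:
  assumes "F \<in> sets (borel :: real measure)"
  shows "analytic F"
proof -
  have "F \<in> sigma_sets UNIV (range (\<lambda>a::real. {..a}))"
    using assms by (simp add: borel_eq_atMost)
  then have "analytic F \<and> analytic (- F)"
  proof induction
    case (Basic A)
    then obtain a where A: "A = {..a}" by auto
    have "- A = (\<Union>n::nat. {a + 1 / real (Suc n)..})"
    proof (intro equalityI subsetI)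
      fix x assume "x \<in> - A"
      then have "0 < x - a" by (simp add: A)
      then obtain n where "1 / real (Suc n) < x - a"
        using nat_approx_posE by blast
      then show "x \<in> (\<Union>n::nat. {a + 1 / real (Suc n)..})" by (auto intro!: exI[of _ n])
    next
      fix x assume "x \<in> (\<Union>n::nat. {a + 1 / real (Suc n)..})"
      then obtain n where "a + 1 / real (Suc n) \<le> x" by auto
      moreover have "0 < 1 / real (Suc n)" by simp
      ultimately have "a < x" by linarith
      then show "x \<in> - A" by (simp add: A)
    qed
    moreover have "analytic \<dots>"
      by (intro analytic_UN closed_imp_analytic) auto
    ultimately show ?case using A by (simp add: closed_imp_analytic)
  next
    case Empty
    then show ?case by (simp add: closed_imp_analytic)
  next
    case (Compl A)
    then show ?case by (simp add: Compl_eq_Diff_UNIV[symmetric])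
  next
    case (Union A)
    then show ?case by (simp add: Compl_UN analytic_UN analytic_INT)
  qed
  then show ?thesis by simp
qed

section \<open>Compact subsets of positive content\<close>

lemma cost_bij_image:
  assumes "bij f" "\<And>p. fst (f p) = fst p"
  shows "cost t (f ` C) = cost t C"
proof -
  let ?w = "\<lambda>p :: nat \<times> int. cell_cost t p"
  have "cost t (f ` C) = (\<integral>\<^sup>+p. ?w (f p) * indicator (f ` C) (f p) \<partial>count_space UNIV)"
    unfolding cost_eq_nn_integral using assms(1) by (intro nn_integral_bij_count_space[symmetric])
  also have "\<dots> = cost t C"
    unfolding cost_eq_nn_integral using assms
    by (intro nn_integral_cong) (auto simp: indicator_def inj_image_mem_iff[OF bij_is_inj])
  finally show ?thesis .
qed

lemma cell_neighbours:
  "{(of_int i - 1) / 2 ^ n <..< (of_int i + 2) / 2 ^ n} \<subseteq> cell (n, i - 1) \<union> cell (n, i) \<union> cell (n, i + 1)"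
  unfolding cell_eq by (auto simp: algebra_simps)

(* Dyadic intervals are half open, so a cover is enlarged by the two neighbours of each
   interval to become a neighbourhood; this costs the factor 3. *)
lemma dyadic_content_open_nbhd:
  assumes "\<And>U. open U \<Longrightarrow> K \<subseteq> U \<Longrightarrow> c \<le> dyadic_content t U"
  shows "c \<le> 3 * dyadic_content t K"
proof (rule ccontr)
  assume "\<not> c \<le> 3 * dyadic_content t K"
  then have "3 * dyadic_content t K < c" by simp
  moreover have "3 * (c / 3) = c" by (simp add: ennreal_times_divide mult.commute ennreal_mult_divide_eq)
  ultimately have "3 * dyadic_content t K < 3 * (c / 3)" by simp
  then have "dyadic_content t K < c / 3" by (metis mult_left_mono not_le zero_le)
  then obtain C where C: "K \<subseteq> (\<Union>p\<in>C. cell p)" "cost t C < c / 3"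
    by (rule dyadic_content_less_imp_cover)
  define U where "U = (\<Union>(n, i)\<in>C. {(of_int i - 1) / 2 ^ n <..< (of_int i + 2) / 2 ^ n :: real})"
  define L where "L = (\<lambda>(n::nat, i::int). (n, i - 1))"
  define R where "R = (\<lambda>(n::nat, i::int). (n, i + 1))"
  have bij: "bij L" "bij R"
    unfolding L_def R_def
    by (intro o_bij[where g="\<lambda>(n, i). (n, i + 1)"] o_bij[where g="\<lambda>(n, i). (n, i - 1)"]; auto)+
  have "open U" unfolding U_def by auto
  moreover have "K \<subseteq> U"
  proof
    fix x assume "x \<in> K"
    then obtain n i where "(n, i) \<in> C" "x \<in> cell (n, i)" using C(1) by fast
    moreover from this have "x \<in> {(of_int i - 1) / 2 ^ n <..< (of_int i + 2) / 2 ^ n}"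
      unfolding cell_eq by (simp add: field_simps)
    ultimately show "x \<in> U" unfolding U_def by blast
  qed
  ultimately have "c \<le> dyadic_content t U" by (rule assms)
  also have "U \<subseteq> (\<Union>p\<in>L ` C \<union> C \<union> R ` C. cell p)"
  proof
    fix x assume "x \<in> U"
    then obtain n i where "(n, i) \<in> C" "x \<in> {(of_int i - 1) / 2 ^ n <..< (of_int i + 2) / 2 ^ n}"
      unfolding U_def by blast
    then have "x \<in> cell (L (n, i)) \<union> cell (n, i) \<union> cell (R (n, i))"
      using subsetD[OF cell_neighbours[of i n], of x] by (simp add: L_def R_def)
    with \<open>(n, i) \<in> C\<close> show "x \<in> (\<Union>p\<in>L ` C \<union> C \<union> R ` C. cell p)" by blast
  qed
  then have "dyadic_content t U \<le> cost t (L ` C \<union> C \<union> R ` C)" by (rule dyadic_content_le)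
  also have "\<dots> \<le> cost t (L ` C) + cost t C + cost t (R ` C)"
    by (meson add_mono cost_Un_le order_refl order_trans)
  also have "\<dots> = 3 * cost t C"
  proof -
    have "cost t (L ` C) = cost t C" "cost t (R ` C) = cost t C"
      using bij by (auto intro!: cost_bij_image simp: L_def R_def split_def)
    moreover have "cost t C + cost t C + cost t C = (1 + 1 + 1) * cost t C"
      by (simp only: distrib_right mult_1)
    ultimately show ?thesis by simp
  qed
  also have "\<dots> < 3 * (c / 3)"
    using C(2) by (intro ennreal_mult_strict_left_mono) auto
  finally show False using \<open>3 * (c / 3) = c\<close> by simp
qed

text \<open>By continuity along an exhaustion some bounded piece of \<open>F\<close> has positive
  content, and finitely many unit cells meet that piece, so finite subadditivity finishes.\<close>

lemma dyadic_content_cell_pos: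
  assumes "dyadic_content t F \<noteq> 0"
  obtains j where "dyadic_content t (F \<inter> cell (0, j)) \<noteq> 0"
proof -
  have "F = (\<Union>n. F \<inter> {- real n .. real n})"
  proof -
    have "\<exists>n. - real n \<le> x \<and> x \<le> real n" for x
      using real_arch_simple[of "\<bar>x\<bar>"] by (auto simp: abs_le_iff) (metis minus_le_iff)
    then show ?thesis by auto
  qed
  then have "dyadic_content t F = (SUP n. dyadic_content t (F \<inter> {- real n .. real n}))"
    by (subst dyadic_content_incseq_UN[symmetric]) (auto simp: incseq_def)
  then have "\<exists>N. dyadic_content t (F \<inter> {- real N .. real N}) \<noteq> 0"
    using assms by (intro ccontr[of "\<exists>N. _ N"]) simp
  then obtain N where N: "dyadic_content t (F \<inter> {- real N .. real N}) \<noteq> 0" ..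
  have zero: "dyadic_content t (\<Union>j\<in>J. F \<inter> cell (0, j)) = 0"
    if "finite J" "\<And>j. dyadic_content t (F \<inter> cell (0, j)) = 0" for J
    using that(1)
  proof induction
    case (insert j J)
    have "dyadic_content t (\<Union>j\<in>insert j J. F \<inter> cell (0, j)) \<le>
        dyadic_content t (F \<inter> cell (0, j)) + dyadic_content t (\<Union>j\<in>J. F \<inter> cell (0, j))"
      by (simp add: dyadic_content_Un_le)
    then show ?case using insert that(2) by simp
  qed simp
  have "F \<inter> {- real N .. real N} \<subseteq> (\<Union>j\<in>{-int N..int N}. F \<inter> cell (0, j))"
  proof
    fix x assume x: "x \<in> F \<inter> {- real N .. real N}"
    then have "\<lfloor>x\<rfloor> \<in> {-int N..int N}" by (auto simp: le_floor_iff floor_le_iff)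
    then show "x \<in> (\<Union>j\<in>{-int N..int N}. F \<inter> cell (0, j))" using x by (auto simp: cell_def)
  qed
  from dyadic_content_mono[OF this, of t]
  have "dyadic_content t (\<Union>j\<in>{-int N..int N}. F \<inter> cell (0, j)) \<noteq> 0"
    using N by (intro notI) simp
  then have "\<exists>j. dyadic_content t (F \<inter> cell (0, j)) \<noteq> 0"
    using zero[of "{-int N..int N}"] by blast
  with that show ?thesis by blast
qed

lemma compact_bounded_sequences: "compact {\<sigma> :: nat \<Rightarrow> nat. \<forall>i. \<sigma> i \<le> b i}"
proof -
  have "compactin (product_topology (\<lambda>_::nat. euclidean) UNIV) (PiE UNIV (\<lambda>i. {..b i}))"
    unfolding compactin_PiE by (simp add: finite_imp_compact)
  moreover have "PiE UNIV (\<lambda>i. {..b i}) = {\<sigma> :: nat \<Rightarrow> nat. \<forall>i. \<sigma> i \<le> b i}"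
    by (auto simp: PiE_def Pi_def)
  ultimately show ?thesis by (simp add: euclidean_product_topology)
qed

text \<open>The argument of Choquet's capacitability theorem: the coordinates of the code are
  bounded one after another, each time keeping the content above \<open>c\<close>, and the codes
  below the resulting sequence form a compact set. Continuity along decreasing sequences is replaced
  by a comparison with open neighbourhoods, as in \<open>dyadic_content_open_nbhd\<close>.\<close>

lemma compact_subset_pos_content:
  assumes F: "F \<in> sets borel" "F \<subseteq> cell (0, j)" and pos: "dyadic_content t F \<noteq> 0"
  obtains K where "compact K" "K \<subseteq> F" "dyadic_content t K \<noteq> 0"
proof -
  obtain P :: "(real \<times> (nat \<Rightarrow> nat)) set" where P: "closed P" "F = fst ` P"
    using borel_imp_analytic[OF F(1)] unfolding analytic_def by blast
  have "0 < dyadic_content t F" using pos by (simp add: zero_less_iff_neq_zero)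
  \<comment> \<open>Strictness lets the same \<open>c\<close> serve at every step: an increasing
    supremum above \<open>c\<close> has a member above \<open>c\<close>.\<close>
  then obtain c where c: "0 < c" "c < dyadic_content t F" using dense by blast
  define A where "A \<sigma> k = fst ` {z \<in> P. \<forall>i<k. snd z i \<le> \<sigma> i}" for \<sigma> and k :: nat
  have step: "\<exists>v. c < dyadic_content t (A (\<sigma>(k := v)) (Suc k))"
    if "c < dyadic_content t (A \<sigma> k)" for \<sigma> k
  proof -
    have "incseq (\<lambda>v. A (\<sigma>(k := v)) (Suc k))"
    proof (rule incseq_SucI, rule subsetI)
      fix v x assume "x \<in> A (\<sigma>(k := v)) (Suc k)"
      then obtain z where "z \<in> P" "x = fst z" "\<forall>i<Suc k. snd z i \<le> (\<sigma>(k := v)) i"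
        unfolding A_def by blast
      moreover from this have "\<forall>i<Suc k. snd z i \<le> (\<sigma>(k := Suc v)) i"
        by (auto simp: less_Suc_eq)
      ultimately show "x \<in> A (\<sigma>(k := Suc v)) (Suc k)" unfolding A_def by blast
    qed
    moreover have "A \<sigma> k \<subseteq> (\<Union>v. A (\<sigma>(k := v)) (Suc k))"
    proof
      fix x assume "x \<in> A \<sigma> k"
      then obtain z where z: "z \<in> P" "x = fst z" "\<forall>i<k. snd z i \<le> \<sigma> i"
        unfolding A_def by blast
      then have "\<forall>i<Suc k. snd z i \<le> (\<sigma>(k := snd z k)) i" by (auto simp: less_Suc_eq)
      with z have "x \<in> A (\<sigma>(k := snd z k)) (Suc k)" unfolding A_def by blast
      then show "x \<in> (\<Union>v. A (\<sigma>(k := v)) (Suc k))" by blast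
    qed
    ultimately have "c < (SUP v. dyadic_content t (A (\<sigma>(k := v)) (Suc k)))"
      using that dyadic_content_mono by (metis dyadic_content_incseq_UN order.strict_trans2)
    then show ?thesis by (simp add: less_SUP_iff)
  qed
  have "\<exists>s. \<forall>k. c < dyadic_content t (A (s k) k) \<and> (\<exists>v. s (Suc k) = (s k)(k := v))"
  proof (rule dependent_nat_choice)
    show "\<exists>x. c < dyadic_content t (A x 0)" using c by (simp add: A_def P(2))
  next
    fix x k assume "c < dyadic_content t (A x k)"
    from step[OF this] show "\<exists>y. c < dyadic_content t (A y (Suc k)) \<and> (\<exists>v. y = x(k := v))" by blast
  qed
  then obtain s where s: "\<And>k. c < dyadic_content t (A (s k) k)" "\<And>k. \<exists>v. s (Suc k) = (s k)(k := v)"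
    by blast
  \<comment> \<open>Step \<open>k\<close> changes coordinate \<open>k\<close> only, so coordinate
    \<open>i\<close> is final from stage \<open>Suc i\<close> on.\<close>
  define \<sigma> where "\<sigma> i = s (Suc i) i" for i
  have s_eq: "s k i = \<sigma> i" if "i < k" for i k
    using that
  proof (induction k)
    case (Suc k)
    then show ?case
      using s(2)[of k] by (cases "i = k") (auto simp: \<sigma>_def)
  qed simp
  have Ac: "c < dyadic_content t (A \<sigma> k)" for k
  proof -
    have "A (s k) k = A \<sigma> k" unfolding A_def using s_eq by auto
    then show ?thesis using s(1)[of k] by simp
  qed
  have PF: "fst z \<in> {of_int j..of_int j + 1}" if "z \<in> P" for z
  proof -
    have "fst z \<in> cell (0, j)" using that P F by blast
    then show ?thesis by (auto simp: cell_eq)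
  qed
  define K where "K = fst ` (P \<inter> ({of_int j..of_int j + 1} \<times> {\<tau>. \<forall>i. \<tau> i \<le> \<sigma> i}))"
  have "compact K"
    unfolding K_def
    by (intro compact_continuous_image closed_Int_compact P compact_Times compact_bounded_sequences
        compact_Icc continuous_intros)
  moreover have "K \<subseteq> F" unfolding K_def P by blast
  moreover have "c \<le> 3 * dyadic_content t K"
  proof (rule dyadic_content_open_nbhd)
    fix U assume U: "open U" "K \<subseteq> U"
    have "\<exists>k. A \<sigma> k \<subseteq> U"
    proof (rule ccontr)
      assume "\<nexists>k. A \<sigma> k \<subseteq> U"
      then have "\<forall>k. \<exists>z. z \<in> P \<and> (\<forall>i<k. snd z i \<le> \<sigma> i) \<and> fst z \<notin> U"
        unfolding A_def by blast
      then obtain z where z: "\<And>k. z k \<in> P" "\<And>k i. i < k \<Longrightarrow> snd (z k) i \<le> \<sigma> i" "\<And>k. fst (z k) \<notin> U"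
        by metis
      \<comment> \<open>Coordinate \<open>i\<close> of \<open>z k\<close> is at most
        \<open>\<sigma> i\<close> once \<open>k > i\<close>. The finitely many earlier terms are
        absorbed by the sum, so the whole sequence lies in a compact set and has a limit
        point.\<close>
      define b where "b i = \<sigma> i + (\<Sum>k\<le>i. snd (z k) i)" for i
      have "snd (z k) i \<le> b i" for k i
      proof (cases "i < k")
        case True
        then show ?thesis using z(2)[of i k] by (simp add: b_def)
      next
        case False
        then have "snd (z k) i \<le> (\<Sum>k\<le>i. snd (z k) i)" by (intro member_le_sum) auto
        then show ?thesis by (simp add: b_def)
      qed
      then have zb: "z k \<in> {of_int j..of_int j + 1} \<times> {\<tau>. \<forall>i. \<tau> i \<le> b i}" for k
        using PF[OF z(1)[of k]] by (auto simp: mem_Times_iff)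
      have "seq_compact ({of_int j..of_int j + 1 :: real} \<times> {\<tau>. \<forall>i. \<tau> i \<le> b i})"
        by (intro compact_imp_seq_compact compact_Times compact_bounded_sequences compact_Icc)
      moreover have "\<forall>k. z k \<in> {of_int j..of_int j + 1 :: real} \<times> {\<tau>. \<forall>i. \<tau> i \<le> b i}"
        using zb by blast
      ultimately obtain w r where r: "strict_mono r" "(z \<circ> r) \<longlonglongrightarrow> w"
        by (rule seq_compactE)
      have w: "w \<in> P"
        using P(1) r(2) z(1) closed_sequentially[of P "z \<circ> r" w] by simp
      have "fst w \<in> - U"
        using U(1) tendsto_fst[OF r(2)] z(3) closed_sequentially[of "- U" "\<lambda>n. fst ((z \<circ> r) n)" "fst w"]
        by (simp add: closed_Compl)
      moreover have "snd w i \<le> \<sigma> i" for i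
      proof (rule Lim_bounded)
        show "(\<lambda>n. snd ((z \<circ> r) n) i) \<longlonglongrightarrow> snd w i"
          using continuous_on_tendsto_compose[OF continuous_on_snd_apply r(2)] by simp
        show "\<forall>n\<ge>Suc i. snd ((z \<circ> r) n) i \<le> \<sigma> i"
        proof safe
          fix n assume "Suc i \<le> n"
          then have "i < r n" using seq_suble[OF r(1), of n] by simp
          then show "snd ((z \<circ> r) n) i \<le> \<sigma> i" using z(2) by simp
        qed
      qed
      then have "fst w \<in> K"
        unfolding K_def using w PF[OF w] by (intro imageI) (auto simp: mem_Times_iff)
      ultimately show False using U(2) by blast
    qed
    then show "c \<le> dyadic_content t U"
      using Ac by (meson dyadic_content_mono less_imp_le order_trans)
  qed
  then have "dyadic_content t K \<noteq> 0" using c(1) by auto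
  ultimately show ?thesis using that by blast
qed

section \<open>Frostman's lemma\<close>

locale frostman_construction =
  fixes K :: "real set" and t :: real and j :: int
  assumes t: "0 < t" and K_cell: "K \<subseteq> cell (0, j)" and K_pos: "dyadic_content t K \<noteq> 0"
    and K_compact: "compact K"
begin

definition k :: "nat \<Rightarrow> int \<Rightarrow> real" where
  "k n i = enn2real (dyadic_content t (K \<inter> cell (n, i)))"

lemma content_le_powr: "dyadic_content t (K \<inter> cell (n, i)) \<le> ennreal (2 powr (- t * real n))"
  using dyadic_content_le[of "K \<inter> cell (n, i)" "{(n, i)}" t] by (simp add: cost_singleton)

lemma content_eq_k: "dyadic_content t (K \<inter> cell (n, i)) = ennreal (k n i)"
  unfolding k_def using order.strict_trans1[OF content_le_powr ennreal_less_top, of n i]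
  by (rule ennreal_enn2real[symmetric])

lemma k_nonneg: "0 \<le> k n i"
  by (simp add: k_def)

lemma k_le: "k n i \<le> 2 powr (- t * real n)"
  using content_le_powr[of n i] unfolding content_eq_k by simp

lemma k_empty: "K \<inter> cell (n, i) = {} \<Longrightarrow> k n i = 0"
  by (simp add: k_def)

lemma cell_split: "cell (n, i) = cell (Suc n, 2 * i) \<union> cell (Suc n, 2 * i + 1)"
proof -
  have "\<lfloor>2 ^ n * x\<rfloor> = \<lfloor>2 ^ Suc n * x\<rfloor> div 2" for x :: real
    using floor_coarsen[of n x 1] by simp
  then show ?thesis by (auto simp: cell_def)
qed

lemma k_subadd: "k n i \<le> k (Suc n) (2 * i) + k (Suc n) (2 * i + 1)"
proof -
  have "dyadic_content t (K \<inter> cell (n, i)) \<le>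
      dyadic_content t (K \<inter> cell (Suc n, 2 * i)) + dyadic_content t (K \<inter> cell (Suc n, 2 * i + 1))"
    using dyadic_content_Un_le by (metis Int_Un_distrib cell_split)
  then show ?thesis unfolding content_eq_k
    by (simp add: k_nonneg flip: ennreal_plus)
qed

  (* The inequality m <= k is preserved because k is subadditive; where both children have
     k = 0 the quotient is 0 / 0 = 0, and then m vanishes on the parent as well. *)
primrec m :: "nat \<Rightarrow> int \<Rightarrow> real" where
  "m 0 i = k 0 i"
| "m (Suc n) i = m n (i div 2) * (k (Suc n) i /
     (k (Suc n) (2 * (i div 2)) + k (Suc n) (2 * (i div 2) + 1)))"

lemma m_bounds: "0 \<le> m n i \<and> m n i \<le> k n i"
proof (induction n arbitrary: i)
  case (Suc n)
  define s where "s = k (Suc n) (2 * (i div 2)) + k (Suc n) (2 * (i div 2) + 1)"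
  have s: "0 \<le> s" unfolding s_def using k_nonneg by simp
  have "m n (i div 2) \<le> s" unfolding s_def using Suc k_subadd order_trans by blast
  then have "m n (i div 2) * (k (Suc n) i / s) \<le> k (Suc n) i"
    using k_nonneg[of "Suc n" i] s mult_right_mono[of "m n (i div 2)" s "k (Suc n) i"]
    by (cases "s = 0") (simp_all add: pos_divide_le_eq mult.commute)
  moreover have "0 \<le> m n (i div 2) * (k (Suc n) i / s)"
    using Suc k_nonneg s by (intro mult_nonneg_nonneg divide_nonneg_nonneg) auto
  ultimately show ?case by (simp add: s_def)
qed (simp add: k_nonneg)

lemma m_nonneg: "0 \<le> m n i" and m_le: "m n i \<le> k n i"
  using m_bounds by auto

lemma m_split: "m n i = m (Suc n) (2 * i) + m (Suc n) (2 * i + 1)"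
proof (cases "k (Suc n) (2 * i) + k (Suc n) (2 * i + 1) = 0")
  case True
  then have "m n i = 0" using m_le[of n i] k_subadd[of n i] m_nonneg[of n i] by simp
  then show ?thesis by simp
next
  case False
  then have "k (Suc n) (2 * i) / (k (Suc n) (2 * i) + k (Suc n) (2 * i + 1)) +
      k (Suc n) (2 * i + 1) / (k (Suc n) (2 * i) + k (Suc n) (2 * i + 1)) = 1"
    by (simp flip: add_divide_distrib)
  then have "m n i * (k (Suc n) (2 * i) / (k (Suc n) (2 * i) + k (Suc n) (2 * i + 1)) +
      k (Suc n) (2 * i + 1) / (k (Suc n) (2 * i) + k (Suc n) (2 * i + 1))) = m n i"
    by simp
  then show ?thesis by (simp add: distrib_left)
qed

text \<open>The mass of the level \<open>n\<close> cells to the left of \<open>b / 2 ^ n\<close>,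
  that is, a distribution function sampled at level \<open>n\<close>. The sum starts at the left end
  of the unit cell that contains \<open>K\<close>.\<close>

definition S :: "nat \<Rightarrow> int \<Rightarrow> real" where
  "S n b = (\<Sum>i\<in>{j * 2 ^ n..<b}. m n i)"

lemma S_mono: "a \<le> b \<Longrightarrow> S n a \<le> S n b"
  unfolding S_def by (intro sum_mono2) (auto simp: m_nonneg)

lemma S_nonneg: "0 \<le> S n b"
  unfolding S_def by (intro sum_nonneg m_nonneg)

lemma S_Suc_le: "S n (b + 1) \<le> S n b + m n b"
proof (cases "j * 2 ^ n \<le> b")
  case True
  then have "{j * 2 ^ n..<b + 1} = insert b {j * 2 ^ n..<b}" by auto
  then show ?thesis by (simp add: S_def)
next
  case False
  then have "{j * 2 ^ n..<b + 1} = {}" by auto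
  then show ?thesis using S_nonneg[of n b] m_nonneg[of n b] by (simp add: S_def)
qed

lemma S_double: "S (Suc n) (2 * b) = S n b"
proof (cases "j * 2 ^ n \<le> b")
  case True
  then show ?thesis
  proof (induction b rule: int_ge_induct)
    case base
    then show ?case by (simp add: S_def)
  next
    case (step b)
    have "{j * 2 ^ Suc n..<2 * (b + 1)} = insert (2 * b) (insert (2 * b + 1) {j * 2 ^ Suc n..<2 * b})"
      "{j * 2 ^ n..<b + 1} = insert b {j * 2 ^ n..<b}"
      using step by auto
    then show ?case using step m_split[of n b] by (simp add: S_def del: m.simps)
  qed
next
  case False
  then show ?thesis by (simp add: S_def)
qed

definition G_level :: "nat \<Rightarrow> real \<Rightarrow> real" where
  "G_level n x = S n \<lfloor>2 ^ n * x\<rfloor>"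

text \<open>The two ends of the cell through \<open>x\<close> give a lower and an upper estimate of
  the distribution function. Refinement raises the first and lowers the second.\<close>

lemma S_floor_refine:
  fixes x :: real
  shows "S n \<lfloor>2 ^ n * x\<rfloor> \<le> S (n + d) \<lfloor>2 ^ (n + d) * x\<rfloor> \<and>
   S (n + d) (\<lfloor>2 ^ (n + d) * x\<rfloor> + 1) \<le> S n (\<lfloor>2 ^ n * x\<rfloor> + 1)"
proof (induction d)
  case (Suc d)
  define b where "b = \<lfloor>2 ^ (n + d) * x\<rfloor>"
  define c where "c = \<lfloor>2 ^ (n + Suc d) * x\<rfloor>"
  have "b = c div 2"
    unfolding b_def c_def using floor_coarsen[of "n + d" x 1] by simp
  then have "2 * b \<le> c" "c + 1 \<le> 2 * (b + 1)" by presburger+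
  then have "S (n + d) b \<le> S (n + Suc d) c" "S (n + Suc d) (c + 1) \<le> S (n + d) (b + 1)"
    using S_mono S_double by (metis add_Suc_right)+
  then show ?case using Suc unfolding b_def c_def by linarith
qed simp

lemma G_level_bounds:
  assumes "n \<le> l"
  shows "S n \<lfloor>2 ^ n * x\<rfloor> \<le> G_level l x" "G_level l x \<le> S n (\<lfloor>2 ^ n * x\<rfloor> + 1)"
proof -
  obtain d where d: "l = n + d" using assms le_Suc_ex by blast
  show "S n \<lfloor>2 ^ n * x\<rfloor> \<le> G_level l x"
    using S_floor_refine[of n x d] by (simp add: d G_level_def)
  have "G_level l x \<le> S l (\<lfloor>2 ^ l * x\<rfloor> + 1)" unfolding G_level_def by (rule S_mono) simp
  then show "G_level l x \<le> S n (\<lfloor>2 ^ n * x\<rfloor> + 1)"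
    using S_floor_refine[of n x d] by (simp add: d)
qed

definition G :: "real \<Rightarrow> real" where
  "G x = (SUP n. G_level n x)"

text \<open>Lower estimates of any level lie below upper estimates of any other, so \<open>G\<close>
  is squeezed between the two estimates at each level.\<close>

lemma G_level_upper: "G_level l x \<le> S n (\<lfloor>2 ^ n * x\<rfloor> + 1)"
proof (cases "n \<le> l")
  case False
  then have "G_level l x \<le> G_level n x" using G_level_bounds(1)[of l n x] by (simp add: G_level_def)
  also have "\<dots> \<le> S n (\<lfloor>2 ^ n * x\<rfloor> + 1)" using G_level_bounds(2) by blast
  finally show ?thesis .
qed (use G_level_bounds in blast)

lemma bdd_G_level: "bdd_above (range (\<lambda>n. G_level n x))"
  using G_level_upper[of _ x 0] by (intro bdd_aboveI2)

lemma G_upper: "G x \<le> S n (\<lfloor>2 ^ n * x\<rfloor> + 1)"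
  unfolding G_def by (intro cSUP_least G_level_upper) auto

lemma G_lower: "S n \<lfloor>2 ^ n * x\<rfloor> \<le> G x"
  unfolding G_def G_level_def[symmetric] by (intro cSUP_upper bdd_G_level) auto

lemma G_mono: "x \<le> y \<Longrightarrow> G x \<le> G y"
  unfolding G_def
proof (intro cSUP_mono bdd_G_level)
  fix n assume "x \<le> y"
  then have "G_level n x \<le> G_level n y"
    unfolding G_level_def by (intro S_mono floor_mono mult_left_mono) auto
  then show "\<exists>l\<in>UNIV. G_level n x \<le> G_level l y" by blast
qed auto

text \<open>Points at distance at most \<open>1 / 2 ^ n\<close> lie in the same cell or in adjacent
  cells of level \<open>n\<close>, so the masses of two cells bound the increment.\<close>

lemma G_increment:
  assumes "x \<le> y" "y - x \<le> 1 / 2 ^ n"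
  shows "G y - G x \<le> 2 * 2 powr (- t * real n)"
proof -
  define b where "b = \<lfloor>2 ^ n * x\<rfloor>"
  have "2 ^ n * (y - x) \<le> 2 ^ n * (1 / 2 ^ n)" using assms(2) by (rule mult_left_mono) simp
  then have "2 ^ n * y \<le> 2 ^ n * x + 1" by (simp add: algebra_simps)
  then have "\<lfloor>2 ^ n * y\<rfloor> \<le> b + 1" unfolding b_def by linarith
  then have "G y \<le> S n (b + 1 + 1)" using G_upper[of y n] S_mono by (meson add_right_mono order_trans)
  also have "\<dots> \<le> S n b + m n b + m n (b + 1)"
    using S_Suc_le[of n b] S_Suc_le[of n "b + 1"] by linarith
  also have "\<dots> \<le> G x + 2 * 2 powr (- t * real n)"
    using G_lower[of n x] m_le[of n b] m_le[of n "b + 1"] k_le[of n b] k_le[of n "b + 1"]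
    unfolding b_def by linarith
  finally show ?thesis by simp
qed

lemma G_below: "x < of_int j \<Longrightarrow> G x = 0"
proof -
  assume "x < of_int j"
  then have "\<lfloor>x\<rfloor> + 1 \<le> j" by linarith
  then have "S 0 (\<lfloor>2 ^ 0 * x\<rfloor> + 1) = 0" by (simp add: S_def)
  then show ?thesis using G_upper[of x 0] G_lower[of 0 x] S_nonneg[of 0 "\<lfloor>2 ^ 0 * x\<rfloor>"] by simp
qed

lemma k_0: "i \<noteq> j \<Longrightarrow> k 0 i = 0"
  using K_cell by (intro k_empty) (auto simp: cell_def)

lemma S_0: "j < b \<Longrightarrow> S 0 b = k 0 j"
  unfolding S_def by (subst sum.remove[of _ j]) (auto intro!: sum.neutral simp: k_0)

lemma G_above: "of_int j + 1 \<le> x \<Longrightarrow> G x = k 0 j"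
proof -
  assume "of_int j + 1 \<le> x"
  then have "j < \<lfloor>2 ^ 0 * x\<rfloor>" by (simp add: less_floor_iff)
  then show ?thesis using G_upper[of x 0] G_lower[of 0 x] S_0 by simp
qed

lemma total_pos: "0 < k 0 j"
proof -
  have "K \<inter> cell (0, j) = K" using K_cell by blast
  then have "ennreal (k 0 j) \<noteq> 0" using K_pos content_eq_k[of 0 j] by simp
  then show ?thesis using k_nonneg[of 0 j] by (cases "k 0 j = 0") auto
qed

lemma ex_small_powr: "0 < e \<Longrightarrow> \<exists>n. 2 * 2 powr (- t * real n) < e"
proof -
  assume e: "0 < e"
  have "(\<lambda>n. (2 powr (- t)) ^ n) \<longlonglongrightarrow> 0"
    using t by (intro LIMSEQ_power_zero) (simp add: powr_less_one)
  then have "\<forall>\<^sub>F n in sequentially. (2 powr (- t)) ^ n < e / 2"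
    using e by (intro order_tendstoD) auto
  then obtain n where "(2 powr (- t)) ^ n < e / 2"
    using eventually_happens'[OF sequentially_bot] by blast
  then show ?thesis by (intro exI[of _ n]) (simp add: powr_powr flip: powr_realpow)
qed

lemma G_continuous: "isCont G a"
proof (rule continuous_at_eps_delta[THEN iffD2], intro allI impI)
  fix e :: real assume "0 < e"
  then obtain n where n: "2 * 2 powr (- t * real n) < e" using ex_small_powr by blast
  have "\<bar>G x - G a\<bar> < e" if "\<bar>x - a\<bar> < 1 / 2 ^ n" for x
    using that G_increment[of x a n] G_increment[of a x n] G_mono[of x a] G_mono[of a x] n
    by (cases "x \<le> a") auto
  then show "\<exists>d>0. \<forall>x'. dist x' a < d \<longrightarrow> dist (G x') (G a) < e"
    by (intro exI[of _ "1 / 2 ^ n"]) (simp add: dist_real_def)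
qed

lemma G_at_right: "continuous (at_right a) (\<lambda>x. G x / k 0 j)"
proof (rule continuous_at_imp_continuous_at_within)
  show "isCont (\<lambda>x. G x / k 0 j) a"
    using G_continuous[of a] total_pos by (simp add: isCont_divide)
qed

definition \<mu> :: "real measure" where
  "\<mu> = interval_measure (\<lambda>x. G x / k 0 j)"

lemma real_distribution_\<mu>: "real_distribution \<mu>"
  unfolding \<mu>_def
proof (rule real_distribution_interval_measure)
  show "G x / k 0 j \<le> G y / k 0 j" if "x \<le> y" for x y
    using that G_mono total_pos by (intro divide_right_mono) auto
  show "continuous (at_right a) (\<lambda>x. G x / k 0 j)" for a
    by (rule G_at_right)
  have "\<forall>\<^sub>F x in at_bot. G x / k 0 j = 0"
    by (rule eventually_mono[OF eventually_gt_at_bot[of "of_int j"]]) (simp add: G_below)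
  then show "((\<lambda>x. G x / k 0 j) \<longlongrightarrow> 0) at_bot" by (rule tendsto_eventually)
  have "\<forall>\<^sub>F x in at_top. G x / k 0 j = 1"
    by (rule eventually_mono[OF eventually_ge_at_top[of "of_int j + 1"]])
      (use total_pos in \<open>simp add: G_above\<close>)
  then show "((\<lambda>x. G x / k 0 j) \<longlongrightarrow> 1) at_top" by (rule tendsto_eventually)
qed

lemma measure_\<mu>_Ioc:
  assumes "a \<le> b"
  shows "measure \<mu> {a<..b} = (G b - G a) / k 0 j"
  unfolding \<mu>_def
  using assms G_mono total_pos G_at_right
  by (subst measure_interval_measure_Ioc) (simp_all add: divide_right_mono diff_divide_distrib)

lemma measure_\<mu>_Icc:
  assumes "a \<le> b" "b - a \<le> 1 / 2 ^ n"
  shows "measure \<mu> {a..b} \<le> (4 / k 0 j) * 2 powr (- t * real n)"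
proof -
  interpret real_distribution \<mu> by (rule real_distribution_\<mu>)
  \<comment> \<open>The distribution function gives the mass of left-open intervals, so the closed
    interval is enlarged to the left by \<open>h\<close>. The additional increment makes the
    constant 4 instead of 2.\<close>
  define h :: real where "h = 1 / 2 ^ n"
  have h: "0 < h" by (simp add: h_def)
  then have "measure \<mu> {a..b} \<le> measure \<mu> {a - h<..b}"
    by (intro finite_measure_mono) (auto)
  also have "\<dots> = ((G b - G a) + (G a - G (a - h))) / k 0 j"
    using assms h by (subst measure_\<mu>_Ioc) (auto intro: order_trans[of _ a])
  also have "\<dots> \<le> (2 * 2 powr (- t * real n) + 2 * 2 powr (- t * real n)) / k 0 j"
    using assms total_pos h by (intro divide_right_mono add_mono G_increment) (auto simp: h_def)
  finally show ?thesis by simp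
qed

text \<open>Open on the left and closed on the right, as suits \<open>interval_measure\<close>. The
  right end belongs to the next half-open cell, which is why \<open>D_null\<close> asks two cells to
  miss \<open>K\<close>.\<close>

definition D :: "nat \<times> int \<Rightarrow> real set" where
  "D p = {of_int (snd p) / 2 ^ fst p <.. (of_int (snd p) + 1) / 2 ^ fst p}"

lemma D_null:
  assumes "K \<inter> cell (n, b) = {}" "K \<inter> cell (n, b + 1) = {}"
  shows "D (n, b) \<in> null_sets \<mu>"
proof -
  interpret real_distribution \<mu> by (rule real_distribution_\<mu>)
  have "\<lfloor>2 ^ n * (of_int b / 2 ^ n :: real)\<rfloor> = b" "\<lfloor>2 ^ n * ((of_int b + 1) / 2 ^ n :: real)\<rfloor> = b + 1"
    by (simp_all add: floor_eq_iff)
  then have "G ((of_int b + 1) / 2 ^ n) \<le> S n (b + 1 + 1)" "S n b \<le> G (of_int b / 2 ^ n)"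
    using G_upper[of "(of_int b + 1) / 2 ^ n" n] G_lower[of n "of_int b / 2 ^ n"] by auto
  moreover have "S n (b + 1 + 1) \<le> S n b + m n b + m n (b + 1)"
    using S_Suc_le[of n b] S_Suc_le[of n "b + 1"] by linarith
  moreover have "m n b \<le> 0" "m n (b + 1) \<le> 0"
    using m_le[of n b] m_le[of n "b + 1"] k_empty assms by auto
  ultimately have "G ((of_int b + 1) / 2 ^ n) \<le> G (of_int b / 2 ^ n)" by linarith
  then have "measure \<mu> (D (n, b)) \<le> 0"
    unfolding D_def using total_pos
    by (simp, subst measure_\<mu>_Ioc) (auto simp: divide_right_mono divide_nonpos_pos)
  then have "measure \<mu> (D (n, b)) = 0" by (simp add: measure_le_0_iff)
  then show ?thesis by (intro null_setsI) (auto simp: D_def emeasure_eq_measure)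
qed

text \<open>The complement of \<open>K\<close> is open, hence covered by those of the countably many
  \<open>D p\<close> that are null.\<close>

lemma measure_\<mu>_K: "measure \<mu> K = 1"
proof -
  interpret real_distribution \<mu> by (rule real_distribution_\<mu>)
  have "- K \<subseteq> (\<Union>p\<in>{p. D p \<in> null_sets \<mu>}. D p)"
  proof
    fix y assume "y \<in> - K"
    moreover have "open (- K)" using K_compact by (simp add: compact_imp_closed open_Compl)
    ultimately obtain e where e: "e > 0" "ball y e \<subseteq> - K" by (meson open_contains_ball)
    then obtain n where "(1/2) ^ n < e / 2" using real_arch_pow_inv[of "e/2" "1/2"] by auto
    then have n: "2 * (1 / 2 ^ n) < e" by (simp add: power_one_over)
    \<comment> \<open>Since \<open>D\<close> is closed on the right, the index of the interval
      through \<open>y\<close> comes from a ceiling instead of a floor.\<close>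
    define b where "b = \<lceil>2 ^ n * y\<rceil> - 1"
    have b: "of_int b < 2 ^ n * y" "2 ^ n * y \<le> of_int b + 1" unfolding b_def by linarith+
    then have y: "y \<in> D (n, b)"
      by (simp add: D_def pos_divide_less_eq pos_le_divide_eq mult.commute)
    have "x \<in> ball y e" if "x \<in> cell (n, b) \<union> cell (n, b + 1)" for x
    proof -
      have "of_int b / 2 ^ n \<le> x" "x < of_int b / 2 ^ n + 2 * (1 / 2 ^ n)"
        using that unfolding cell_eq by (auto simp: add_divide_distrib)
      moreover have "of_int b / 2 ^ n < y" "y \<le> of_int b / 2 ^ n + 1 / 2 ^ n"
        using y by (auto simp: D_def add_divide_distrib)
      ultimately show ?thesis using n e(1) by (auto simp: dist_real_def)
    qed
    then have "D (n, b) \<in> null_sets \<mu>" using e by (intro D_null) blast+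
    with y show "y \<in> (\<Union>p\<in>{p. D p \<in> null_sets \<mu>}. D p)" by blast
  qed
  moreover have "(\<Union>p\<in>{p. D p \<in> null_sets \<mu>}. D p) \<in> null_sets \<mu>"
    by (intro null_sets_UN') auto
  moreover have "- K \<in> sets \<mu>" using K_compact by (simp add: compact_imp_closed)
  ultimately have "- K \<in> null_sets \<mu>" by (metis null_sets_subset)
  then have "measure \<mu> (space \<mu> - K) = 0" by (simp add: Compl_eq_Diff_UNIV null_sets_def measure_def)
  moreover have "K \<in> sets \<mu>" using K_compact by (auto intro: borel_compact)
  ultimately show ?thesis using prob_compl[of K] by simp
qed

end

text \<open>The bounded support is recorded for later use: it makes the characteristic function
  Lipschitz and leaves finitely many random coefficients per level.\<close>

lemma frostman:
  assumes F: "F \<in> sets borel" and t: "0 < t" and pos: "hausdorff_measure t F \<noteq> 0"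
  shows "\<exists>\<mu> C R. real_distribution \<mu> \<and> measure \<mu> F = 1 \<and> 0 < C \<and> measure \<mu> {-R..R} = 1 \<and>
    (\<forall>n a b. b - a \<le> 1 / 2 ^ n \<longrightarrow> measure \<mu> {a..b} \<le> C * 2 powr (- t * real n))"
proof -
  have "dyadic_content t F \<noteq> 0"
    using pos hausdorff_measure_eq_0_if_dyadic_content[OF t] by blast
  then obtain j where j: "dyadic_content t (F \<inter> cell (0, j)) \<noteq> 0"
    by (rule dyadic_content_cell_pos)
  have "cell (0, j) \<in> sets borel" by (simp add: cell_eq)
  then have "F \<inter> cell (0, j) \<in> sets borel" using F by blast
  then obtain K where K: "compact K" "K \<subseteq> F \<inter> cell (0, j)" "dyadic_content t K \<noteq> 0"
    using compact_subset_pos_content[of "F \<inter> cell (0, j)" j t] j by auto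
  interpret frostman_construction K t j
    using K t by (simp add: frostman_construction_def)
  interpret real_distribution \<mu> by (rule real_distribution_\<mu>)
  have K_sub: "measure \<mu> X = 1" if "K \<subseteq> X" "X \<in> sets borel" for X
  proof -
    have "measure \<mu> K \<le> measure \<mu> X" using that by (intro finite_measure_mono) auto
    then show ?thesis using measure_\<mu>_K prob_le_1[of X] by linarith
  qed
  have "K \<subseteq> {-(\<bar>of_int j\<bar> + 1) .. \<bar>of_int j\<bar> + 1}"
  proof
    fix x assume "x \<in> K"
    then have "x \<in> cell (0, j)" using K(2) by blast
    then have "of_int j \<le> x" "x < of_int j + 1" by (simp_all add: cell_eq)
    then show "x \<in> {-(\<bar>of_int j\<bar> + 1) .. \<bar>of_int j\<bar> + 1}" by auto
  qed
  then have "measure \<mu> {-(\<bar>of_int j\<bar> + 1) .. \<bar>of_int j\<bar> + 1} = 1" by (intro K_sub) auto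
  moreover have "measure \<mu> {a..b} \<le> (4 / k 0 j) * 2 powr (- t * real n)" if "b - a \<le> 1 / 2 ^ n" for n a b
    using measure_\<mu>_Icc[of a b n] that total_pos by (cases "a \<le> b") auto
  moreover have "measure \<mu> F = 1" using K F by (intro K_sub) auto
  moreover have "0 < 4 / k 0 j" using total_pos by simp
  ultimately show ?thesis using real_distribution_\<mu> by blast
qed

section \<open>Fourier decay and Hausdorff measure\<close>

lemma fourier_transform_eq_char: "fourier_transform \<mu> \<xi> = char \<mu> (- (2 * pi * \<xi>))"
  unfolding fourier_transform_def char_def
  by (intro Bochner_Integration.integral_cong refl arg_cong[where f=exp]) (simp add: algebra_simps)

lemma (in real_distribution) norm_fourier_transform_le_1: "cmod (fourier_transform M \<xi>) \<le> 1"
  unfolding fourier_transform_eq_char by (rule cmod_char_le_1)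

lemma (in real_distribution) norm_char_squared:
  "of_real ((cmod (char M s))\<^sup>2) = (\<integral>p. iexp (s * (fst p - snd p)) \<partial>(M \<Otimes>\<^sub>M M))"
proof -
  interpret P: pair_prob_space M M ..
  have int: "integrable (M \<Otimes>\<^sub>M M) (\<lambda>p. iexp (s * (fst p - snd p)))"
    by (intro P.P.integrable_const_bound[where B=1]) auto
  have "(\<integral>p. iexp (s * (fst p - snd p)) \<partial>(M \<Otimes>\<^sub>M M)) = (\<integral>x. \<integral>y. iexp (s * (x - y)) \<partial>M \<partial>M)"
    using P.integral_fst'[OF int] by simp
  also have "\<dots> = (\<integral>x. iexp (s * x) * cnj (char M s) \<partial>M)"
  proof (intro Bochner_Integration.integral_cong refl)
    fix x
    have "(\<integral>y. iexp (s * (x - y)) \<partial>M) = (\<integral>y. iexp (s * x) * cnj (iexp (s * y)) \<partial>M)"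
      by (intro Bochner_Integration.integral_cong refl) (simp add: exp_cnj algebra_simps flip: exp_add)
    also have "\<dots> = iexp (s * x) * cnj (char M s)"
      unfolding char_def by simp
    finally show "(\<integral>y. iexp (s * (x - y)) \<partial>M) = iexp (s * x) * cnj (char M s)" .
  qed
  also have "\<dots> = char M s * cnj (char M s)"
    unfolding char_def by simp
  also have "\<dots> = of_real ((cmod (char M s))\<^sup>2)"
    by (simp add: complex_norm_square[symmetric])
  finally show ?thesis by simp
qed

text \<open>Averaging over a Gaussian frequency turns the oscillating kernel in \<open>x - y\<close>
  into a positive Gaussian kernel, which can be bounded below by the indicator of nearby
  pairs.\<close>

lemma (in real_distribution) integral_norm_char_squared:
  "(\<integral>z. (cmod (char M (a * z)))\<^sup>2 \<partial>\<N>)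
     = (\<integral>p. exp (- ((a * (fst p - snd p))\<^sup>2) / 2) \<partial>(M \<Otimes>\<^sub>M M))"
proof -
  interpret N: real_distribution \<N>
    by (rule real_dist_normal_dist)
  interpret P: pair_prob_space M M ..
  interpret Q: pair_prob_space \<N> "M \<Otimes>\<^sub>M M" ..
  let ?f = "\<lambda>z p. iexp (a * z * (fst p - snd p))"
  have int: "integrable (\<N> \<Otimes>\<^sub>M (M \<Otimes>\<^sub>M M)) (case_prod ?f)"
    by (intro Q.P.integrable_const_bound[where B=1]) auto
  have "complex_of_real (\<integral>z. (cmod (char M (a * z)))\<^sup>2 \<partial>\<N>)
     = (\<integral>z. of_real ((cmod (char M (a * z)))\<^sup>2) \<partial>\<N>)"
    by (rule integral_complex_of_real[symmetric])
  also have "\<dots> = (\<integral>z. (\<integral>p. iexp (a * z * (fst p - snd p)) \<partial>(M \<Otimes>\<^sub>M M)) \<partial>\<N>)"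
    by (simp only: norm_char_squared)
  also have "\<dots> = (\<integral>p. (\<integral>z. iexp (a * z * (fst p - snd p)) \<partial>\<N>) \<partial>(M \<Otimes>\<^sub>M M))"
    by (rule Q.Fubini_integral[OF int, symmetric])
  also have "\<dots> = (\<integral>p. of_real (exp (- ((a * (fst p - snd p))\<^sup>2) / 2)) \<partial>(M \<Otimes>\<^sub>M M))"
  proof (intro Bochner_Integration.integral_cong refl)
    fix p :: "real \<times> real"
    have "(\<integral>z. iexp (a * z * (fst p - snd p)) \<partial>\<N>)
        = char \<N> (a * (fst p - snd p))"
      unfolding char_def by (simp add: mult_ac)
    then show "(\<integral>z. iexp (a * z * (fst p - snd p)) \<partial>\<N>)
        = of_real (exp (- ((a * (fst p - snd p))\<^sup>2) / 2))"
      by (simp add: char_std_normal_distribution)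
  qed
  also have "\<dots> = of_real (\<integral>p. exp (- ((a * (fst p - snd p))\<^sup>2) / 2) \<partial>(M \<Otimes>\<^sub>M M))"
    by (rule integral_complex_of_real)
  finally show ?thesis using of_real_eq_iff by blast
qed

text \<open>On [-1, 1] the density is at most 1 and the power is integrable because
  \<open>a < 1\<close>. Outside, the power is at most 1.\<close>

lemma nn_integral_powr_normal_finite:
  assumes a: "0 < a" "a < 1"
  shows "(\<integral>\<^sup>+z. ennreal (\<bar>z\<bar> powr (- a)) \<partial>\<N>) < \<infinity>"
proof -
  have I1: "((\<lambda>x. x powr (-a)) has_integral (1 / (1 - a))) {0..1}"
    using has_integral_powr_from_0[of "-a" 1] a by simp
  have I2: "((\<lambda>x. (- x) powr (-a)) has_integral (1 / (1 - a))) {-1..0}"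
    using has_integral_reflect_real[of "\<lambda>x. x powr (-a)" "1 / (1 - a)" 1 0] I1 by simp
  have N1: "(\<integral>\<^sup>+x. ennreal (x powr (-a)) * indicator {0..1} x \<partial>lborel) = ennreal (1 / (1 - a))"
  proof -
    have "((\<lambda>x. if x \<in> {0..1} then x powr (-a) else 0) has_integral (1 / (1 - a))) UNIV"
      using I1 by (simp only: has_integral_restrict_UNIV)
    then have "(\<integral>\<^sup>+x. ennreal (if x \<in> {0..1} then x powr (-a) else 0) \<partial>lborel) = ennreal (1 / (1 - a))"
      by (rule nn_integral_has_integral_lborel[rotated 2]) auto
    moreover have "ennreal (if x \<in> {0..1} then x powr (-a) else 0) = ennreal (x powr (-a)) * indicator {0..1} x" for x :: real
      by simp
    ultimately show ?thesis by simp
  qed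
  have N2: "(\<integral>\<^sup>+x. ennreal ((-x) powr (-a)) * indicator {-1..0} x \<partial>lborel) = ennreal (1 / (1 - a))"
  proof -
    have "((\<lambda>x. if x \<in> {-1..0} then (-x) powr (-a) else 0) has_integral (1 / (1 - a))) UNIV"
      using I2 by (simp only: has_integral_restrict_UNIV)
    then have "(\<integral>\<^sup>+x. ennreal (if x \<in> {-1..0} then (-x) powr (-a) else 0) \<partial>lborel) = ennreal (1 / (1 - a))"
      by (rule nn_integral_has_integral_lborel[rotated 2]) auto
    moreover have "ennreal (if x \<in> {-1..0} then (-x) powr (-a) else 0) = ennreal ((-x) powr (-a)) * indicator {-1..0} x" for x :: real
      by simp
    ultimately show ?thesis by simp
  qed
  have N3: "(\<integral>\<^sup>+x. ennreal (std_normal_density x) \<partial>lborel) = 1"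
  proof -
    interpret N: prob_space \<N> by (rule prob_space_normal_density) simp
    show ?thesis using N.emeasure_space_1 by (simp add: emeasure_density)
  qed
  have dens: "std_normal_density x \<le> 1" for x
  proof -
    have "exp (- (x\<^sup>2 / 2)) \<le> 1" by simp
    also have "1 \<le> sqrt (2 * pi)" using pi_gt3 by simp
    finally show ?thesis
      unfolding std_normal_density_def by (simp add: divide_le_eq)
  qed
  have "(\<integral>\<^sup>+z. ennreal (\<bar>z\<bar> powr (- a)) \<partial>\<N>)
      = (\<integral>\<^sup>+z. ennreal (std_normal_density z) * ennreal (\<bar>z\<bar> powr (- a)) \<partial>lborel)"
    by (subst nn_integral_density) auto
  also have "\<dots> \<le> (\<integral>\<^sup>+z. (ennreal (z powr (-a)) * indicator {0..1} z
      + ennreal ((-z) powr (-a)) * indicator {-1..0} z) + ennreal (std_normal_density z) \<partial>lborel)"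
  proof (rule nn_integral_mono)
    fix z :: real
    consider "z < -1" | "-1 \<le> z" "z \<le> 0" | "0 < z" "z \<le> 1" | "1 < z" by linarith
    then show "ennreal (std_normal_density z) * ennreal (\<bar>z\<bar> powr (- a)) \<le>
      (ennreal (z powr (-a)) * indicator {0..1} z
      + ennreal ((-z) powr (-a)) * indicator {-1..0} z) + ennreal (std_normal_density z)"
    proof cases
      case 1
      then have "(- z) powr (- a) \<le> 1" using a powr_mono[of "-a" 0 "-z"] by simp
      then show ?thesis using 1
        by (auto simp flip: ennreal_mult intro!: ennreal_leI mult_left_le)
    next
      case 2
      have "ennreal (std_normal_density z) * ennreal (\<bar>z\<bar> powr (- a)) \<le> 1 * ennreal ((-z) powr (-a))"
        using 2 dens[of z] by (intro mult_mono) (auto simp: ennreal_leI)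
      also have "\<dots> \<le> ennreal ((-z) powr (-a)) * indicator {-1..0} z" using 2 by simp
      finally show ?thesis by (meson add_increasing add_increasing2 zero_le)
    next
      case 3
      have "ennreal (std_normal_density z) * ennreal (\<bar>z\<bar> powr (- a)) \<le> 1 * ennreal (z powr (-a))"
        using 3 dens[of z] by (intro mult_mono) (auto simp: ennreal_leI)
      also have "\<dots> \<le> ennreal (z powr (-a)) * indicator {0..1} z" using 3 by simp
      finally show ?thesis by (meson add_increasing add_increasing2 zero_le)
    next
      case 4
      then have "z powr (- a) \<le> 1" using a powr_mono[of "-a" 0 z] by simp
      then show ?thesis using 4
        by (auto simp flip: ennreal_mult intro!: ennreal_leI mult_left_le)
    qed
  qed
  also have "\<dots> = ennreal (1 / (1 - a)) + ennreal (1 / (1 - a)) + 1"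
    by (simp add: nn_integral_add N1 N2 N3)
  also have "\<dots> < \<infinity>" by (simp add: ennreal_add_less_top)
  finally show ?thesis .
qed

text \<open>The mean mass of a ball of radius 2^(-k) is the product measure of the pairs at distance
  at most 2^(-k). A Gaussian kernel dominates their indicator, and its integral is an average of the
  squared transform over frequencies of order 2^k.\<close>

lemma (in real_distribution) energy_bound:
  assumes a: "0 < a" "a < 1"
    and decay: "\<And>\<xi>. \<xi> \<noteq> 0 \<Longrightarrow> (cmod (fourier_transform M \<xi>))\<^sup>2 \<le> B * \<bar>\<xi>\<bar> powr (- a)" and B: "0 \<le> B"
  obtains Q where "0 \<le> Q"
    "\<And>k. (\<integral>\<^sup>+x. emeasure M (cball x (1 / 2 ^ k)) \<partial>M) \<le> ennreal (Q * 2 powr (- a * real k))"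
proof -
  let ?N = "\<lambda>\<sigma>. \<integral>z. (cmod (char M (2 * pi * \<sigma> * z)))\<^sup>2 \<partial>\<N>"
  let ?I = "\<lambda>k. \<integral>\<^sup>+x. emeasure M (cball x (1 / 2 ^ k)) \<partial>M"
  interpret N: real_distribution \<N> by (rule real_dist_normal_dist)
  interpret P: pair_prob_space M M ..
  define J where "J = (\<integral>\<^sup>+z. ennreal (\<bar>z\<bar> powr (- a)) \<partial>\<N>)"
  have J: "J = ennreal (enn2real J)"
    using nn_integral_powr_normal_finite[OF a] by (simp add: J_def ennreal_enn2real)
  define Q where "Q = exp (2 * pi\<^sup>2) * (B * enn2real J)"
  have "?I k \<le> ennreal (Q * 2 powr (- a * real k))" for k
  proof -
    define \<sigma> :: real where "\<sigma> = 2 ^ k"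
    have \<sigma>: "0 < \<sigma>" by (simp add: \<sigma>_def)
    define X where "X = {p \<in> space (M \<Otimes>\<^sub>M M). \<bar>fst p - snd p\<bar> \<le> 1 / \<sigma>}"
    have X: "X \<in> sets (M \<Otimes>\<^sub>M M)" unfolding X_def by measurable
    have "?I k = emeasure (M \<Otimes>\<^sub>M M) X"
    proof (subst emeasure_pair_measure_alt[OF X], rule nn_integral_cong)
      fix x
      have "Pair x -` X = cball x (1 / 2 ^ k)"
        by (auto simp: X_def space_pair_measure dist_real_def \<sigma>_def)
      then show "emeasure M (cball x (1 / 2 ^ k)) = emeasure M (Pair x -` X)" by simp
    qed
    also have "\<dots> = ennreal (measure (M \<Otimes>\<^sub>M M) X)" by (rule P.P.emeasure_eq_measure)
    also have "measure (M \<Otimes>\<^sub>M M) X = (\<integral>p. indicator X p \<partial>(M \<Otimes>\<^sub>M M))"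
      using X by simp
    \<comment> \<open>On \<open>X\<close> the product of \<sigma> and the distance is at most 1, so
      the Gaussian exponent is at most \<open>2 * pi\<^sup>2\<close>, which fixes the constant in
      front.\<close>
    also have "\<dots> \<le> (\<integral>p. exp (2 * pi\<^sup>2) * exp (- ((2 * pi * \<sigma> * (fst p - snd p))\<^sup>2) / 2) \<partial>(M \<Otimes>\<^sub>M M))"
    proof (rule integral_mono)
      show "integrable (M \<Otimes>\<^sub>M M) (indicator X :: _ \<Rightarrow> real)"
        using X by (intro P.P.integrable_const_bound[where B=1] borel_measurable_indicator) auto
      show "integrable (M \<Otimes>\<^sub>M M) (\<lambda>p. exp (2 * pi\<^sup>2) * exp (- ((2 * pi * \<sigma> * (fst p - snd p))\<^sup>2) / 2))"
        by (intro P.P.integrable_const_bound[where B="exp (2 * pi\<^sup>2)"]) auto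
      fix p
      show "indicator X p \<le> exp (2 * pi\<^sup>2) * exp (- ((2 * pi * \<sigma> * (fst p - snd p))\<^sup>2) / 2)"
      proof (cases "p \<in> X")
        case True
        then have "\<sigma> * \<bar>fst p - snd p\<bar> \<le> 1" using \<sigma> by (simp add: X_def field_simps)
        then have "(\<sigma> * \<bar>fst p - snd p\<bar>)\<^sup>2 \<le> 1\<^sup>2" using \<sigma> by (intro power_mono) auto
        moreover define d where "d = fst p - snd p"
        ultimately have "(\<sigma> * d)\<^sup>2 \<le> 1" by (simp add: power_mult_distrib)
        then have "4 * pi\<^sup>2 * (\<sigma> * d)\<^sup>2 \<le> 4 * pi\<^sup>2 * 1" by (intro mult_left_mono) auto
        also have "4 * pi\<^sup>2 * (\<sigma> * d)\<^sup>2 = (2 * pi * \<sigma> * d)\<^sup>2" by (simp add: power_mult_distrib)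
        finally have "(2 * pi * \<sigma> * (fst p - snd p))\<^sup>2 \<le> 4 * pi\<^sup>2" by (simp only: d_def)
        then show ?thesis using True by (simp flip: exp_add)
      qed simp
    qed
    also have "\<dots> = exp (2 * pi\<^sup>2) * (?N \<sigma>)"
      by (simp add: integral_norm_char_squared)
    finally have "?I k
        \<le> ennreal (exp (2 * pi\<^sup>2) * (?N \<sigma>))"
      by (simp add: ennreal_leI)
    also have "\<dots> = ennreal (exp (2 * pi\<^sup>2)) * ennreal (?N \<sigma>)"
      by (intro ennreal_mult integral_nonneg_AE) auto
    also have "ennreal (?N \<sigma>)
        = (\<integral>\<^sup>+z. ennreal ((cmod (char M (2 * pi * \<sigma> * z)))\<^sup>2) \<partial>\<N>)"
    proof (rule nn_integral_eq_integral[symmetric])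
      show "integrable \<N> (\<lambda>z. (cmod (char M (2 * pi * \<sigma> * z)))\<^sup>2)"
        using cmod_char_le_1
        by (intro N.integrable_const_bound[where B=1])
          (auto simp: power_le_one intro!: borel_measurable_power)
    qed auto
    also have "\<dots> \<le> (\<integral>\<^sup>+z. ennreal (B * \<sigma> powr (- a)) * ennreal (\<bar>z\<bar> powr (- a)) \<partial>\<N>)"
    proof (rule nn_integral_mono_AE)
      have "AE z in lborel. z \<noteq> (0::real)" by (rule AE_lborel_singleton)
      then have "AE z in \<N>. z \<noteq> 0" by (subst AE_density) auto
      then show "AE z in \<N>. ennreal ((cmod (char M (2 * pi * \<sigma> * z)))\<^sup>2)
          \<le> ennreal (B * \<sigma> powr (- a)) * ennreal (\<bar>z\<bar> powr (- a))"
      proof eventually_elim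
        case (elim z)
        have "(cmod (char M (2 * pi * \<sigma> * z)))\<^sup>2 = (cmod (fourier_transform M (- (\<sigma> * z))))\<^sup>2"
          by (simp add: fourier_transform_eq_char mult_ac)
        also have "\<dots> \<le> B * \<bar>- (\<sigma> * z)\<bar> powr (- a)" using elim \<sigma> by (intro decay) auto
        also have "\<dots> = (B * \<sigma> powr (- a)) * \<bar>z\<bar> powr (- a)"
          using \<sigma> by (simp add: abs_mult powr_mult)
        finally show ?case using B by (simp add: ennreal_leI flip: ennreal_mult)
      qed
    qed
    also have "\<dots> = ennreal (B * \<sigma> powr (- a)) * J"
      unfolding J_def by (rule nn_integral_cmult) simp
    also have "\<dots> = ennreal (B * \<sigma> powr (- a) * enn2real J)"
      using B by (subst J) (simp add: ennreal_mult)
    also have "ennreal (exp (2 * pi\<^sup>2)) * \<dots> = ennreal (Q * \<sigma> powr (- a))"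
      using B by (simp add: Q_def mult_ac flip: ennreal_mult)
    also have "\<sigma> powr (- a) = 2 powr (- a * real k)"
      by (simp add: \<sigma>_def powr_powr mult.commute flip: powr_realpow)
    finally show ?thesis by (simp add: mult_left_mono)
  qed
  moreover have "0 \<le> Q" using B by (simp add: Q_def)
  ultimately show ?thesis using that by blast
qed

lemma ex_dyadic_scale:
  fixes d :: real
  assumes "0 < d" "d \<le> 1"
  obtains k where "d \<le> 1 / 2 ^ k" "1 / 2 ^ Suc k < d"
proof -
  define P where "P n \<longleftrightarrow> (1 / 2 ^ n :: real) < d" for n
  have "\<exists>n. P n"
    using real_arch_pow_inv[of d "1/2"] assms by (simp add: P_def power_one_over)
  then have *: "P (LEAST n. P n)" by (rule LeastI_ex)
  then have "(LEAST n. P n) \<noteq> 0" using assms by (metis P_def div_by_1 not_le power_0)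
  then obtain k where k: "(LEAST n. P n) = Suc k" using not0_implies_Suc by blast
  have "\<not> P k" using not_less_Least[of k P] k by simp
  then show ?thesis using that[of k] * k by (simp add: P_def)
qed

text \<open>A bound on the mean mass of balls becomes pointwise by summing over the radii 2^(-k)
  with weights 2^(tk): the sum is finite almost everywhere, hence bounded on a subset
  \<open>E n\<close> of \<open>F\<close> of positive measure, and there every small ball has mass at
  most a multiple of its radius to the power \<open>t\<close>.\<close>

lemma hausdorff_measure_nonzero_if_fourier_decay:
  assumes \<mu>: "real_distribution \<mu>" and F: "measure \<mu> F = 1"
    and s: "s \<le> 1" "bounded (range (\<lambda>\<xi>. cmod (fourier_transform \<mu> \<xi>) * \<bar>\<xi>\<bar> powr (s / 2)))"
    and t: "0 < t" "t < s"
  shows "hausdorff_measure t F \<noteq> 0"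
proof -
  let ?I = "\<lambda>k. \<integral>\<^sup>+x. emeasure \<mu> (cball x (1 / 2 ^ k)) \<partial>\<mu>"
  interpret real_distribution \<mu> by (rule \<mu>)
  let ?f = "\<lambda>\<xi>. cmod (fourier_transform \<mu> \<xi>)"
  have Fm: "F \<in> sets \<mu>" using F measure_notin_sets by fastforce
  \<comment> \<open>Above \<open>t\<close> to make the series for the integral of \<Psi> converge,
    below \<open>s\<close>, hence below 1, to make \<open>energy_bound\<close> applicable.\<close>
  define a where "a = (t + s) / 2"
  have a: "0 < a" "a < 1" "t < a" "a < s" using t s by (auto simp: a_def)
  obtain B where B: "\<And>\<xi>. ?f \<xi> * \<bar>\<xi>\<bar> powr (s / 2) \<le> B"
    using s(2) by (auto simp: bounded_iff abs_mult)
  \<comment> \<open>The entry 1 serves frequencies of modulus at most 1, where the transform is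
    bounded by 1 and the negative power is at least 1.\<close>
  define B' where "B' = max 1 (B\<^sup>2)"
  have "(?f \<xi>)\<^sup>2 \<le> B' * \<bar>\<xi>\<bar> powr (- a)" if "\<xi> \<noteq> 0" for \<xi>
  proof (cases "\<bar>\<xi>\<bar> \<le> 1")
    case True
    have "(?f \<xi>)\<^sup>2 \<le> 1"
      using norm_fourier_transform_le_1 by (simp add: power_le_one)
    also have "1 \<le> \<bar>\<xi>\<bar> powr (- a)"
      using True that a powr_mono'[of "-a" 0 "\<bar>\<xi>\<bar>"] by simp
    also have "\<dots> \<le> B' * \<bar>\<xi>\<bar> powr (- a)"
      using mult_right_mono[of 1 B' "\<bar>\<xi>\<bar> powr (- a)"] by (simp add: B'_def)
    finally show ?thesis .
  next
    case False
    have "(?f \<xi> * \<bar>\<xi>\<bar> powr (s / 2))\<^sup>2 \<le> B\<^sup>2"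
      using B by (intro power_mono) auto
    then have "(?f \<xi>)\<^sup>2 * \<bar>\<xi>\<bar> powr s \<le> B\<^sup>2"
      using that by (simp add: power_mult_distrib powr_powr flip: powr_numeral)
    then have "(?f \<xi>)\<^sup>2 \<le> B\<^sup>2 * \<bar>\<xi>\<bar> powr (- s)"
      using that by (simp add: powr_minus field_simps)
    also have "\<dots> \<le> B' * \<bar>\<xi>\<bar> powr (- a)"
      using False a by (intro mult_mono powr_mono) (auto simp: B'_def)
    finally show ?thesis .
  qed
  note decay = this
  let ?P = "\<lambda>r. {p \<in> space (\<mu> \<Otimes>\<^sub>M \<mu>). \<bar>fst p - snd p\<bar> \<le> r}"
  have "0 \<le> B'" by (simp add: B'_def)
  then obtain Q where Q: "0 \<le> Q"
    "\<And>k. ?I k \<le> ennreal (Q * 2 powr (- a * real k))"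
    using energy_bound[OF a(1,2) decay] by blast
  have ball_meas: "(\<lambda>x. emeasure \<mu> (cball x r)) \<in> borel_measurable \<mu>" for r
  proof -
    have "?P r \<in> sets (\<mu> \<Otimes>\<^sub>M \<mu>)" by measurable
    then have *: "(\<lambda>x. emeasure \<mu> (Pair x -` ?P r)) \<in> borel_measurable \<mu>"
      by (rule measurable_emeasure_Pair)
    have "Pair x -` ?P r = cball x r" for x
      by (auto simp: space_pair_measure dist_real_def)
    with * show ?thesis by (simp only:)
  qed
  note ball_meas [measurable]
  define \<Psi> where "\<Psi> x = (\<Sum>k. ennreal (2 powr (t * real k)) * emeasure \<mu> (cball x (1 / 2 ^ k)))" for x
  have \<Psi>_meas [measurable]: "\<Psi> \<in> borel_measurable \<mu>"
    unfolding \<Psi>_def by measurable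
  have "(\<integral>\<^sup>+x. \<Psi> x \<partial>\<mu>) = (\<Sum>k. ennreal (2 powr (t * real k)) * ?I k)"
    unfolding \<Psi>_def using ball_meas
    by (subst nn_integral_suminf) (auto simp: nn_integral_cmult)
  also have "\<dots> \<le> (\<Sum>k. ennreal (Q * (2 powr (t - a)) ^ k))"
  proof (rule suminf_le)
    fix k
    have "ennreal (2 powr (t * real k)) * ?I k
        \<le> ennreal (2 powr (t * real k)) * ennreal (Q * 2 powr (- a * real k))"
      using Q by (intro mult_left_mono) auto
    also have "\<dots> = ennreal (Q * (2 powr (t - a)) ^ k)"
    proof -
      have "2 powr (t * real k) * 2 powr (- a * real k) = (2 powr (t - a)) ^ k"
        by (simp add: powr_powr left_diff_distrib flip: powr_realpow powr_add)
      then show ?thesis using Q(1) by (simp add: mult.left_commute flip: ennreal_mult)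
    qed
    finally show "ennreal (2 powr (t * real k)) * ?I k
        \<le> ennreal (Q * (2 powr (t - a)) ^ k)" .
  qed auto
  also have "\<dots> < \<infinity>"
  proof -
    have "2 powr (t - a) < 1" using a by (simp add: powr_less_one)
    then have "summable (\<lambda>k. Q * (2 powr (t - a)) ^ k)"
      by (intro summable_mult summable_geometric) simp
    then show ?thesis using Q by (subst suminf_ennreal2) auto
  qed
  finally have "AE x in \<mu>. \<Psi> x \<noteq> \<infinity>"
    by (intro nn_integral_PInf_AE \<Psi>_meas) auto
  define E where "E n = {x \<in> F. \<Psi> x \<le> of_nat n}" for n :: nat
  have E_meas: "E n \<in> sets \<mu>" for n
  proof -
    have "E n = F \<inter> {x \<in> space \<mu>. \<Psi> x \<le> of_nat n}" by (auto simp: E_def)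
    also have "\<dots> \<in> sets \<mu>" using Fm by measurable
    finally show ?thesis .
  qed
  have "\<exists>n. emeasure \<mu> (E n) \<noteq> 0"
  proof (rule ccontr)
    assume "\<nexists>n. emeasure \<mu> (E n) \<noteq> 0"
    then have "\<And>n. E n \<in> null_sets \<mu>" using E_meas by auto
    then have "(\<Union>n. E n) \<in> null_sets \<mu>" by (intro null_sets_UN)
    then have "AE x in \<mu>. x \<notin> (\<Union>n. E n)" by (rule AE_not_in)
    moreover have "AE x in \<mu>. x \<in> F" using F Fm by (simp add: prob_eq_1)
    ultimately have "AE x in \<mu>. False"
      using \<open>AE x in \<mu>. \<Psi> x \<noteq> \<infinity>\<close>
    proof eventually_elim
      case (elim x)
      then have "\<Psi> x < top" by (simp add: less_top)
      then obtain n :: nat where "\<Psi> x < of_nat n"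
        using ennreal_Ex_less_of_nat by blast
      then have "\<Psi> x \<le> of_nat n" by simp
      then show ?case using elim by (auto simp: E_def)
    qed
    then show False by simp
  qed
  then obtain n where n: "emeasure \<mu> (E n) \<noteq> 0" by blast
  \<comment> \<open>The factor \<open>2 powr t\<close> pays for enlarging a radius to the next power
    of 1/2.\<close>
  define A where "A = real n * 2 powr t"
  have small: "emeasure \<mu> (cball x (1 / 2 ^ k)) \<le> ennreal (real n * 2 powr (- t * real k))" if "x \<in> E n" for x k
  proof -
    have "ennreal (2 powr (t * real k)) * emeasure \<mu> (cball x (1 / 2 ^ k)) \<le> \<Psi> x"
      unfolding \<Psi>_def using sum_le_suminf[of "\<lambda>k. ennreal (2 powr (t * real k)) * emeasure \<mu> (cball x (1 / 2 ^ k))" "{k}"]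
      by simp
    also have "\<dots> \<le> ennreal (real n)" using that by (simp add: E_def ennreal_of_nat_eq_real_of_nat)
    finally have "ennreal (2 powr (t * real k) * measure \<mu> (cball x (1 / 2 ^ k))) \<le> ennreal (real n)"
      by (simp add: emeasure_eq_measure ennreal_mult)
    then have "2 powr (t * real k) * measure \<mu> (cball x (1 / 2 ^ k)) \<le> real n" by simp
    then show ?thesis
      by (simp add: emeasure_eq_measure powr_minus field_simps)
  qed
  have cball_le: "emeasure \<mu> (cball x d) \<le> ennreal A * ennreal (d powr t)"
    if x: "x \<in> E n" and d: "0 \<le> d" "d \<le> 1" for x d
  proof (cases "d = 0")
    case True
    \<comment> \<open>Covering sets may be single points, which contribute nothing to the sum, so
      points of \<open>E n\<close> must be shown to have mass 0.\<close>
    have eps: "measure \<mu> {x} \<le> e" if e: "0 < e" for e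
    proof -
      have "(\<lambda>k. real n * (2 powr (- t)) ^ k) \<longlonglongrightarrow> real n * 0"
        using t by (intro tendsto_mult tendsto_const LIMSEQ_power_zero) (simp add: powr_less_one)
      then have "\<forall>\<^sub>F k in sequentially. real n * (2 powr (- t)) ^ k < e"
        using e by (intro order_tendstoD) auto
      then obtain k where "real n * (2 powr (- t)) ^ k < e"
        using eventually_happens'[OF sequentially_bot] by blast
      moreover have "measure \<mu> {x} \<le> measure \<mu> (cball x (1 / 2 ^ k))"
        by (intro finite_measure_mono) auto
      moreover have "measure \<mu> (cball x (1 / 2 ^ k)) \<le> real n * (2 powr (- t)) ^ k"
        using small[OF x, of k] by (simp add: emeasure_eq_measure powr_powr flip: powr_realpow)
      ultimately show ?thesis by linarith
    qed
    have "measure \<mu> {x} \<le> 0"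
      using eps[of "measure \<mu> {x} / 2"] measure_nonneg[of \<mu> "{x}"] by linarith
    then have "measure \<mu> {x} = 0" using measure_nonneg[of \<mu> "{x}"] by linarith
    then show ?thesis using True by (simp add: emeasure_eq_measure)
  next
    case False
    then obtain k where k: "d \<le> 1 / 2 ^ k" "1 / 2 ^ Suc k < d"
      using d ex_dyadic_scale[of d] by auto
    have "emeasure \<mu> (cball x d) \<le> emeasure \<mu> (cball x (1 / 2 ^ k))"
      using k by (intro emeasure_mono) auto
    also have "\<dots> \<le> ennreal (real n * 2 powr (- t * real k))" by (rule small[OF x])
    also have "\<dots> \<le> ennreal (A * d powr t)"
    proof (rule ennreal_leI)
      have "(1 / 2 ^ Suc k :: real) = 2 powr (- real (Suc k))"
        by (simp add: powr_minus_divide powr_realpow del: of_nat_Suc)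
      moreover have "- t * real k = t + - real (Suc k) * t" by (simp add: algebra_simps)
      ultimately have "2 powr (- t * real k) = 2 powr t * (1 / 2 ^ Suc k) powr t"
        by (simp only: powr_powr powr_add)
      also have "\<dots> \<le> 2 powr t * d powr t"
        using k t by (intro mult_left_mono powr_mono2) auto
      finally show "real n * 2 powr (- t * real k) \<le> A * d powr t"
        by (simp add: A_def mult.assoc mult_left_mono)
    qed
    finally show ?thesis by (simp add: A_def ennreal_mult)
  qed
  have "emeasure \<mu> (E n) \<le> ennreal A * (\<Sum>i. diam_pow t (U i))"
    if U: "F \<subseteq> (\<Union>i. U i)" "\<forall>i. bounded (U i) \<and> diameter (U i) \<le> 1" for U :: "nat \<Rightarrow> real set"
  proof -
    let ?c = "\<lambda>i. SOME x. x \<in> U i \<inter> E n"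
    \<comment> \<open>A covering set that meets \<open>E n\<close> is replaced by a ball of radius
      its diameter about one of its points in \<open>E n\<close>, because ball masses are controlled
      only at such centres.\<close>
    define V where "V i = (if U i \<inter> E n = {} then {} else cball (?c i) (diameter (U i)))" for i
    have some: "(?c i) \<in> U i \<inter> E n" if "U i \<inter> E n \<noteq> {}" for i
      using that by (simp only: some_in_eq simp_thms)
    have "E n \<subseteq> (\<Union>i. V i)"
    proof
      fix y assume y: "y \<in> E n"
      then obtain i where i: "y \<in> U i" using U(1) by (auto simp: E_def)
      then have ne: "U i \<inter> E n \<noteq> {}" using y by blast
      have "dist (?c i) y \<le> diameter (U i)"
        using U(2) some[OF ne] i by (intro diameter_bounded_bound) auto
      then have "y \<in> V i" using ne by (simp add: V_def)
      then show "y \<in> (\<Union>i. V i)" by blast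
    qed
    then have "emeasure \<mu> (E n) \<le> emeasure \<mu> (\<Union>i. V i)"
      by (intro emeasure_mono) (auto simp: V_def)
    also have "\<dots> \<le> (\<Sum>i. emeasure \<mu> (V i))"
      by (intro emeasure_subadditive_countably) (auto simp: V_def)
    also have "\<dots> \<le> (\<Sum>i. ennreal A * diam_pow t (U i))"
    proof (rule suminf_le)
      fix i
      show "emeasure \<mu> (V i) \<le> ennreal A * diam_pow t (U i)"
      proof (cases "U i \<inter> E n = {}")
        case False
        then have "U i \<noteq> {}" by blast
        then show ?thesis
          using False cball_le[of "?c i" "diameter (U i)"] some[OF False] U(2) t
          by (auto simp: V_def diam_pow_def diameter_ge_0)
      qed (simp add: V_def)
    qed auto
    finally show ?thesis by simp
  qed note cover = this
  show ?thesis
  proof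
    assume "hausdorff_measure t F = 0"
    moreover have "hausdorff_content t 1 F \<le> hausdorff_measure t F"
      unfolding hausdorff_measure_def by (rule SUP_upper) simp
    ultimately have "hausdorff_content t 1 F = 0" by simp
    \<comment> \<open>The 1 keeps the divisor positive when \<open>A\<close> is 0.\<close>
    moreover have "0 < emeasure \<mu> (E n) / (ennreal A + 1)"
      using n by (simp add: ennreal_zero_less_divide zero_less_iff_neq_zero)
    ultimately have "hausdorff_content t 1 F < emeasure \<mu> (E n) / (ennreal A + 1)" by simp
    then obtain U where U: "F \<subseteq> (\<Union>i. U i)" "\<forall>i. bounded (U i) \<and> diameter (U i) \<le> 1"
      "(\<Sum>i. diam_pow t (U i)) < emeasure \<mu> (E n) / (ennreal A + 1)"
      unfolding hausdorff_content_def Inf_less_iff by blast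
    have A1: "ennreal A + 1 = ennreal (A + 1)" "0 < A + 1" by (simp_all add: A_def add_nonneg_pos)
    have "emeasure \<mu> (E n) \<le> ennreal A * (\<Sum>i. diam_pow t (U i))" by (rule cover[OF U(1,2)])
    also have "\<dots> \<le> (ennreal A + 1) * (\<Sum>i. diam_pow t (U i))" by (intro mult_right_mono) auto
    also have "\<dots> < (ennreal A + 1) * (emeasure \<mu> (E n) / (ennreal A + 1))"
      using U(3) A1 by (intro ennreal_mult_strict_left_mono) auto
    also have "\<dots> = emeasure \<mu> (E n)"
      using A1(2) unfolding A1(1) ennreal_times_divide mult.commute[of "ennreal (A + 1)"]
      by (subst ennreal_mult_divide_eq) auto
    finally show False by simp
  qed
qed

section \<open>The perturbed identity map\<close>

(* The jumps of the coefficient are harmless: (sin (pi * y))^2 vanishes to second order at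
   the integers, so wave c is C^1 for every bounded c. *)
definition wave :: "(int \<Rightarrow> real) \<Rightarrow> real \<Rightarrow> real" where
  "wave c y = c \<lfloor>y\<rfloor> * (sin (pi * y))\<^sup>2"

definition wave_deriv :: "(int \<Rightarrow> real) \<Rightarrow> real \<Rightarrow> real" where
  "wave_deriv c y = c \<lfloor>y\<rfloor> * (pi * sin (2 * pi * y))"

lemma floor_eq_on_Ioo: "x \<in> {of_int n<..<of_int n + 1} \<Longrightarrow> \<lfloor>x\<rfloor> = n" for x :: real
  by (simp add: floor_eq_iff)

lemma non_int_in_Ioo: "y \<noteq> of_int \<lfloor>y\<rfloor> \<Longrightarrow> y \<in> {of_int \<lfloor>y\<rfloor><..<of_int \<lfloor>y\<rfloor> + 1}" for y :: real
  using floor_correct[of y] by (simp only: greaterThanLessThan_iff) linarith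

lemma sin_pi_of_int_add_le: "\<bar>sin (pi * (of_int n + h))\<bar> \<le> pi * \<bar>h\<bar>"
proof -
  have "sin (pi * (of_int n + h)) = cos (pi * of_int n) * sin (pi * h)"
    by (simp add: distrib_left sin_add sin_npi_int)
  then have "\<bar>sin (pi * (of_int n + h))\<bar> \<le> 1 * \<bar>sin (pi * h)\<bar>"
    by (simp add: abs_mult mult_right_mono del: mult_1_left)
  also have "\<dots> \<le> \<bar>pi * h\<bar>" using abs_sin_x_le_abs_x by simp
  finally show ?thesis by (simp add: abs_mult)
qed

lemma wave_has_derivative:
  assumes B: "\<And>i. \<bar>c i\<bar> \<le> B"
  shows "(wave c has_real_derivative wave_deriv c y) (at y)"
proof (cases "y = of_int \<lfloor>y\<rfloor>")
  case False
  have "((\<lambda>y. c \<lfloor>y'\<rfloor> * (sin (pi * y))\<^sup>2) has_real_derivative wave_deriv c y) (at y)" if "y' = y" for y'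
    unfolding wave_deriv_def that using sin_double[of "pi * y"]
    by (auto intro!: derivative_eq_intros simp: mult_ac)
  then have "((\<lambda>x. c \<lfloor>y\<rfloor> * (sin (pi * x))\<^sup>2) has_real_derivative wave_deriv c y) (at y)" by simp
  then show ?thesis
    by (rule has_field_derivative_transform_within_open[OF _ _ non_int_in_Ioo[OF False]])
       (auto simp: wave_def floor_eq_on_Ioo)
next
  case True
  define n where "n = \<lfloor>y\<rfloor>"
  have y: "y = of_int n" using True by (simp add: n_def)
  have B0: "0 \<le> B" using B[of 0] by linarith
  have "wave_deriv c y = 0"
    using sin_npi_int[of "2 * n"] by (simp add: wave_deriv_def y mult.assoc mult.left_commute)
  moreover have "wave c y = 0" by (simp add: wave_def y sin_npi_int)
  moreover have "((\<lambda>h. wave c (y + h) / h) \<longlongrightarrow> 0) (at 0)"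
  proof (rule Lim_null_comparison)
    show "\<forall>\<^sub>F h in at 0. norm (wave c (y + h) / h) \<le> B * pi\<^sup>2 * \<bar>h\<bar>"
    proof (rule always_eventually, rule allI)
      fix h :: real
      have "\<bar>wave c (y + h)\<bar> = \<bar>c \<lfloor>y + h\<rfloor>\<bar> * (\<bar>sin (pi * (of_int n + h))\<bar>)\<^sup>2"
        by (simp add: wave_def abs_mult y)
      also have "\<dots> \<le> B * (pi * \<bar>h\<bar>)\<^sup>2"
        using B B0 sin_pi_of_int_add_le by (intro mult_mono power_mono) auto
      also have "\<dots> = (B * pi\<^sup>2 * \<bar>h\<bar>) * \<bar>h\<bar>"
        by (simp only: power_mult_distrib power2_eq_square mult_ac)
      finally show "norm (wave c (y + h) / h) \<le> B * pi\<^sup>2 * \<bar>h\<bar>"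
        using B0 by (cases "h = 0") (simp_all add: pos_divide_le_eq)
    qed
    show "((\<lambda>h. B * pi\<^sup>2 * \<bar>h\<bar>) \<longlongrightarrow> 0) (at 0)"
      by (auto intro!: tendsto_eq_intros)
  qed
  ultimately show ?thesis by (simp add: DERIV_def)
qed

lemma isCont_wave_deriv:
  assumes B: "\<And>i. \<bar>c i\<bar> \<le> B"
  shows "isCont (wave_deriv c) y"
proof (cases "y = of_int \<lfloor>y\<rfloor>")
  case False
  let ?S = "{of_int \<lfloor>y\<rfloor><..<of_int \<lfloor>y\<rfloor> + 1 :: real}"
  have "continuous_on ?S (\<lambda>x. c \<lfloor>y\<rfloor> * (pi * sin (2 * pi * x)))"
    by (intro continuous_intros)
  then have "continuous_on ?S (wave_deriv c)"
    by (subst continuous_on_cong[OF refl, where g="\<lambda>x. c \<lfloor>y\<rfloor> * (pi * sin (2 * pi * x))"])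
      (auto simp: wave_deriv_def floor_eq_on_Ioo)
  then show ?thesis using non_int_in_Ioo[OF False] by (simp add: continuous_on_eq_continuous_at)
next
  case True
  define n where "n = \<lfloor>y\<rfloor>"
  have y: "y = of_int n" using True by (simp add: n_def)
  have s0: "sin (2 * pi * y) = 0"
    using sin_npi_int[of "2 * n"] by (simp add: y mult.assoc mult.left_commute)
  have "(wave_deriv c \<longlongrightarrow> 0) (at y)"
  proof (rule Lim_null_comparison)
    have "norm (wave_deriv c x) \<le> B * (pi * \<bar>sin (2 * pi * x)\<bar>)" for x
      using B by (simp add: wave_deriv_def abs_mult mult_right_mono)
    then show "\<forall>\<^sub>F x in at y. norm (wave_deriv c x) \<le> B * (pi * \<bar>sin (2 * pi * x)\<bar>)" by simp
    have "isCont (\<lambda>x. B * (pi * \<bar>sin (2 * pi * x)\<bar>)) y" by (intro continuous_intros)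
    then show "((\<lambda>x. B * (pi * \<bar>sin (2 * pi * x)\<bar>)) \<longlongrightarrow> 0) (at y)"
      using s0 by (simp add: isCont_def)
  qed
  moreover have "wave_deriv c y = 0" by (simp add: wave_deriv_def s0)
  ultimately show ?thesis by (simp add: isCont_def)
qed

section \<open>The series of waves as a \<open>C1_diffeomorphism\<close>\<close>

definition phase :: "nat \<Rightarrow> real \<Rightarrow> real" where
  "phase l x = 2 ^ (l div 2) * x + real (l mod 2) / 2"

text \<open>One factor \<open>real l + 1\<close> is spent on the size of the coefficients, and the
  other two make the derivative series converge. The 40 keeps that series below 1/2 in modulus, so
  the derivative stays positive.\<close>

definition amp :: "nat \<Rightarrow> real" where
  "amp l = 1 / (40 * 2 ^ (l div 2) * (real l + 1) ^ 3)"

definition bumpy :: "(nat \<Rightarrow> int \<Rightarrow> real) \<Rightarrow> real \<Rightarrow> real" where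
  "bumpy c x = x + (\<Sum>l. amp l * wave (c l) (phase l x))"

abbreviation bump_deriv :: "(nat \<Rightarrow> int \<Rightarrow> real) \<Rightarrow> nat \<Rightarrow> real \<Rightarrow> real" where
  "bump_deriv c l x \<equiv> amp l * (wave_deriv (c l) (phase l x) * 2 ^ (l div 2))"

definition bumpy_deriv :: "(nat \<Rightarrow> int \<Rightarrow> real) \<Rightarrow> real \<Rightarrow> real" where
  "bumpy_deriv c x = 1 + (\<Sum>l. bump_deriv c l x)"

lemma amp_pos: "0 < amp l"
  by (simp add: amp_def)

lemma sums_inverse_squares: "(\<lambda>l. 1 / (real l + 1)\<^sup>2) sums (pi\<^sup>2 / 6)"
  using inverse_squares_sums by (simp add: add.commute)

lemma suminf_inverse_squares_le: "(\<Sum>l. 1 / (real l + 1)\<^sup>2) \<le> 3"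
proof -
  have "pi\<^sup>2 \<le> 4\<^sup>2" using pi_less_4 pi_gt_zero by (intro power_mono) auto
  then show ?thesis using sums_unique[OF sums_inverse_squares] by simp
qed

locale bounded_coeffs =
  fixes c :: "nat \<Rightarrow> int \<Rightarrow> real"
  assumes c_le: "\<bar>c l i\<bar> \<le> real l + 1"
begin

lemma term_bound: "\<bar>amp l * wave (c l) (phase l x)\<bar> \<le> (1 / 40) * (1 / (real l + 1)\<^sup>2)"
proof -
  have "\<bar>wave (c l) (phase l x)\<bar> \<le> (real l + 1) * 1"
    unfolding wave_def abs_mult
    by (intro mult_mono c_le) (auto simp: abs_square_le_1)
  then have "\<bar>amp l * wave (c l) (phase l x)\<bar> \<le> amp l * (real l + 1)"
    using amp_pos[of l] by (simp add: abs_mult)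
  \<comment> \<open>The power of 2 in the amplitude is only estimated by 1 here. It is needed in
    full for the derivative.\<close>
  also have "\<dots> \<le> (1 / (40 * 1 * (real l + 1) ^ 3)) * (real l + 1)"
    unfolding amp_def by (intro mult_right_mono divide_left_mono mult_mono) auto
  also have "\<dots> = (1 / 40) * (1 / (real l + 1)\<^sup>2)"
    by (simp add: power2_eq_square power3_eq_cube)
  finally show ?thesis .
qed

lemma deriv_term_bound:
  "\<bar>bump_deriv c l x\<bar> \<le> (1 / 10) * (1 / (real l + 1)\<^sup>2)"
proof -
  have "\<bar>wave_deriv (c l) (phase l x)\<bar> \<le> (real l + 1) * (pi * 1)"
    unfolding wave_deriv_def abs_mult by (intro mult_mono c_le) auto
  also have "\<dots> \<le> (real l + 1) * 4"
    using pi_less_4 by (intro mult_left_mono) auto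
  finally have "\<bar>bump_deriv c l x\<bar> \<le> amp l * (((real l + 1) * 4) * 2 ^ (l div 2))"
    using amp_pos[of l] by (simp add: abs_mult)
  also have "\<dots> = (1 / 10) * (1 / (real l + 1)\<^sup>2)"
  proof -
    define r where "r = real l + 1"
    have "0 < r" by (simp add: r_def)
    then show ?thesis
      unfolding amp_def r_def[symmetric] by (simp add: power2_eq_square power3_eq_cube)
  qed
  finally show ?thesis .
qed

lemma summable_bound: "summable (\<lambda>l. C * (1 / (real l + 1)\<^sup>2))"
  using sums_inverse_squares by (intro summable_mult) (rule sums_summable)

lemma summable_terms: "summable (\<lambda>l. amp l * wave (c l) (phase l x))"
  by (rule summable_comparison_test'[OF summable_bound[of "1/40"], of 0]) (use term_bound in auto)

lemma bumpy_near_id: "\<bar>bumpy c x - x\<bar> \<le> 1"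
proof -
  have "\<bar>\<Sum>l. amp l * wave (c l) (phase l x)\<bar> \<le> (\<Sum>l. (1 / 40) * (1 / (real l + 1)\<^sup>2))"
    using norm_suminf_le[OF _ summable_bound[of "1/40"], of "\<lambda>l. amp l * wave (c l) (phase l x)"] term_bound
    by auto
  also have "\<dots> = (1 / 40) * (\<Sum>l. 1 / (real l + 1)\<^sup>2)"
    by (rule suminf_mult) (use sums_inverse_squares sums_summable in blast)
  finally show ?thesis using suminf_inverse_squares_le by (simp add: bumpy_def)
qed

lemma bumpy_deriv_near_1: "\<bar>bumpy_deriv c x - 1\<bar> \<le> 1 / 2"
proof -
  have "\<bar>\<Sum>l. bump_deriv c l x\<bar> \<le> (\<Sum>l. (1 / 10) * (1 / (real l + 1)\<^sup>2))"
    using norm_suminf_le[OF _ summable_bound[of "1/10"], of "\<lambda>l. bump_deriv c l x"]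
      deriv_term_bound by auto
  also have "\<dots> = (1 / 10) * (\<Sum>l. 1 / (real l + 1)\<^sup>2)"
    by (rule suminf_mult) (use sums_inverse_squares sums_summable in blast)
  finally show ?thesis using suminf_inverse_squares_le by (simp add: bumpy_deriv_def)
qed

lemma uniform_limit_deriv:
  "uniform_limit UNIV (\<lambda>n x. \<Sum>l<n. bump_deriv c l x)
     (\<lambda>x. \<Sum>l. bump_deriv c l x) sequentially"
  by (rule Weierstrass_m_test[OF _ summable_bound[of "1/10"]]) (use deriv_term_bound in auto)

lemma bumpy_has_derivative: "(bumpy c has_real_derivative bumpy_deriv c x) (at x)"
proof -
  have "((\<lambda>x. \<Sum>l. amp l * wave (c l) (phase l x)) has_real_derivative
      (\<Sum>l. bump_deriv c l x)) (at x)"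
  proof (rule has_field_derivative_series'(2)[where S=UNIV and ?x0.0=0 and
        f="\<lambda>l x. amp l * wave (c l) (phase l x)" and
        f'="\<lambda>l x. bump_deriv c l x"])
    fix l x
    have "(phase l has_real_derivative 2 ^ (l div 2)) (at x)"
      unfolding phase_def[abs_def] by (auto intro!: derivative_eq_intros)
    then have "((\<lambda>x. wave (c l) (phase l x)) has_real_derivative wave_deriv (c l) (phase l x) * 2 ^ (l div 2)) (at x)"
      by (rule DERIV_chain2[OF wave_has_derivative[of "c l" "real l + 1", OF c_le]])
    then show "((\<lambda>x. amp l * wave (c l) (phase l x)) has_real_derivative
        bump_deriv c l x) (at x within UNIV)"
      using DERIV_cmult by blast
  next
    show "uniformly_convergent_on UNIV
        (\<lambda>n x. \<Sum>l<n. bump_deriv c l x)"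
      using uniform_limit_deriv uniformly_convergentI by blast
  qed (auto simp: summable_terms)
  then show ?thesis
    unfolding bumpy_def[abs_def] bumpy_deriv_def by (intro DERIV_add DERIV_ident)
qed

lemma continuous_bumpy_deriv: "continuous_on UNIV (bumpy_deriv c)"
proof -
  have cont: "continuous_on UNIV (\<lambda>x. wave_deriv (c l) (phase l x))" for l
  proof (rule continuous_on_compose2[of UNIV "wave_deriv (c l)" UNIV "phase l"])
    show "continuous_on UNIV (wave_deriv (c l))"
      using isCont_wave_deriv[OF c_le] by (simp add: continuous_on_eq_continuous_at)
    show "continuous_on UNIV (phase l)"
      unfolding phase_def[abs_def] by (intro continuous_intros)
  qed auto
  have "continuous_on UNIV (\<lambda>x. \<Sum>l. bump_deriv c l x)"
    by (rule uniform_limit_theorem[OF _ uniform_limit_deriv])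
      (auto intro!: always_eventually continuous_intros cont)
  then show ?thesis unfolding bumpy_deriv_def[abs_def] by (intro continuous_intros)
qed

lemma bumpy_strict_mono:
  assumes "x < y"
  shows "bumpy c x < bumpy c y"
  using assms
proof (rule DERIV_pos_imp_increasing)
  show "\<exists>y. (bumpy c has_real_derivative y) (at z) \<and> 0 < y" for z
  proof -
    have "0 < bumpy_deriv c z" using bumpy_deriv_near_1[of z] by linarith
    then show ?thesis using bumpy_has_derivative by blast
  qed
qed

lemma isCont_bumpy: "isCont (bumpy c) x"
  using bumpy_has_derivative DERIV_isCont by blast

lemma bij_bumpy: "bij (bumpy c)"
proof (rule bijI)
  show "inj (bumpy c)"
    by (rule injI) (metis bumpy_strict_mono less_irrefl linorder_neqE_linordered_idom)
  show "surj (bumpy c)"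
  proof -
    have "\<exists>x. bumpy c x = y" for y
    proof -
      have "bumpy c (y - 1) \<le> y" "y \<le> bumpy c (y + 1)"
        using bumpy_near_id[of "y - 1"] bumpy_near_id[of "y + 1"] by linarith+
      then show ?thesis
        using IVT[of "bumpy c" "y - 1" y "y + 1"] isCont_bumpy by auto
    qed
    then show ?thesis by (metis surjI)
  qed
qed

lemma C1_diffeomorphism_bumpy: "C1_diffeomorphism (bumpy c)"
proof -
  let ?g = "inv (bumpy c)"
  have gf: "?g (bumpy c x) = x" for x using bij_bumpy by (simp add: bij_is_inj)
  have fg: "bumpy c (?g y) = y" for y using bij_bumpy by (simp add: bij_is_surj surj_f_inv_f)
  have cont_g: "isCont ?g y" for y
  proof -
    have "isCont ?g (bumpy c (?g y))"
      by (rule isCont_inverse_function[where d=1]) (auto simp: gf isCont_bumpy)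
    then show ?thesis by (simp add: fg)
  qed
  have pos: "bumpy_deriv c x \<noteq> 0" for x using bumpy_deriv_near_1[of x] by linarith
  have "(?g has_real_derivative inverse (bumpy_deriv c (?g y))) (at y)" for y
    by (rule DERIV_inverse_function[where f="bumpy c" and a="y - 1" and b="y + 1"])
      (auto simp: bumpy_has_derivative pos fg cont_g)
  moreover have "continuous_on UNIV (\<lambda>y. inverse (bumpy_deriv c (?g y)))"
  proof (intro continuous_on_inverse ballI pos)
    show "continuous_on UNIV (\<lambda>y. bumpy_deriv c (?g y))"
      using cont_g by (intro continuous_on_compose2[OF continuous_bumpy_deriv])
        (auto simp: continuous_on_eq_continuous_at)
  qed
  ultimately have "?g C1_differentiable_on UNIV"
    unfolding C1_differentiable_on_def has_real_derivative_iff_has_vector_derivative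
    by (intro exI[of _ "\<lambda>y. inverse (bumpy_deriv c (?g y))"]) blast
  moreover have "bumpy c C1_differentiable_on UNIV"
    unfolding C1_differentiable_on_def
    using bumpy_has_derivative continuous_bumpy_deriv
    by (auto simp: has_real_derivative_iff_has_vector_derivative)
  ultimately show ?thesis using bij_bumpy by (simp add: C1_diffeomorphism_def)
qed

lemma bumpy_lipschitz: "\<bar>bumpy c x - bumpy c y\<bar> \<le> 2 * \<bar>x - y\<bar>"
proof -
  have "norm (bumpy c x - bumpy c y) \<le> 2 * norm (x - y)"
  proof (rule field_differentiable_bound[where S=UNIV])
    show "(bumpy c has_real_derivative bumpy_deriv c z) (at z within UNIV)" for z
      using bumpy_has_derivative by simp
    show "norm (bumpy_deriv c z) \<le> 2" for z
      using bumpy_deriv_near_1[of z] unfolding real_norm_def by linarith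
  qed auto
  then show ?thesis by simp
qed

end

section \<open>Random phases\<close>

text \<open>Exponential tilting: multiplying the standard density by exp(\<epsilon> z - 1/2) moves
  its mean to \<epsilon>. The resulting bound is linear in \<open>a\<close> in the exponent, which
  suffices because the truncation height grows linearly with the level.\<close>

lemma normal_half_tail:
  assumes \<epsilon>: "\<epsilon> = 1 \<or> \<epsilon> = - 1"
  shows "measure \<N> {z. a < \<epsilon> * z} \<le> exp (1/2 - a)"
proof -
  interpret N: real_distribution \<N> by (rule real_dist_normal_dist)
  interpret N1: prob_space "density lborel (normal_density \<epsilon> 1)" by (rule prob_space_normal_density) simp
  have total: "(\<integral>\<^sup>+z. ennreal (normal_density \<epsilon> 1 z) \<partial>lborel) = 1"
    using N1.emeasure_space_1 by (simp add: emeasure_density)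
  have "emeasure \<N> {z. a < \<epsilon> * z}
      = (\<integral>\<^sup>+z. ennreal (std_normal_density z) * indicator {z. a < \<epsilon> * z} z \<partial>lborel)"
    by (subst emeasure_density) auto
  also have "\<dots> \<le> (\<integral>\<^sup>+z. ennreal (exp (1/2 - a)) * ennreal (normal_density \<epsilon> 1 z) \<partial>lborel)"
  proof (rule nn_integral_mono)
    fix z :: real
    show "ennreal (std_normal_density z) * indicator {z. a < \<epsilon> * z} z \<le> ennreal (exp (1/2 - a)) * ennreal (normal_density \<epsilon> 1 z)"
    proof (cases "a < \<epsilon> * z")
      case True
      have "exp (- z\<^sup>2 / 2) \<le> exp (1/2 - a) * exp (- (z - \<epsilon>)\<^sup>2 / 2)"
        using True \<epsilon> by (auto simp: power2_eq_square field_simps simp flip: exp_add)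
      then have "1 / sqrt (2 * pi) * exp (- z\<^sup>2 / 2) \<le> 1 / sqrt (2 * pi) * (exp (1/2 - a) * exp (- (z - \<epsilon>)\<^sup>2 / 2))"
        by (intro mult_left_mono) auto
      then have "std_normal_density z \<le> exp (1/2 - a) * normal_density \<epsilon> 1 z"
        by (simp add: std_normal_density_def normal_density_def mult_ac)
      then show ?thesis using True by (simp add: ennreal_leI flip: ennreal_mult)
    qed simp
  qed
  also have "\<dots> = ennreal (exp (1/2 - a))"
    by (subst nn_integral_cmult) (auto simp: total)
  finally show ?thesis by (simp add: N.emeasure_eq_measure)
qed

lemma normal_tail: "measure \<N> {z. a < \<bar>z\<bar>} \<le> 2 * exp (1/2 - a)"
proof -
  interpret N: real_distribution \<N> by (rule real_dist_normal_dist)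
  have "measure \<N> {z. a < \<bar>z\<bar>} =
      measure \<N> ({z. a < 1 * z} \<union> {z. a < (- 1) * z})"
    by (intro arg_cong[where f="measure \<N>"]) auto
  also have "\<dots> \<le> measure \<N> {z. a < 1 * z} + measure \<N> {z. a < (- 1) * z}"
    by (rule measure_Un_le) measurable
  also have "\<dots> \<le> exp (1/2 - a) + exp (1/2 - a)"
    by (intro add_mono normal_half_tail) auto
  finally show ?thesis by simp
qed

definition trunc :: "nat \<Rightarrow> real \<Rightarrow> real" where
  "trunc l z = max (- (real l + 1)) (min (real l + 1) z)"

lemma trunc_le: "\<bar>trunc l z\<bar> \<le> real l + 1"
  by (auto simp: trunc_def)

lemma borel_measurable_trunc [measurable]: "trunc l \<in> borel_measurable borel"
  unfolding trunc_def[abs_def] by measurable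

text \<open>Truncation changes the integrand only on the tail event, where two numbers of modulus 1
  differ by at most 2.\<close>

lemma norm_char_trunc:
  "cmod (\<integral>z. iexp (s * trunc l z) \<partial>\<N>) \<le> exp (- s\<^sup>2 / 2) + 4 * exp (- real l)"
proof -
  let ?D = "\<integral>z. iexp (s * trunc l z) - iexp (s * z) \<partial>\<N>"
  interpret N: real_distribution \<N> by (rule real_dist_normal_dist)
  let ?A = "{z. real l + 1 < \<bar>z\<bar>}"
  have i1: "integrable \<N> (\<lambda>z. iexp (s * trunc l z))"
    by (intro N.integrable_const_bound[where B=1]) auto
  have i2: "integrable \<N> (\<lambda>z. iexp (s * z))"
    by (intro N.integrable_const_bound[where B=1]) auto
  have split: "(\<integral>z. iexp (s * trunc l z) \<partial>\<N>)
      = char \<N> s + ?D"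
    using i1 i2 by (simp add: char_def)
  have "cmod (complex_of_real (exp (- (s\<^sup>2) / 2))) = exp (- s\<^sup>2 / 2)"
    by (subst norm_of_real) simp
  then have main: "cmod (char \<N> s) = exp (- s\<^sup>2 / 2)"
    by (simp only: char_std_normal_distribution)
  have "cmod ?D
      \<le> (\<integral>z. 2 * indicator ?A z \<partial>\<N>)"
  proof (rule Bochner_Integration.integral_norm_bound_integral)
    show "integrable \<N> (\<lambda>z. iexp (s * trunc l z) - iexp (s * z))"
      using i1 i2 by simp
    show "integrable \<N> (\<lambda>z. 2 * indicator ?A z :: real)"
      by (intro N.integrable_const_bound[where B=2]) (auto simp: indicator_def)
    show "cmod (iexp (s * trunc l z) - iexp (s * z)) \<le> 2 * indicator ?A z" for z
    proof (cases "z \<in> ?A")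
      case True
      have "cmod (iexp (s * trunc l z) - iexp (s * z)) \<le> cmod (iexp (s * trunc l z)) + cmod (iexp (s * z))"
        by (rule norm_triangle_ineq4)
      then show ?thesis using True by simp
    next
      case False
      then have "trunc l z = z" by (auto simp: trunc_def)
      then show ?thesis using False by simp
    qed
  qed
  also have "(\<integral>z. 2 * indicator ?A z \<partial>\<N>) = 2 * measure \<N> ?A"
    by simp
  also have "\<dots> \<le> 2 * (2 * exp (1/2 - (real l + 1)))"
    by (intro mult_left_mono normal_tail) auto
  also have "\<dots> \<le> 4 * exp (- real l)" by simp
  finally have "cmod ?D \<le> 4 * exp (- real l)" .
  then show ?thesis
    unfolding split main[symmetric] by (rule order_trans[OF norm_triangle_ineq add_left_mono])
qed

text \<open>If the sum has modulus at least \<open>2 * u + e\<close> and its mean has modulus at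
  most \<open>e\<close>, then the real or the imaginary part deviates from its mean by at least
  \<open>u\<close>, so the real inequality is applied to each part.\<close>

lemma complex_hoeffding:
  fixes Y :: "'i \<Rightarrow> 'a \<Rightarrow> complex"
  assumes "prob_space P" and J: "finite J"
    and indep: "prob_space.indep_vars P (\<lambda>_. borel) Y J"
    and bound: "\<And>j \<omega>. j \<in> J \<Longrightarrow> cmod (Y j \<omega>) \<le> c j"
    and pos: "0 < (\<Sum>j\<in>J. (c j)\<^sup>2)" and V: "(\<Sum>j\<in>J. (c j)\<^sup>2) \<le> V"
    and mean: "cmod (\<Sum>j\<in>J. \<integral>\<omega>. Y j \<omega> \<partial>P) \<le> e" and u: "0 < u"
  shows "measure P {\<omega> \<in> space P. 2 * u + e \<le> cmod (\<Sum>j\<in>J. Y j \<omega>)} \<le> 4 * exp (- u\<^sup>2 / (2 * V))"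
proof -
  let ?C = "{\<omega> \<in> space P. 2 * u + e \<le> cmod (\<Sum>j\<in>J. Y j \<omega>)}"
  let ?B = "{\<omega> \<in> space P. u \<le> \<bar>(\<Sum>j\<in>J. Im (Y j \<omega>)) - (\<Sum>j\<in>J. \<integral>\<omega>. Im (Y j \<omega>) \<partial>P)\<bar>}"
  let ?A = "{\<omega> \<in> space P. u \<le> \<bar>(\<Sum>j\<in>J. Re (Y j \<omega>)) - (\<Sum>j\<in>J. \<integral>\<omega>. Re (Y j \<omega>) \<partial>P)\<bar>}"
  interpret prob_space P by fact
  have Ym: "Y j \<in> borel_measurable P" if "j \<in> J" for j
    using indep that by (simp add: indep_vars_def)
  have int: "integrable P (Y j)" if "j \<in> J" for j
    using bound that Ym by (intro integrable_const_bound[where B="c j"]) auto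
  have tail: "measure P {\<omega> \<in> space P. u \<le> \<bar>(\<Sum>j\<in>J. f (Y j \<omega>)) - (\<Sum>j\<in>J. \<integral>\<omega>. f (Y j \<omega>) \<partial>P)\<bar>} \<le> 2 * exp (- u\<^sup>2 / (2 * V))"
    if f: "f \<in> borel_measurable borel" "\<And>z. \<bar>f z\<bar> \<le> cmod z" for f :: "complex \<Rightarrow> real"
  proof -
    interpret H: Hoeffding_ineq P J "\<lambda>j \<omega>. f (Y j \<omega>)" "\<lambda>j. - c j" c "\<Sum>j\<in>J. \<integral>\<omega>. f (Y j \<omega>) \<partial>P"
    proof unfold_locales
      show "indep_vars (\<lambda>_. borel) (\<lambda>j \<omega>. f (Y j \<omega>)) J"
        by (rule indep_vars_compose2[OF indep]) (use f in auto)
      show "AE x in P. f (Y j x) \<in> {- c j..c j}" if "j \<in> J" for j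
      proof (rule AE_I2)
        fix x
        have "\<bar>f (Y j x)\<bar> \<le> c j" using f(2)[of "Y j x"] bound[OF that, of x] by linarith
        then show "f (Y j x) \<in> {- c j..c j}" by auto
      qed
    qed (use J in auto)
    \<comment> \<open>The ranges are intervals of length \<open>2 * c j\<close>. This 4 turns
      Hoeffding's exponent into \<open>- u\<^sup>2 / (2 * V)\<close>.\<close>
    have eq: "(\<Sum>j\<in>J. (c j - - c j)\<^sup>2) = 4 * (\<Sum>j\<in>J. (c j)\<^sup>2)"
      by (simp add: sum_distrib_left power2_eq_square algebra_simps)
    have "measure P {\<omega> \<in> space P. u \<le> \<bar>(\<Sum>j\<in>J. f (Y j \<omega>)) - (\<Sum>j\<in>J. \<integral>\<omega>. f (Y j \<omega>) \<partial>P)\<bar>}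
        \<le> 2 * exp (- 2 * u\<^sup>2 / (4 * (\<Sum>j\<in>J. (c j)\<^sup>2)))"
      using H.Hoeffding_ineq_abs_ge[of u] u pos unfolding eq by simp
    also have "\<dots> \<le> 2 * exp (- u\<^sup>2 / (2 * V))"
      using pos V u by (simp add: frac_le divide_left_mono)
    finally show ?thesis .
  qed
  have "measure P ?C
      \<le> measure P (?A
         \<union> ?B)"
  proof (rule finite_measure_mono)
    show "?C
      \<subseteq> ?A
         \<union> ?B"
    proof
      fix \<omega> assume \<omega>: "\<omega> \<in> ?C"
      define S where "S = (\<Sum>j\<in>J. Y j \<omega>)"
      define m where "m = (\<Sum>j\<in>J. \<integral>\<omega>. Y j \<omega> \<partial>P)"
      have Re: "Re S = (\<Sum>j\<in>J. Re (Y j \<omega>))" "Re m = (\<Sum>j\<in>J. \<integral>\<omega>. Re (Y j \<omega>) \<partial>P)"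
        using int by (simp_all add: S_def m_def)
      have Im: "Im S = (\<Sum>j\<in>J. Im (Y j \<omega>))" "Im m = (\<Sum>j\<in>J. \<integral>\<omega>. Im (Y j \<omega>) \<partial>P)"
        using int by (simp_all add: S_def m_def)
      have "2 * u + e \<le> cmod S" using \<omega> by (simp add: S_def)
      moreover have "cmod S \<le> cmod (S - m) + cmod m" using norm_triangle_ineq[of "S - m" m] by simp
      moreover have "cmod m \<le> e" using mean by (simp add: m_def)
      moreover have "cmod (S - m) \<le> \<bar>Re S - Re m\<bar> + \<bar>Im S - Im m\<bar>"
        using cmod_le[of "S - m"] by simp
      ultimately have "u \<le> \<bar>Re S - Re m\<bar> \<or> u \<le> \<bar>Im S - Im m\<bar>" by linarith
      then show "\<omega> \<in> ?A
         \<union> ?B"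
        using \<omega> unfolding Re Im by blast
    qed
  qed (use Ym in measurable)
  also have "\<dots> \<le> 2 * exp (- u\<^sup>2 / (2 * V)) + 2 * exp (- u\<^sup>2 / (2 * V))"
    by (rule order_trans[OF measure_Un_le add_mono[OF tail[of Re] tail[of Im]]])
      (use Ym abs_Re_le_cmod abs_Im_le_cmod in measurable)
  finally show ?thesis by simp
qed

text \<open>The integral splits over the fibres of \<kappa>, and each fibre sees a single
  independent variable \<open>Z i\<close>. A fibre contributes at most its mass \<open>c i\<close>;
  since these masses sum to 1 and are at most \<open>M\<close>, their squares sum to at most
  \<open>M\<close>, which is where the regularity of \<mu> enters.\<close>

lemma random_phase_tail:
  fixes g h \<phi> :: "real \<Rightarrow> real" and \<kappa> :: "real \<Rightarrow> int" and Z :: "int \<Rightarrow> 'a \<Rightarrow> real"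
  assumes \<mu>: "real_distribution \<mu>"
    and [measurable]: "g \<in> borel_measurable borel" "h \<in> borel_measurable borel"
      "\<phi> \<in> borel_measurable borel" "\<kappa> \<in> borel \<rightarrow>\<^sub>M count_space UNIV" "G \<in> sets borel"
    and J: "finite J" "AE x in \<mu>. \<kappa> x \<in> J"
    and M: "\<And>i. measure \<mu> {x. \<kappa> x = i} \<le> M"
    and e: "\<And>x. x \<in> G \<Longrightarrow> cmod (\<integral>z. iexp (h x * \<phi> z) \<partial>\<N>) \<le> e" "0 \<le> e"
    and P: "prob_space P" and indep: "prob_space.indep_vars P (\<lambda>_. borel) Z J"
    and Z: "\<And>i. distr P borel (Z i) = \<N>" "\<And>i. Z i \<in> borel_measurable P"
    and u: "0 < u"
  shows "measure P {\<omega> \<in> space P. 2 * u + e \<le>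
      cmod (\<integral>x. indicator G x *\<^sub>R iexp (g x + h x * \<phi> (Z (\<kappa> x) \<omega>)) \<partial>\<mu>)} \<le> 4 * exp (- u\<^sup>2 / (2 * M))"
proof -
  let ?T = "\<lambda>i x z. indicator (G \<inter> {x. \<kappa> x = i}) x *\<^sub>R iexp (g x + h x * \<phi> z)"
  interpret real_distribution \<mu> by (rule \<mu>)
  interpret P: prob_space P by fact
  interpret N: real_distribution \<N> by (rule real_dist_normal_dist)
  interpret Q: pair_prob_space \<N> \<mu> ..
  define W where "W i z = (\<integral>x. ?T i x z \<partial>\<mu>)" for i z
  define c where "c i = measure \<mu> {x. \<kappa> x = i}" for i
  have fib: "{x. \<kappa> x = i} \<in> sets borel" for i by measurable
  have Gfib [measurable]: "G \<inter> {x. \<kappa> x = i} \<in> sets borel" for i by measurable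
  have W_meas [measurable]: "W i \<in> borel_measurable borel" for i
    unfolding W_def[abs_def] by measurable
  have W_le: "cmod (W i z) \<le> c i" for i z
  proof -
    have "cmod (W i z) \<le> (\<integral>x. indicator {x. \<kappa> x = i} x \<partial>\<mu>)"
      unfolding W_def
    proof (rule Bochner_Integration.integral_norm_bound_integral)
      show "integrable \<mu> (\<lambda>x. ?T i x z)"
        by (intro integrable_const_bound[where B=1]) (auto simp: indicator_def)
      show "integrable \<mu> (indicator {x. \<kappa> x = i} :: _ \<Rightarrow> real)"
        using fib by (intro integrable_const_bound[where B=1]) (auto simp: indicator_def)
    qed (auto simp: indicator_def)
    also have "\<dots> = c i" using fib by (simp add: c_def)
    finally show ?thesis .
  qed
  have sum_c: "(\<Sum>i\<in>J. c i) = 1"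
  proof -
    have "(\<Sum>i\<in>J. c i) = measure \<mu> (\<Union>i\<in>J. {x. \<kappa> x = i})"
      unfolding c_def using J(1) fib
      by (intro finite_measure_finite_Union[symmetric]) (auto simp: disjoint_family_on_def)
    also have "(\<Union>i\<in>J. {x. \<kappa> x = i}) = {x \<in> space \<mu>. \<kappa> x \<in> J}" by auto
    also have "measure \<mu> {x \<in> space \<mu>. \<kappa> x \<in> J} = 1"
      using J(2) by (intro prob_Collect_eq_1[THEN iffD2]) auto
    finally show ?thesis .
  qed
  have c0: "0 \<le> c i" for i by (simp add: c_def)
  have sq: "(\<Sum>i\<in>J. (c i)\<^sup>2) \<le> M"
  proof -
    have "(\<Sum>i\<in>J. (c i)\<^sup>2) \<le> (\<Sum>i\<in>J. M * c i)"
      using M c0 by (intro sum_mono) (simp add: c_def power2_eq_square mult_right_mono)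
    also have "\<dots> = M" by (simp add: sum_distrib_left[symmetric] sum_c)
    finally show ?thesis .
  qed
  have sq_pos: "0 < (\<Sum>i\<in>J. (c i)\<^sup>2)"
  proof -
    have "\<exists>i\<in>J. c i \<noteq> 0" using sum_c by (metis sum.neutral zero_neq_one)
    then obtain i where "i \<in> J" "c i \<noteq> 0" by blast
    then show ?thesis using J(1) by (intro sum_pos2[of J i]) auto
  qed
  have mean: "cmod (\<integral>\<omega>. W i (Z i \<omega>) \<partial>P) \<le> e * c i" for i
  proof -
    have E1: "(\<integral>\<omega>. W i (Z i \<omega>) \<partial>P) = (\<integral>z. W i z \<partial>\<N>)"
      using Z by (subst Z(1)[of i, symmetric], subst integral_distr) auto
    \<comment> \<open>After exchanging the integrals, the mean of a summand is an integral over the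
      fibre of characteristic function values at \<open>h x\<close>, which are at most
      \<open>e\<close> on \<open>G\<close>.\<close>
    have E2: "(\<integral>z. W i z \<partial>\<N>) = (\<integral>x. (\<integral>z. ?T i x z \<partial>\<N>) \<partial>\<mu>)"
      unfolding W_def
      by (rule Q.Fubini_integral[symmetric], intro Q.P.integrable_const_bound[where B=1])
        (auto simp: indicator_def split_beta')
    have "cmod (\<integral>x. (\<integral>z. ?T i x z \<partial>\<N>) \<partial>\<mu>)
        \<le> (\<integral>x. e * indicator {x. \<kappa> x = i} x \<partial>\<mu>)"
    proof (rule Bochner_Integration.integral_norm_bound_integral)
      have le: "cmod (\<integral>z. ?T i x z \<partial>\<N>) \<le> e * indicator {x. \<kappa> x = i} x" for x
      proof (cases "x \<in> G \<inter> {x. \<kappa> x = i}")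
        case True
        have "(\<integral>z. ?T i x z \<partial>\<N>)
            = (\<integral>z. iexp (g x) * iexp (h x * \<phi> z) \<partial>\<N>)"
          using True by (simp add: distrib_left exp_add)
        also have "\<dots> = iexp (g x) * (\<integral>z. iexp (h x * \<phi> z) \<partial>\<N>)" by simp
        finally show ?thesis using e(1)[of x] True by (simp add: norm_mult)
      qed (use e(2) in simp)
      then show "cmod (\<integral>z. ?T i x z \<partial>\<N>) \<le> e * indicator {x. \<kappa> x = i} x" for x .
      have le': "cmod (\<integral>z. ?T i x z \<partial>\<N>) \<le> e" for x
        using le[of x] e(2) by (auto simp: indicator_def split: if_splits)
      show "integrable \<mu> (\<lambda>x. \<integral>z. ?T i x z \<partial>\<N>)"
        using le' by (intro integrable_const_bound[where B=e]) auto
      show "integrable \<mu> (\<lambda>x. e * indicator {x. \<kappa> x = i} x)"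
        using fib e(2) by (intro integrable_const_bound[where B=e]) (auto simp: indicator_def)
    qed
    also have "\<dots> = e * c i" using fib by (simp add: c_def)
    finally show ?thesis by (simp only: E1 E2)
  qed
  have mean_sum: "cmod (\<Sum>i\<in>J. \<integral>\<omega>. W i (Z i \<omega>) \<partial>P) \<le> e"
  proof -
    have "cmod (\<Sum>i\<in>J. \<integral>\<omega>. W i (Z i \<omega>) \<partial>P) \<le> (\<Sum>i\<in>J. e * c i)"
      using mean by (intro sum_norm_le) auto
    then show ?thesis by (simp add: sum_distrib_left[symmetric] sum_c)
  qed
  have eq: "(\<integral>x. indicator G x *\<^sub>R iexp (g x + h x * \<phi> (Z (\<kappa> x) \<omega>)) \<partial>\<mu>) = (\<Sum>i\<in>J. W i (Z i \<omega>))" for \<omega>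
  proof -
    have "(\<Sum>i\<in>J. W i (Z i \<omega>)) = (\<integral>x. (\<Sum>i\<in>J. ?T i x (Z i \<omega>)) \<partial>\<mu>)"
      unfolding W_def
      by (rule Bochner_Integration.integral_sum[symmetric], intro integrable_const_bound[where B=1])
        (auto simp: indicator_def)
    also have "\<dots> = (\<integral>x. indicator G x *\<^sub>R iexp (g x + h x * \<phi> (Z (\<kappa> x) \<omega>)) \<partial>\<mu>)"
    proof (rule integral_cong_AE)
      show "AE x in \<mu>. (\<Sum>i\<in>J. ?T i x (Z i \<omega>))
         = indicator G x *\<^sub>R iexp (g x + h x * \<phi> (Z (\<kappa> x) \<omega>))"
        using J(2)
      proof eventually_elim
        case (elim x)
        have "(\<Sum>i\<in>J. ?T i x (Z i \<omega>))
           = (\<Sum>i\<in>{\<kappa> x}. ?T i x (Z i \<omega>))"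
          using J(1) elim by (intro sum.mono_neutral_right) auto
        then show ?case by (simp add: indicator_def)
      qed
    qed measurable
    finally show ?thesis by simp
  qed
  show ?thesis
    unfolding eq
  proof (rule complex_hoeffding[where c=c, OF P J(1) _ _ sq_pos sq mean_sum u])
    show "P.indep_vars (\<lambda>_. borel) (\<lambda>j \<omega>. W j (Z j \<omega>)) J"
      by (rule P.indep_vars_compose2[OF indep]) auto
  qed (rule W_le)
qed

section \<open>The Gaussian field and the resampling of one level\<close>

definition gauss_field :: "(nat \<times> int \<Rightarrow> real) measure" where
  "gauss_field = PiM UNIV (\<lambda>_. \<N>)"

definition random_diffeo :: "(nat \<times> int \<Rightarrow> real) \<Rightarrow> real \<Rightarrow> real" where
  "random_diffeo \<omega> = bumpy (\<lambda>l i. trunc l (\<omega> (l, i)))"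

(* Replacing the coefficients of one level by an independent copy preserves gauss_field;
   this takes the place of conditioning on all other levels. *)
definition resample :: "nat \<Rightarrow> (nat \<times> int \<Rightarrow> real) \<times> (nat \<times> int \<Rightarrow> real) \<Rightarrow> nat \<times> int \<Rightarrow> real" where
  "resample l = (\<lambda>(\<omega>, \<omega>') p. if fst p = l then \<omega>' p else \<omega> p)"

lemma resample_apply: "resample l z p = (if fst p = l then snd z p else fst z p)"
  by (simp add: resample_def split_beta')

interpretation std_normal: real_distribution \<N>
  by (rule real_dist_normal_dist)

interpretation gauss: product_prob_space "\<lambda>_ :: nat \<times> int. \<N>" UNIV
  by unfold_locales

lemma prob_space_gauss_field: "prob_space gauss_field"
  unfolding gauss_field_def by (rule gauss.P.prob_space_axioms)

lemma space_gauss_field [simp]: "space gauss_field = UNIV"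
  by (simp add: gauss_field_def space_PiM)

lemma measurable_gauss_component [measurable]: "(\<lambda>\<omega>. \<omega> p) \<in> borel_measurable gauss_field"
proof -
  have "(\<lambda>\<omega>. \<omega> p) \<in> gauss_field \<rightarrow>\<^sub>M \<N>"
    unfolding gauss_field_def by (rule measurable_component_singleton) simp
  then show ?thesis by simp
qed

lemma measurable_resample [measurable]: "resample l \<in> gauss_field \<Otimes>\<^sub>M gauss_field \<rightarrow>\<^sub>M gauss_field"
proof -
  have "(\<lambda>z p. resample l z p) \<in> gauss_field \<Otimes>\<^sub>M gauss_field \<rightarrow>\<^sub>M PiM UNIV (\<lambda>_. \<N>)"
  proof (rule measurable_abs_UNIV)
    fix p
    have "(\<lambda>z. if fst p = l then snd z p else fst z p) \<in> borel_measurable (gauss_field \<Otimes>\<^sub>M gauss_field)"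
      by (cases "fst p = l") (auto intro: measurable_compose[OF measurable_snd] measurable_compose[OF measurable_fst])
    then show "(\<lambda>z. resample l z p) \<in> gauss_field \<Otimes>\<^sub>M gauss_field \<rightarrow>\<^sub>M \<N>"
      by (simp add: resample_def split_beta')
  qed
  then show ?thesis by (simp add: gauss_field_def)
qed

text \<open>It suffices to compare finite-dimensional cylinders. The preimage of a cylinder is a
  product of two, one restricting the coordinates off level \<open>l\<close> of the first field, the
  other those on level \<open>l\<close> of the second.\<close>

lemma distr_resample: "distr (gauss_field \<Otimes>\<^sub>M gauss_field) gauss_field (resample l) = gauss_field"
proof -
  let ?GG = "gauss_field \<Otimes>\<^sub>M gauss_field"
  interpret G: prob_space gauss_field by (rule prob_space_gauss_field)
  interpret P: pair_prob_space gauss_field gauss_field ..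
  let ?M = "\<lambda>_ :: nat \<times> int. \<N>"
  have "distr ?GG gauss_field (resample l) = PiM UNIV ?M"
  proof (rule gauss.PiM_eq)
    show "sets (distr ?GG gauss_field (resample l)) = sets (PiM UNIV ?M)"
      by (simp add: gauss_field_def)
    fix J and A :: "nat \<times> int \<Rightarrow> real set"
    assume J: "finite J" and A: "\<And>p. p \<in> J \<Longrightarrow> A p \<in> sets \<N>"
    let ?J1 = "{p \<in> J. fst p \<noteq> l}" and ?J2 = "{p \<in> J. fst p = l}"
    let ?E = "\<lambda>J. prod_emb UNIV ?M J (PiE J A)"
    have E_sets: "?E K \<in> sets gauss_field" if "K \<subseteq> J" for K
      unfolding gauss_field_def using J A that by (intro sets_PiM_I) (auto intro: finite_subset)
    have mem: "\<omega> \<in> ?E K \<longleftrightarrow> (\<forall>p\<in>K. \<omega> p \<in> A p)" for K \<omega>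
      by (auto simp: prod_emb_def PiE_def Pi_def extensional_def)
    have "emeasure (distr ?GG gauss_field (resample l)) (?E J)
        = emeasure ?GG (resample l -` ?E J \<inter> space ?GG)"
      using E_sets by (intro emeasure_distr measurable_resample) auto
    also have "resample l -` ?E J \<inter> space ?GG = ?E ?J1 \<times> ?E ?J2"
    proof (intro set_eqI)
      fix z
      have "(\<forall>p\<in>J. resample l z p \<in> A p) \<longleftrightarrow> (\<forall>p\<in>?J1. fst z p \<in> A p) \<and> (\<forall>p\<in>?J2. snd z p \<in> A p)"
      proof (intro iffI conjI ballI)
        fix p assume "\<forall>p\<in>J. resample l z p \<in> A p" "p \<in> ?J1"
        then show "fst z p \<in> A p" by (metis (lifting) mem_Collect_eq resample_apply)
      next
        fix p assume "\<forall>p\<in>J. resample l z p \<in> A p" "p \<in> ?J2"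
        then show "snd z p \<in> A p" by (metis (lifting) mem_Collect_eq resample_apply)
      next
        fix p assume "(\<forall>p\<in>?J1. fst z p \<in> A p) \<and> (\<forall>p\<in>?J2. snd z p \<in> A p)" "p \<in> J"
        then show "resample l z p \<in> A p" by (cases p) (auto simp: resample_apply)
      qed
      then show "z \<in> resample l -` ?E J \<inter> space ?GG \<longleftrightarrow> z \<in> ?E ?J1 \<times> ?E ?J2"
        by (simp only: vimage_eq Int_iff mem mem_Times_iff space_pair_measure space_gauss_field UNIV_I simp_thms)
    qed
    also have "emeasure ?GG (?E ?J1 \<times> ?E ?J2) = emeasure gauss_field (?E ?J1) * emeasure gauss_field (?E ?J2)"
      by (intro G.emeasure_pair_measure_Times E_sets) auto
    also have "\<dots> = (\<Prod>p\<in>?J1. emeasure \<N> (A p)) * (\<Prod>p\<in>?J2. emeasure \<N> (A p))"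
      unfolding gauss_field_def using J A by (subst (1 2) gauss.emeasure_PiM_emb) auto
    also have "\<dots> = (\<Prod>p\<in>?J1 \<union> ?J2. emeasure \<N> (A p))"
      using J by (intro prod.union_disjoint[symmetric]) auto
    also have "?J1 \<union> ?J2 = J" by auto
    finally show "emeasure (distr ?GG gauss_field (resample l)) (?E J)
        = (\<Prod>p\<in>J. emeasure \<N> (A p))" .
  qed
  then show ?thesis by (simp add: gauss_field_def)
qed

lemma distr_gauss_component: "distr gauss_field borel (\<lambda>\<omega>. \<omega> p) = \<N>"
proof -
  have "distr gauss_field \<N> (\<lambda>\<omega>. \<omega> p) = \<N>"
    unfolding gauss_field_def by (rule gauss.PiM_component) simp
  moreover have "distr gauss_field borel (\<lambda>\<omega>. \<omega> p) = distr gauss_field \<N> (\<lambda>\<omega>. \<omega> p)"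
    by (rule distr_cong) auto
  ultimately show ?thesis by simp
qed

lemma indep_gauss_components:
  assumes "J \<noteq> {}"
  shows "prob_space.indep_vars gauss_field (\<lambda>_. borel) (\<lambda>i \<omega>. \<omega> (l, i)) J"
proof -
  interpret G: prob_space gauss_field by (rule prob_space_gauss_field)
  have "distr gauss_field (PiM J (\<lambda>_. \<N>)) (\<lambda>\<omega>. \<lambda>i\<in>J. \<omega> (l, i)) = PiM J (\<lambda>_. \<N>)"
    unfolding gauss_field_def
    by (rule distr_PiM_reindex) (auto simp: inj_on_def intro: std_normal.prob_space_axioms)
  moreover have "distr gauss_field (PiM J (\<lambda>_. borel)) (\<lambda>\<omega>. \<lambda>i\<in>J. \<omega> (l, i))
     = distr gauss_field (PiM J (\<lambda>_. \<N>)) (\<lambda>\<omega>. \<lambda>i\<in>J. \<omega> (l, i))"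
    by (intro distr_cong sets_PiM_cong) auto
  ultimately show ?thesis
    using assms by (subst G.indep_vars_iff_distr_eq_PiM') (auto simp: distr_gauss_component)
qed

lemma bounded_coeffs_trunc: "bounded_coeffs (\<lambda>l i. trunc l (\<omega> (l, i)))"
  by unfold_locales (rule trunc_le)

text \<open>Which coordinate of the field is read depends on the point. The index runs through the
  integers, and for a fixed index the value is a coordinate projection, so countable gluing gives
  joint measurability.\<close>

lemma measurable_random_diffeo [measurable]:
  "(\<lambda>z. random_diffeo (fst z) (snd z)) \<in> borel_measurable (gauss_field \<Otimes>\<^sub>M borel)"
proof -
  have phase [measurable]: "phase l \<in> borel_measurable borel" for l
    unfolding phase_def[abs_def] by measurable
  have [measurable]: "(\<lambda>z. fst z (l, \<lfloor>phase l (snd z)\<rfloor>)) \<in> borel_measurable (gauss_field \<Otimes>\<^sub>M borel)" for l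
  proof (rule measurable_compose_countable'[where I=UNIV and f="\<lambda>i z. fst z (l, i)" and g="\<lambda>z. \<lfloor>phase l (snd z)\<rfloor>"])
    show "(\<lambda>z. fst z (l, i)) \<in> borel_measurable (gauss_field \<Otimes>\<^sub>M borel)" for i
      by (rule measurable_compose[OF measurable_fst measurable_gauss_component])
  qed (auto, measurable)
  show ?thesis
    unfolding random_diffeo_def bumpy_def wave_def by measurable
qed

lemma measurable_random_diffeo_pair [measurable (raw)]:
  assumes "f \<in> N \<rightarrow>\<^sub>M gauss_field" "g \<in> borel_measurable N"
  shows "(\<lambda>z. random_diffeo (f z) (g z)) \<in> borel_measurable N"
  using measurable_compose[OF measurable_Pair[OF assms] measurable_random_diffeo] by simp

lemma bumpy_split_level:
  assumes "bounded_coeffs c"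
  shows "bumpy c x = bumpy (c(l := \<lambda>_. 0)) x + amp l * wave (c l) (phase l x)"
proof -
  interpret c: bounded_coeffs c by fact
  interpret c0: bounded_coeffs "c(l := \<lambda>_. 0)"
    using c.c_le by unfold_locales auto
  have "(\<lambda>n. amp n * wave ((c(l := \<lambda>_. 0)) n) (phase n x) + (if n = l then amp n * wave (c n) (phase n x) else 0))
     sums ((\<Sum>n. amp n * wave ((c(l := \<lambda>_. 0)) n) (phase n x)) + amp l * wave (c l) (phase l x))"
    by (intro sums_add summable_sums c0.summable_terms sums_single)
  moreover have "amp n * wave ((c(l := \<lambda>_. 0)) n) (phase n x) + (if n = l then amp n * wave (c n) (phase n x) else 0)
     = amp n * wave (c n) (phase n x)" for n
    by (simp add: wave_def)
  ultimately show ?thesis by (simp add: bumpy_def sums_iff)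
qed

lemma level_tail:
  assumes \<mu>: "real_distribution \<mu>" and R: "AE x in \<mu>. \<bar>x\<bar> \<le> R"
    and M: "\<And>i. measure \<mu> {x. \<lfloor>phase l x\<rfloor> = i} \<le> M"
    and G [measurable]: "G \<in> sets borel" and sin2: "\<And>x. x \<in> G \<Longrightarrow> 1 / 2 \<le> (sin (pi * phase l x))\<^sup>2"
    and e: "\<And>r. \<bar>s\<bar> * amp l / 2 \<le> \<bar>r\<bar> \<Longrightarrow> cmod (\<integral>z. iexp (r * trunc l z) \<partial>\<N>) \<le> e"
    and e0: "0 \<le> e" and u: "0 < u"
  shows "measure gauss_field {\<omega>. 2 * u + e \<le> cmod (\<integral>x. indicator G x *\<^sub>R iexp (s * random_diffeo \<omega> x) \<partial>\<mu>)}
     \<le> 4 * exp (- u\<^sup>2 / (2 * M))" (is "measure _ ?A \<le> ?b")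
proof -
  let ?GG = "gauss_field \<Otimes>\<^sub>M gauss_field"
  interpret real_distribution \<mu> by (rule \<mu>)
  interpret P: prob_space gauss_field by (rule prob_space_gauss_field)
  have A: "?A \<in> sets gauss_field"
  proof -
    have "{\<omega> \<in> space gauss_field. 2 * u + e \<le> cmod (\<integral>x. indicator G x *\<^sub>R iexp (s * random_diffeo \<omega> x) \<partial>\<mu>)} \<in> sets gauss_field"
      by measurable
    then show ?thesis by simp
  qed
  let ?B = "resample l -` ?A \<inter> space ?GG"
  have B: "?B \<in> sets ?GG"
    by (rule measurable_sets[OF measurable_resample A])
  have slice: "emeasure gauss_field (Pair \<omega> -` ?B) \<le> ennreal ?b" for \<omega>
  proof -
    define c where "c = (\<lambda>l i. trunc l (\<omega> (l, i)))(l := \<lambda>_. 0)"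
    define g where "g x = s * bumpy c x" for x
    define h where "h x = s * amp l * (sin (pi * phase l x))\<^sup>2" for x
    interpret c: bounded_coeffs c
      by unfold_locales (auto simp: c_def trunc_le)
    have phase [measurable]: "phase l \<in> borel_measurable borel"
      unfolding phase_def[abs_def] by measurable
    have [measurable]: "bumpy c \<in> borel_measurable borel"
      using c.isCont_bumpy by (intro borel_measurable_continuous_onI) (simp add: continuous_on_eq_continuous_at)
    have gh [measurable]: "g \<in> borel_measurable borel" "h \<in> borel_measurable borel"
      unfolding g_def[abs_def] h_def[abs_def] by measurable
    have split: "s * random_diffeo (resample l (\<omega>, \<omega>')) x = g x + h x * trunc l (\<omega>' (l, \<lfloor>phase l x\<rfloor>))" for \<omega>' x
    proof -
      let ?c = "\<lambda>n i. trunc n (resample l (\<omega>, \<omega>') (n, i))"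
      have "?c(l := \<lambda>_. 0) = c" by (auto simp: c_def resample_def)
      then have "random_diffeo (resample l (\<omega>, \<omega>')) x = bumpy c x + amp l * wave (?c l) (phase l x)"
        unfolding random_diffeo_def using bumpy_split_level[OF bounded_coeffs_trunc, of "resample l (\<omega>, \<omega>')" x l] by simp
      then show ?thesis by (simp add: g_def h_def wave_def resample_def algebra_simps)
    qed
    define J where "J = {\<lfloor>phase l (- \<bar>R\<bar>)\<rfloor>..\<lfloor>phase l \<bar>R\<bar>\<rfloor>}"
    have phase_mono: "phase l x \<le> phase l y" if "x \<le> y" for x y
      using that by (simp add: phase_def)
    have J: "finite J" "AE x in \<mu>. \<lfloor>phase l x\<rfloor> \<in> J"
    proof -
      show "AE x in \<mu>. \<lfloor>phase l x\<rfloor> \<in> J"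
        using R
      proof eventually_elim
        case (elim x)
        then have "- \<bar>R\<bar> \<le> x" "x \<le> \<bar>R\<bar>" by linarith+
        then show ?case unfolding J_def by (simp add: floor_mono phase_mono)
      qed
    qed (simp add: J_def)
    have Jne: "J \<noteq> {}"
    proof
      assume "J = {}"
      with J(2) have "AE x in \<mu>. False" by simp
      then show False by simp
    qed
    have "measure gauss_field {\<omega>' \<in> space gauss_field. 2 * u + e \<le>
      cmod (\<integral>x. indicator G x *\<^sub>R iexp (g x + h x * trunc l (\<omega>' (l, \<lfloor>phase l x\<rfloor>))) \<partial>\<mu>)} \<le> ?b"
    proof (rule random_phase_tail[where Z="\<lambda>i \<omega>'. \<omega>' (l, i)" and \<kappa>="\<lambda>x. \<lfloor>phase l x\<rfloor>",
          OF \<mu> gh borel_measurable_trunc _ G J M _ e0 prob_space_gauss_field indep_gauss_components[OF Jne]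
          distr_gauss_component measurable_gauss_component u])
      show "(\<lambda>x. \<lfloor>phase l x\<rfloor>) \<in> borel \<rightarrow>\<^sub>M count_space UNIV" by measurable
      fix x assume x: "x \<in> G"
      have "\<bar>s\<bar> * amp l * (1 / 2) \<le> \<bar>s\<bar> * amp l * (sin (pi * phase l x))\<^sup>2"
        using sin2[OF x] amp_pos[of l] by (intro mult_left_mono) auto
      also have "\<dots> = \<bar>h x\<bar>" using amp_pos[of l] by (simp add: h_def abs_mult)
      finally show "cmod (\<integral>z. iexp (h x * trunc l z) \<partial>\<N>) \<le> e"
        by (intro e) simp
    qed
    moreover have "Pair \<omega> -` ?B = {\<omega>' \<in> space gauss_field. 2 * u + e \<le>
      cmod (\<integral>x. indicator G x *\<^sub>R iexp (g x + h x * trunc l (\<omega>' (l, \<lfloor>phase l x\<rfloor>))) \<partial>\<mu>)}"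
      unfolding split[symmetric] by (auto simp: space_pair_measure simp del: of_real_mult)
    ultimately show ?thesis by (simp add: P.emeasure_eq_measure ennreal_leI)
  qed
  have "emeasure gauss_field ?A = emeasure (distr ?GG gauss_field (resample l)) ?A"
    by (simp add: distr_resample)
  also have "\<dots> = emeasure ?GG ?B"
    using A by (rule emeasure_distr[OF measurable_resample])
  also have "\<dots> = (\<integral>\<^sup>+\<omega>. emeasure gauss_field (Pair \<omega> -` ?B) \<partial>gauss_field)"
    by (rule P.emeasure_pair_measure_alt[OF B])
  also have "\<dots> \<le> (\<integral>\<^sup>+\<omega>. ennreal ?b \<partial>gauss_field)"
    by (intro nn_integral_mono slice)
  also have "\<dots> = ennreal ?b"
    using P.emeasure_space_1 by simp
  finally show ?thesis by (simp add: P.emeasure_eq_measure)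
qed

section \<open>Fourier decay of random images\<close>

lemma measurable_random_diffeo_section [measurable]: "random_diffeo \<omega> \<in> borel_measurable borel"
proof -
  interpret bounded_coeffs "\<lambda>l i. trunc l (\<omega> (l, i))" by (rule bounded_coeffs_trunc)
  show ?thesis
    unfolding random_diffeo_def using isCont_bumpy
    by (intro borel_measurable_continuous_onI) (simp add: continuous_on_eq_continuous_at)
qed

lemma char_distr_random_diffeo:
  assumes "real_distribution \<mu>"
  shows "char (distr \<mu> borel (random_diffeo \<omega>)) s = (\<integral>x. iexp (s * random_diffeo \<omega> x) \<partial>\<mu>)"
proof -
  interpret real_distribution \<mu> by fact
  show ?thesis unfolding char_def by (subst integral_distr) auto
qed

lemma measure_phase_fibre_le:
  assumes "real_distribution \<mu>"
    and frost: "\<And>n a b. b - a \<le> 1 / 2 ^ n \<Longrightarrow> measure \<mu> {a..b} \<le> C * 2 powr (- t * real n)"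
  shows "measure \<mu> {x. \<lfloor>phase l x\<rfloor> = i} \<le> C * 2 powr (- t * real (l div 2))"
proof -
  interpret real_distribution \<mu> by fact
  define a where "a = (of_int i - real (l mod 2) / 2) / 2 ^ (l div 2)"
  have "{x. \<lfloor>phase l x\<rfloor> = i} \<subseteq> {a..a + 1 / 2 ^ (l div 2)}"
  proof
    fix x assume "x \<in> {x. \<lfloor>phase l x\<rfloor> = i}"
    then have "of_int i \<le> phase l x" "phase l x \<le> of_int i + 1" by (simp_all, linarith+)
    then have "of_int i - real (l mod 2) / 2 \<le> x * 2 ^ (l div 2)"
      "x * 2 ^ (l div 2) \<le> (of_int i - real (l mod 2) / 2) + 1"
      by (simp_all add: phase_def mult.commute)
    then have "a \<le> x" "x \<le> ((of_int i - real (l mod 2) / 2) + 1) / 2 ^ (l div 2)"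
      unfolding a_def by (simp_all only: pos_divide_le_eq pos_le_divide_eq zero_less_power zero_less_numeral)
    then show "x \<in> {a..a + 1 / 2 ^ (l div 2)}" by (simp add: a_def add_divide_distrib)
  qed
  then have "measure \<mu> {x. \<lfloor>phase l x\<rfloor> = i} \<le> measure \<mu> {a..a + 1 / 2 ^ (l div 2)}"
    by (intro finite_measure_mono) auto
  also have "\<dots> \<le> C * 2 powr (- t * real (l div 2))" by (rule frost) simp
  finally show ?thesis .
qed

text \<open>The line is split into the set \<open>G\<close> where level \<open>2 * m\<close> has
  sin^2 at least 1/2 and its complement, where level \<open>2 * m + 1\<close> does. Each part
  contributes half of the threshold and half of the probability. The number
  \<open>2 * real m + 2\<close> is the larger of the two values of
  \<open>real l + 1\<close>.\<close>

lemma char_tail: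
  assumes \<mu>: "real_distribution \<mu>" and R: "AE x in \<mu>. \<bar>x\<bar> \<le> R"
    and frost: "\<And>n a b. b - a \<le> 1 / 2 ^ n \<Longrightarrow> measure \<mu> {a..b} \<le> C * 2 powr (- t * real n)"
    and u: "0 < u" and \<rho>: "0 \<le> \<rho>" "\<rho> \<le> \<bar>s\<bar> * (1 / (40 * 2 ^ m * (2 * real m + 2) ^ 3)) / 2"
    and e_def: "e = exp (- \<rho>\<^sup>2 / 2) + 4 * exp (- 2 * real m)"
  shows "measure gauss_field {\<omega>. 4 * u + 2 * e \<le> cmod (char (distr \<mu> borel (random_diffeo \<omega>)) s)}
     \<le> 8 * exp (- u\<^sup>2 / (2 * (C * 2 powr (- t * real m))))"
proof -
  let ?X = "\<lambda>\<omega> x. iexp (s * random_diffeo \<omega> x)"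
  let ?b = "4 * exp (- u\<^sup>2 / (2 * (C * 2 powr (- t * real m))))"
  interpret real_distribution \<mu> by (rule \<mu>)
  interpret P: prob_space gauss_field by (rule prob_space_gauss_field)
  define G where "G = {x. 1 / 2 \<le> (sin (pi * phase (2 * m) x))\<^sup>2}"
  have phase [measurable]: "phase l \<in> borel_measurable borel" for l
    unfolding phase_def[abs_def] by measurable
  have G [measurable]: "G \<in> sets borel" unfolding G_def by measurable
  have e0: "0 \<le> e" by (simp add: e_def)
  define T where "T H = {\<omega>. 2 * u + e \<le> cmod (\<integral>x. indicator H x *\<^sub>R ?X \<omega> x \<partial>\<mu>)}" for H
  have T_sets: "T H \<in> sets gauss_field" if [measurable]: "H \<in> sets borel" for H
  proof -
    have "{\<omega> \<in> space gauss_field. 2 * u + e \<le> cmod (\<integral>x. indicator H x *\<^sub>R ?X \<omega> x \<partial>\<mu>)} \<in> sets gauss_field"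
      by measurable
    then show ?thesis by (simp add: T_def)
  qed
  have level: "measure gauss_field (T H) \<le> ?b"
    if l: "l = 2 * m \<or> l = 2 * m + 1" and H: "H \<in> sets borel" "\<And>x. x \<in> H \<Longrightarrow> 1 / 2 \<le> (sin (pi * phase l x))\<^sup>2" for l H
    unfolding T_def
  proof (rule level_tail[OF \<mu> R _ H _ e0 u])
    have l_div: "l div 2 = m" using l by auto
    show "measure \<mu> {x. \<lfloor>phase l x\<rfloor> = i} \<le> C * 2 powr (- t * real m)" for i
      using measure_phase_fibre_le[OF \<mu> frost, of l i] by (simp add: l_div)
    fix r assume r: "\<bar>s\<bar> * amp l / 2 \<le> \<bar>r\<bar>"
    have "1 / (40 * 2 ^ m * (2 * real m + 2) ^ 3) \<le> amp l"
      unfolding amp_def l_div using l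
      by (intro divide_left_mono mult_left_mono power_mono) auto
    then have "\<bar>s\<bar> * (1 / (40 * 2 ^ m * (2 * real m + 2) ^ 3)) / 2 \<le> \<bar>s\<bar> * amp l / 2"
      by (intro divide_right_mono mult_left_mono) auto
    then have "\<rho> \<le> \<bar>r\<bar>" using \<rho>(2) r by linarith
    then have "\<rho>\<^sup>2 \<le> r\<^sup>2" using \<rho>(1) by (simp add: abs_le_square_iff[symmetric])
    then have "exp (- r\<^sup>2 / 2) \<le> exp (- \<rho>\<^sup>2 / 2)" by simp
    moreover have "exp (- real l) \<le> exp (- 2 * real m)" using l by auto
    ultimately show "cmod (\<integral>z. iexp (r * trunc l z) \<partial>\<N>) \<le> e"
      using norm_char_trunc[of r l] unfolding e_def by linarith
  qed
  have even: "measure gauss_field (T G) \<le> ?b"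
    by (rule level[of "2 * m"]) (auto simp: G_def intro: G[unfolded G_def])
  have odd: "measure gauss_field (T (- G)) \<le> ?b"
  proof (rule level[of "2 * m + 1"])
    show "- G \<in> sets borel" using G by auto
    fix x assume "x \<in> - G"
    then have "(sin (pi * phase (2 * m) x))\<^sup>2 \<le> 1 / 2" by (simp add: G_def)
    then have "1 / 2 \<le> (cos (pi * phase (2 * m) x))\<^sup>2"
      using sin_cos_squared_add[of "pi * phase (2 * m) x"] by linarith
    moreover have "pi * phase (2 * m + 1) x = pi * phase (2 * m) x + pi / 2"
      by (simp add: phase_def distrib_left)
    then have "sin (pi * phase (2 * m + 1) x) = cos (pi * phase (2 * m) x)"
      by (simp add: sin_add)
    ultimately show "1 / 2 \<le> (sin (pi * phase (2 * m + 1) x))\<^sup>2" by simp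
  qed simp
  have "{\<omega>. 4 * u + 2 * e \<le> cmod (char (distr \<mu> borel (random_diffeo \<omega>)) s)} \<subseteq> T G \<union> T (- G)"
  proof
    fix \<omega> assume \<omega>: "\<omega> \<in> {\<omega>. 4 * u + 2 * e \<le> cmod (char (distr \<mu> borel (random_diffeo \<omega>)) s)}"
    have int: "integrable \<mu> (\<lambda>x. indicator H x *\<^sub>R ?X \<omega> x)"
      if [measurable]: "H \<in> sets borel" for H
      by (intro integrable_const_bound[where B=1]) (auto simp: indicator_def)
    define I where "I H = (\<integral>x. indicator H x *\<^sub>R ?X \<omega> x \<partial>\<mu>)" for H
    have "char (distr \<mu> borel (random_diffeo \<omega>)) s =
        (\<integral>x. indicator G x *\<^sub>R ?X \<omega> x + indicator (- G) x *\<^sub>R ?X \<omega> x \<partial>\<mu>)"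
      unfolding char_distr_random_diffeo[OF \<mu>]
      by (intro Bochner_Integration.integral_cong) (auto simp: indicator_def)
    also have "\<dots> = I G + I (- G)"
      unfolding I_def using G by (intro Bochner_Integration.integral_add int) auto
    finally have eq: "char (distr \<mu> borel (random_diffeo \<omega>)) s = I G + I (- G)" .
    from \<omega> have "4 * u + 2 * e \<le> cmod (char (distr \<mu> borel (random_diffeo \<omega>)) s)" by simp
    then have "4 * u + 2 * e \<le> cmod (I G + I (- G))" unfolding eq .
    also have "cmod (I G + I (- G)) \<le> cmod (I G) + cmod (I (- G))" by (rule norm_triangle_ineq)
    finally have "4 * u + 2 * e \<le> cmod (I G) + cmod (I (- G))" .
    then have "2 * u + e \<le> cmod (I G) \<or> 2 * u + e \<le> cmod (I (- G))" by linarith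
    then show "\<omega> \<in> T G \<union> T (- G)" by (simp only: T_def I_def Un_iff mem_Collect_eq)
  qed
  then have "measure gauss_field {\<omega>. 4 * u + 2 * e \<le> cmod (char (distr \<mu> borel (random_diffeo \<omega>)) s)}
      \<le> measure gauss_field (T G \<union> T (- G))"
    using T_sets G by (intro P.finite_measure_mono) auto
  also have "\<dots> \<le> measure gauss_field (T G) + measure gauss_field (T (- G))"
    using T_sets G by (intro measure_Un_le) auto
  finally show ?thesis using even odd by simp
qed

text \<open>This extends an estimate from a fine grid of frequencies to all frequencies.\<close>

lemma (in real_distribution) char_lipschitz:
  assumes R: "AE x in M. \<bar>x\<bar> \<le> R"
  shows "cmod (char M s - char M s') \<le> \<bar>s - s'\<bar> * R"
proof -
  let ?d = "\<lambda>x. iexp (s * x) - iexp (s' * x)"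
  have int: "integrable M (\<lambda>x. iexp (s * x))" for s
    by (intro integrable_const_bound[where B=1]) auto
  have diff: "char M s - char M s' = (\<integral>x. ?d x \<partial>M)"
    unfolding char_def using int by (intro Bochner_Integration.integral_diff[symmetric])
  have "cmod (\<integral>x. ?d x \<partial>M) \<le> (\<integral>x. cmod (?d x) \<partial>M)"
    by (rule integral_norm_bound)
  also have "\<dots> \<le> (\<integral>x. \<bar>s - s'\<bar> * R \<partial>M)"
  proof (rule integral_mono_AE)
    show "integrable M (\<lambda>x. cmod (?d x))"
      using int by (intro integrable_norm Bochner_Integration.integrable_diff)
    show "AE x in M. cmod (?d x) \<le> \<bar>s - s'\<bar> * R"
      using R
    proof eventually_elim
      case (elim x)
      have "?d x = iexp (s' * x) * (iexp ((s - s') * x) - 1)"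
        by (simp add: algebra_simps flip: exp_add)
      then have "cmod (?d x) = cmod (iexp ((s - s') * x) - 1)"
        by (simp add: norm_mult)
      also have "\<dots> \<le> \<bar>(s - s') * x\<bar>" using iexp_approx1[of "(s - s') * x" 0] by simp
      also have "\<dots> \<le> \<bar>s - s'\<bar> * R" using elim by (simp add: abs_mult mult_left_mono)
      finally show ?case .
    qed
  qed simp
  also have "\<dots> = \<bar>s - s'\<bar> * R" using prob_space by simp
  finally show ?thesis unfolding diff .
qed

lemma (in real_distribution) norm_fourier_transform_uminus:
  "cmod (fourier_transform M (- \<xi>)) = cmod (fourier_transform M \<xi>)"
proof -
  have "char M (- s) = cnj (char M s)" for s
  proof -
    have "char M (- s) = (\<integral>x. cnj (iexp (s * x)) \<partial>M)"
      unfolding char_def by (intro Bochner_Integration.integral_cong) (simp_all add: exp_cnj)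
    also have "\<dots> = cnj (char M s)" unfolding char_def by (rule Bochner_Integration.integral_cnj)
    finally show ?thesis .
  qed
  then show ?thesis
    unfolding fourier_transform_eq_char by (metis complex_mod_cnj mult_minus_right minus_minus)
qed

text \<open>The number of grid points at scale \<open>m\<close> times the failure probability at one
  of them. The double exponential decay beats the growth 8^m for every positive \<eta>.\<close>

lemma tail_sum_asymptotics:
  fixes \<eta> C :: real
  assumes "0 < \<eta>" "0 < C"
  shows "summable (\<lambda>m. (2 ^ (3 * m + 3) + 1) * (8 * exp (- (2 powr (2 * real m * \<eta>) / (2 * C)))))"
proof -
  let ?b = "\<lambda>m. (2 ^ (3 * m + 3) + 1 :: real) * (8 * exp (- (2 powr (2 * real m * \<eta>) / (2 * C))))"
  have "(\<lambda>m. ?b m * 2 ^ m) \<longlonglongrightarrow> 0"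
    using assms by real_asymp
  then have "\<forall>\<^sub>F m in sequentially. ?b m * 2 ^ m < 1"
    by (rule order_tendstoD) simp
  then have "\<forall>\<^sub>F m in sequentially. norm (?b m) \<le> (1 / 2) ^ m"
  proof eventually_elim
    case (elim m)
    have pos: "0 \<le> ?b m"
      by (intro mult_nonneg_nonneg add_nonneg_nonneg) auto
    have "?b m \<le> 1 / 2 ^ m"
      using elim by (simp add: pos_le_divide_eq)
    then show ?case using pos by (simp add: power_one_over)
  qed
  then show ?thesis
    by (rule summable_comparison_test_ev) (simp add: summable_geometric)
qed

text \<open>The left side is the Gaussian characteristic function at the lower bound for the random
  phase at scale \<open>m\<close>. The power of \<open>m\<close> is harmless against the exponential
  inside the square.\<close>

lemma mean_asymptotics:
  fixes \<eta> :: real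
  assumes "0 < \<eta>"
  shows "\<forall>\<^sub>F m in sequentially. exp (- (2 powr (real m * \<eta>) / (320 * (real m + 1) ^ 3))\<^sup>2 / 2) \<le> 1 / 2 ^ m"
proof -
  let ?e = "\<lambda>m. exp (- (2 powr (real m * \<eta>) / (320 * (real m + 1) ^ 3))\<^sup>2 / 2)"
  have "(\<lambda>m. ?e m * 2 ^ m) \<longlonglongrightarrow> 0"
    using assms by real_asymp
  then have "\<forall>\<^sub>F m in sequentially. ?e m * 2 ^ m < 1"
    by (rule order_tendstoD) simp
  then show ?thesis
    by eventually_elim (simp add: pos_le_divide_eq)
qed

lemma random_diffeo_near_id: "\<bar>random_diffeo \<omega> x - x\<bar> \<le> 1"
  unfolding random_diffeo_def by (rule bounded_coeffs.bumpy_near_id[OF bounded_coeffs_trunc])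

text \<open>Frequencies between 2^(m (1 + \<eta>)) and 2^((m+1) (1 + \<eta>)) are handled with scale
  \<open>m\<close>. The parameter \<eta> is spent on making the random phase large and on making
  failure improbable. The condition on \<sigma> states that the weight at the upper end of the
  block, 2^((m+1) (1 + \<eta>) \<sigma> / 2), is at most 2^((m+1) (t / 2 - \<eta>)).\<close>

lemma random_diffeo_decay:
  assumes \<mu>: "real_distribution \<mu>" and R: "AE x in \<mu>. \<bar>x\<bar> \<le> R" and C: "0 < C"
    and frost: "\<And>n a b. b - a \<le> 1 / 2 ^ n \<Longrightarrow> measure \<mu> {a..b} \<le> C * 2 powr (- t * real n)"
    and t: "t \<le> 1" and \<eta>: "0 < \<eta>" "\<eta> \<le> 1" and \<sigma>: "0 \<le> \<sigma>" "\<sigma> * (1 + \<eta>) \<le> t - 2 * \<eta>"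
  shows "AE \<omega> in gauss_field. bounded (range (\<lambda>\<xi>.
     cmod (fourier_transform (distr \<mu> borel (random_diffeo \<omega>)) \<xi>) * \<bar>\<xi>\<bar> powr (\<sigma> / 2)))"
proof -
  interpret real_distribution \<mu> by (rule \<mu>)
  interpret P: prob_space gauss_field by (rule prob_space_gauss_field)
  let ?t = "\<lambda>m. exp (- (2 powr (2 * real m * \<eta>) / (2 * C)))"
  let ?w = "\<lambda>m i. 2 * pi * (real i / 2 ^ m)"
  \<comment> \<open>The typical fluctuation 2^(-mt/2), enlarged by 2^(m \<eta>) to make the failure
    probabilities summable.\<close>
  define u where "u m = 2 powr (real m * (\<eta> - t / 2))" for m
  \<comment> \<open>A lower bound for half the angular frequency times the amplitude at scale
    \<open>m\<close>. Here 320 is 40 from \<open>amp\<close> times \<open>2 ^ 3\<close> from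
    \<open>(2 * (real m + 1)) ^ 3\<close>, and a factor \<open>pi\<close> is given away.\<close>
  define \<rho> where "\<rho> m = 2 powr (real m * \<eta>) / (320 * (real m + 1) ^ 3)" for m
  define e where "e m = exp (- (\<rho> m)\<^sup>2 / 2) + 4 * exp (- 2 * real m)" for m
  \<comment> \<open>Grid points of spacing 2^(-m). As \<eta> is at most 1, the block ends below
    2^(2m+2), so after rounding up numerators reach at most 2^(3m+2) + 1.\<close>
  define I where "I m = {i::nat. i \<le> 2 ^ (3 * m + 3) \<and> 2 powr (real m * (1 + \<eta>)) \<le> real i / 2 ^ m}" for m
  define bad where "bad m i = {\<omega>. 4 * u m + 2 * e m \<le> cmod (char (distr \<mu> borel (random_diffeo \<omega>)) (?w m i))}" for m i
  define b where "b m = (2 ^ (3 * m + 3) + 1) * (8 * ?t m)" for m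
  have I_fin: "finite (I m)" for m
    by (rule finite_subset[of _ "{..2 ^ (3 * m + 3)}"]) (auto simp: I_def)
  have I_card: "real (card (I m)) \<le> 2 ^ (3 * m + 3) + 1" for m
  proof -
    have "card (I m) \<le> card {..(2::nat) ^ (3 * m + 3)}"
      by (intro card_mono) (auto simp: I_def)
    then have "real (card (I m)) \<le> real (2 ^ (3 * m + 3) + 1)" by (simp only: card_atMost of_nat_le_iff)
    then show ?thesis by simp
  qed
  have bad_sets: "bad m i \<in> sets gauss_field" for m i
  proof -
    have "{\<omega> \<in> space gauss_field. 4 * u m + 2 * e m \<le> cmod (\<integral>x. iexp (?w m i * random_diffeo \<omega> x) \<partial>\<mu>)} \<in> sets gauss_field"
      by measurable
    then show ?thesis unfolding bad_def char_distr_random_diffeo[OF \<mu>] by simp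
  qed
  let ?B = "\<lambda>m. \<Union>i\<in>I m. bad m i"
  have bad_prob: "measure gauss_field (bad m i) \<le> 8 * ?t m" if i: "i \<in> I m" for m i
  proof -
    let ?s = "?w m i"
    have "2 powr (real m * (1 + \<eta>)) = 2 ^ m * 2 powr (real m * \<eta>)"
      by (simp add: distrib_left powr_add powr_realpow)
    then have i': "2 ^ m * 2 powr (real m * \<eta>) \<le> real i / 2 ^ m" using i by (simp add: I_def)
    have "measure gauss_field (bad m i) \<le> 8 * exp (- (u m)\<^sup>2 / (2 * (C * 2 powr (- t * real m))))"
      unfolding bad_def
    proof (rule char_tail[OF \<mu> R frost, where \<rho>="\<rho> m"])
      show "0 < u m" "0 \<le> \<rho> m" by (simp_all add: u_def \<rho>_def)
      show "e m = exp (- (\<rho> m)\<^sup>2 / 2) + 4 * exp (- 2 * real m)" by (rule e_def)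
      define r where "r = real m + 1"
      have r: "0 < r" by (simp add: r_def)
      have "\<rho> m = 2 powr (real m * \<eta>) / (320 * r ^ 3)" by (simp add: \<rho>_def r_def)
      also have "\<dots> \<le> pi * 2 powr (real m * \<eta>) / (320 * r ^ 3)"
        using r pi_gt3 by (intro divide_right_mono) auto
      also have "\<dots> = 2 * pi * (2 ^ m * 2 powr (real m * \<eta>)) * (1 / (40 * 2 ^ m * (2 * r) ^ 3)) / 2"
        using r by (simp add: power_mult_distrib field_simps)
      also have "\<dots> \<le> ?w m i * (1 / (40 * 2 ^ m * (2 * r) ^ 3)) / 2"
        using i' r by (intro divide_right_mono mult_right_mono mult_left_mono) auto
      also have "\<dots> = \<bar>?s\<bar> * (1 / (40 * 2 ^ m * (2 * real m + 2) ^ 3)) / 2"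
        by (simp add: r_def distrib_left)
      finally show "\<rho> m \<le> \<bar>?s\<bar> * (1 / (40 * 2 ^ m * (2 * real m + 2) ^ 3)) / 2" .
    qed
    also have "(u m)\<^sup>2 = 2 powr (2 * real m * \<eta>) * 2 powr (- t * real m)"
    proof -
      have "(u m)\<^sup>2 = 2 powr (real m * (\<eta> - t / 2) + real m * (\<eta> - t / 2))"
        by (simp only: u_def power2_eq_square powr_add)
      also have "real m * (\<eta> - t / 2) + real m * (\<eta> - t / 2) = 2 * real m * \<eta> + - t * real m"
        by (simp add: algebra_simps)
      finally show ?thesis by (simp only: powr_add)
    qed
    also have "- (2 powr (2 * real m * \<eta>) * 2 powr (- t * real m)) / (2 * (C * 2 powr (- t * real m)))
       = - (2 powr (2 * real m * \<eta>) / (2 * C))"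
      using C by simp
    finally show ?thesis .
  qed
  have ev: "AE \<omega> in gauss_field. \<forall>\<^sub>F m in sequentially. \<omega> \<in> space gauss_field - (?B m)"
  proof (rule borel_cantelli_AE1)
    show "(?B m) \<in> sets gauss_field" for m
      using I_fin bad_sets by auto
    show "emeasure gauss_field (?B m) < \<infinity>" for m
      by (simp add: P.emeasure_eq_measure)
    have le_b: "measure gauss_field (?B m) \<le> b m" for m
    proof -
      have "measure gauss_field (?B m) \<le> (\<Sum>i\<in>I m. measure gauss_field (bad m i))"
        using I_fin bad_sets by (intro measure_UNION_le) auto
      also have "\<dots> \<le> real (card (I m)) * (8 * ?t m)"
        using bad_prob by (intro sum_bounded_above) auto
      also have "\<dots> \<le> b m" unfolding b_def using I_card by (intro mult_right_mono) auto
      finally show ?thesis .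
    qed
    have "summable b" unfolding b_def[abs_def] by (rule tail_sum_asymptotics[OF \<eta>(1) C])
    then show "summable (\<lambda>m. measure gauss_field (?B m))"
    proof (rule summable_comparison_test'[where N=0])
      show "norm (measure gauss_field (?B m)) \<le> b m" for m
        using le_b[of m] by simp
    qed
  qed
  have e_le: "\<forall>\<^sub>F m in sequentially. e m \<le> 5 / 2 ^ m"
    using mean_asymptotics[OF \<eta>(1)]
  proof eventually_elim
    case (elim m)
    have "exp (- 2 * real m) \<le> 1 / 2 ^ m"
    proof -
      have "(2::real) ^ m \<le> exp 1 ^ m" using exp_ge_add_one_self[of 1] by (intro power_mono) auto
      also have "\<dots> \<le> exp (2 * real m)" by (simp add: exp_of_nat_mult[symmetric])
      finally have "1 / exp (2 * real m) \<le> 1 / 2 ^ m" by (intro divide_left_mono) auto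
      then show ?thesis by (simp add: exp_minus inverse_eq_divide)
    qed
    then show ?case using elim by (simp add: e_def \<rho>_def)
  qed
  show ?thesis
    using ev
  proof eventually_elim
    case (elim \<omega>)
    define \<nu> where "\<nu> = distr \<mu> borel (random_diffeo \<omega>)"
    interpret \<nu>: real_distribution \<nu>
      unfolding \<nu>_def by (rule real_distribution_distr) simp
    have R': "AE x in \<nu>. \<bar>x\<bar> \<le> R + 1"
    proof -
      have "AE x in \<mu>. \<bar>random_diffeo \<omega> x\<bar> \<le> R + 1"
        using R
      proof eventually_elim
        case (elim x)
        then show ?case using random_diffeo_near_id[of \<omega> x] by linarith
      qed
      then show ?thesis unfolding \<nu>_def by (subst AE_distr_iff) auto
    qed
    have R0: "0 \<le> R + 1"
    proof -
      have "AE x in \<nu>. 0 \<le> R + 1" using R' by eventually_elim linarith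
      then show ?thesis by simp
    qed
    obtain m0 where m0: "\<And>m. m0 \<le> m \<Longrightarrow> \<omega> \<notin> (?B m) \<and> e m \<le> 5 / 2 ^ m"
      using eventually_conj[OF elim e_le] unfolding eventually_sequentially by auto
  let ?f = "\<lambda>\<xi>. cmod (fourier_transform \<nu> \<xi>)"
    \<comment> \<open>In these terms \<open>u m\<close> is
      \<open>2 powr (- real m * \<beta>)\<close>, and \<open>\<beta> \<le> 1\<close> lets
      \<open>u m\<close> absorb all errors of order 2^(-m).\<close>
    define \<beta> where "\<beta> = t / 2 - \<eta>"
    have "0 \<le> \<sigma> * (1 + \<eta>)" using \<sigma>(1) \<eta>(1) by simp
    then have \<beta>: "0 \<le> \<beta>" "\<beta> \<le> 1" "(1 + \<eta>) * (\<sigma> / 2) \<le> \<beta>"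
      using \<sigma>(2) t \<eta>(1) by (auto simp: \<beta>_def field_simps)
    \<comment> \<open>The 14 is 4 from the threshold \<open>4 * u m\<close> plus 10 from
      \<open>2 * e m\<close>. The remaining term is the Lipschitz error between a frequency and its
      grid point.\<close>
    define K1 where "K1 = 14 + 2 * pi * (R + 1)"
    have K1: "0 \<le> K1" using R0 by (simp add: K1_def)
    have large: "?f \<xi> * \<xi> powr (\<sigma> / 2) \<le> 2 * K1"
      if \<xi>: "2 powr (real m0 * (1 + \<eta>)) \<le> \<xi>" for \<xi>
    proof -
      have \<xi>pos: "0 < \<xi>" using \<xi> by (rule less_le_trans[rotated]) simp
      define q where "q = log 2 \<xi> / (1 + \<eta>)"
      have q: "2 powr (q * (1 + \<eta>)) = \<xi>" using \<xi>pos \<eta>(1) by (simp add: q_def)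
      have "real m0 * (1 + \<eta>) \<le> log 2 \<xi>" using \<xi> \<xi>pos by (simp add: le_log_iff)
      then have m0q: "real m0 \<le> q" using \<eta>(1) by (simp add: q_def pos_le_divide_eq)
      define m where "m = nat \<lfloor>q\<rfloor>"
      have "0 \<le> q" using m0q by (rule order_trans[rotated]) simp
      then have m: "real m \<le> q" "q \<le> real m + 1" by (simp_all add: m_def)
      have "m0 \<le> m" using m0q by (simp add: m_def le_nat_floor)
      have lo: "2 powr (real m * (1 + \<eta>)) \<le> \<xi>"
        unfolding q[symmetric] using m \<eta>(1) by (intro powr_mono mult_right_mono) auto
      have hi: "\<xi> \<le> 2 powr ((real m + 1) * (1 + \<eta>))"
        unfolding q[symmetric] using m \<eta>(1) by (intro powr_mono mult_right_mono) auto
      \<comment> \<open>Rounding up keeps the grid point above the lower end of the block, as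
        membership in \<open>I m\<close> requires.\<close>
      define i where "i = nat \<lceil>\<xi> * 2 ^ m\<rceil>"
      have i: "\<xi> * 2 ^ m \<le> real i" "real i \<le> \<xi> * 2 ^ m + 1"
        using \<xi>pos by (simp_all add: i_def of_nat_ceiling)
      have i1: "\<xi> \<le> real i / 2 ^ m" "real i / 2 ^ m - \<xi> \<le> 1 / 2 ^ m"
      proof -
        show "\<xi> \<le> real i / 2 ^ m" using i(1) by (simp add: pos_le_divide_eq)
        have "real i / 2 ^ m \<le> (\<xi> * 2 ^ m + 1) / 2 ^ m" using i(2) by (rule divide_right_mono) simp
        then show "real i / 2 ^ m - \<xi> \<le> 1 / 2 ^ m" by (simp add: add_divide_distrib)
      qed
      have "i \<in> I m"
      proof -
        have "2 powr ((real m + 1) * (1 + \<eta>)) \<le> 2 powr ((real m + 1) * 2)"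
          using \<eta>(2) by (intro powr_mono mult_left_mono) auto
        with hi have "\<xi> \<le> 2 powr ((real m + 1) * 2)" by (rule order_trans)
        also have "\<dots> = 2 ^ (2 * m + 2)"
          by (simp add: distrib_right powr_add mult.commute flip: powr_realpow)
        finally have "\<xi> * 2 ^ m \<le> 2 ^ (2 * m + 2) * 2 ^ m" by (intro mult_right_mono) auto
        also have "\<dots> = 2 ^ (3 * m + 2)" by (simp flip: power_add)
        finally have "real i \<le> 2 ^ (3 * m + 2) + 1" using i(2) by linarith
        also have "\<dots> \<le> 2 ^ (3 * m + 2) + 2 ^ (3 * m + 2)"
          by (intro add_left_mono) (rule one_le_power, simp)
        also have "\<dots> = real (2 ^ (3 * m + 3))" by (simp add: power_add)
        finally have "i \<le> 2 ^ (3 * m + 3)" by (simp only: of_nat_le_iff)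
        then show ?thesis using lo i1(1) by (simp add: I_def)
      qed
      then have "\<omega> \<notin> bad m i" using m0[OF \<open>m0 \<le> m\<close>] by blast
      then have near: "cmod (char \<nu> (?w m i)) < 4 * u m + 2 * e m"
        by (simp only: bad_def \<nu>_def mem_Collect_eq not_le)
      have "?f \<xi> = cmod (char \<nu> (2 * pi * \<xi>))"
        using \<nu>.norm_fourier_transform_uminus[of \<xi>] by (simp add: fourier_transform_eq_char)
      also have "\<dots> \<le> cmod (char \<nu> (?w m i)) + cmod (char \<nu> (2 * pi * \<xi>) - char \<nu> (?w m i))"
        by (rule norm_triangle_sub)
      also have "\<dots> \<le> (4 * u m + 2 * e m) + 2 * pi * (1 / 2 ^ m) * (R + 1)"
      proof (rule add_mono)
        have "cmod (char \<nu> (2 * pi * \<xi>) - char \<nu> (?w m i))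
            \<le> \<bar>2 * pi * \<xi> - ?w m i\<bar> * (R + 1)"
          by (rule \<nu>.char_lipschitz[OF R'])
        also have "\<bar>2 * pi * \<xi> - ?w m i\<bar> = 2 * pi * (real i / 2 ^ m - \<xi>)"
        proof -
          have "2 * pi * \<xi> \<le> ?w m i" using i1(1) by (intro mult_left_mono) auto
          then show ?thesis by (simp add: right_diff_distrib)
        qed
        also have "\<dots> * (R + 1) \<le> 2 * pi * (1 / 2 ^ m) * (R + 1)"
          using i1(2) R0 by (intro mult_right_mono mult_left_mono) auto
        finally show "cmod (char \<nu> (2 * pi * \<xi>) - char \<nu> (?w m i)) \<le> 2 * pi * (1 / 2 ^ m) * (R + 1)" .
      qed (use near in simp)
      also have "\<dots> \<le> 4 * u m + 2 * (5 / 2 ^ m) + 2 * pi * (1 / 2 ^ m) * (R + 1)"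
        using m0[OF \<open>m0 \<le> m\<close>] by simp
      also have "\<dots> = 4 * u m + (10 + 2 * pi * (R + 1)) * (1 / 2 ^ m)"
        by (simp add: algebra_simps add_divide_distrib)
      also have "\<dots> \<le> 4 * u m + (10 + 2 * pi * (R + 1)) * u m"
      proof -
        have "1 / 2 ^ m = 2 powr (- real m)" by (simp add: powr_minus_divide powr_realpow)
        also have "\<dots> \<le> u m"
          unfolding u_def
        proof (rule powr_mono)
          have "real m * \<beta> \<le> real m * 1" using \<beta>(2) by (intro mult_left_mono) auto
          then show "- real m \<le> real m * (\<eta> - t / 2)" by (simp add: \<beta>_def algebra_simps)
        qed simp
        finally show ?thesis using R0 by (intro add_left_mono mult_left_mono) auto
      qed
      also have "\<dots> = K1 * u m" by (simp add: K1_def algebra_simps)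
      finally have ft: "?f \<xi> \<le> K1 * u m" .
      have "\<xi> powr (\<sigma> / 2) \<le> (2 powr ((real m + 1) * (1 + \<eta>))) powr (\<sigma> / 2)"
        using hi \<xi>pos \<sigma>(1) by (intro powr_mono2) auto
      also have "\<dots> = 2 powr ((real m + 1) * ((1 + \<eta>) * (\<sigma> / 2)))" by (simp add: powr_powr mult.assoc)
      also have "\<dots> \<le> 2 powr ((real m + 1) * \<beta>)"
        using \<beta>(3) by (intro powr_mono mult_left_mono) auto
      finally have "?f \<xi> * \<xi> powr (\<sigma> / 2) \<le> (K1 * u m) * 2 powr ((real m + 1) * \<beta>)"
        using ft K1 by (intro mult_mono) (auto simp: u_def)
      also have "\<dots> = K1 * 2 powr \<beta>"
      proof -
        have "u m * 2 powr ((real m + 1) * \<beta>) = 2 powr (real m * (\<eta> - t / 2) + (real m + 1) * \<beta>)"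
          by (simp add: u_def powr_add)
        also have "real m * (\<eta> - t / 2) + (real m + 1) * \<beta> = \<beta>" by (simp add: \<beta>_def algebra_simps)
        finally show ?thesis by (simp add: mult.assoc)
      qed
      also have "\<dots> \<le> K1 * 2 powr 1" using K1 \<beta>(2) by (intro mult_left_mono powr_mono) auto
      finally show ?thesis by simp
    qed
    define X0 where "X0 = 2 powr (real m0 * (1 + \<eta>))"
    have bound: "?f \<xi> * \<bar>\<xi>\<bar> powr (\<sigma> / 2) \<le> max (2 * K1) (X0 powr (\<sigma> / 2))" for \<xi>
    proof (cases "X0 \<le> \<bar>\<xi>\<bar>")
      case True
      have "?f \<xi> = cmod (fourier_transform \<nu> \<bar>\<xi>\<bar>)"
        using \<nu>.norm_fourier_transform_uminus by (cases "0 \<le> \<xi>") auto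
      then show ?thesis using large[of "\<bar>\<xi>\<bar>"] True by (simp add: X0_def)
    next
      case False
      have "?f \<xi> * \<bar>\<xi>\<bar> powr (\<sigma> / 2) \<le> 1 * X0 powr (\<sigma> / 2)"
        using False \<sigma>(1) \<nu>.norm_fourier_transform_le_1 by (intro mult_mono powr_mono2) auto
      then show ?thesis by simp
    qed
    show ?case
      unfolding \<nu>_def[symmetric] bounded_iff using bound by (auto simp: abs_mult)
  qed
qed

section \<open>Hausdorff and Fourier dimension\<close>

lemma hausdorff_content_le_measure: "0 < \<delta> \<Longrightarrow> hausdorff_content s \<delta> A \<le> hausdorff_measure s A"
  unfolding hausdorff_measure_def by (rule SUP_upper) simp

lemma hausdorff_content_le:
  assumes "A \<subseteq> (\<Union>i. U i)" "\<And>i. bounded (U i) \<and> diameter (U i) \<le> \<delta>"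
  shows "hausdorff_content s \<delta> A \<le> (\<Sum>i. diam_pow s (U i))"
  unfolding hausdorff_content_def using assms by (intro Inf_lower) blast

lemma diam_pow_lipschitz_image:
  fixes f :: "real \<Rightarrow> real"
  assumes f: "\<And>x y. \<bar>f x - f y\<bar> \<le> L * \<bar>x - y\<bar>" and L: "0 < L" and s: "0 \<le> s" and U: "bounded U"
  shows "bounded (f ` U)" "diameter (f ` U) \<le> L * diameter U" "diam_pow s (f ` U) \<le> ennreal (L powr s) * diam_pow s U"
proof -
  have d0: "0 \<le> diameter U" using U by (rule diameter_ge_0)
  have le: "\<bar>f x - f y\<bar> \<le> L * diameter U" if "x \<in> U" "y \<in> U" for x y
  proof -
    have "\<bar>x - y\<bar> \<le> diameter U" using diameter_bounded_bound[OF U that] by (simp add: dist_real_def)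
    then show ?thesis using f[of x y] L by (meson less_imp_le mult_left_mono order_trans)
  qed
  show "bounded (f ` U)"
    unfolding bounded_two_points using le by (auto simp: dist_real_def)
  show diam: "diameter (f ` U) \<le> L * diameter U"
    by (rule diameter_le) (use le d0 L in auto)
  show "diam_pow s (f ` U) \<le> ennreal (L powr s) * diam_pow s U"
  proof (cases "U = {} \<or> s = 0")
    case True
    then show ?thesis using L by (auto simp: diam_pow_def)
  next
    case False
    have "diameter (f ` U) powr s \<le> (L * diameter U) powr s"
      using diam s \<open>bounded (f ` U)\<close> by (intro powr_mono2 diameter_ge_0)
    also have "\<dots> = L powr s * diameter U powr s" using L d0 by (simp add: powr_mult)
    finally have "ennreal (diameter (f ` U) powr s) \<le> ennreal (L powr s) * ennreal (diameter U powr s)"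
      by (simp add: ennreal_leI flip: ennreal_mult)
    then show ?thesis using False by (simp add: diam_pow_def)
  qed
qed

lemma hausdorff_measure_lipschitz_image:
  fixes f :: "real \<Rightarrow> real"
  assumes f: "\<And>x y. \<bar>f x - f y\<bar> \<le> L * \<bar>x - y\<bar>" and L: "0 < L" and s: "0 \<le> s"
    and A: "hausdorff_measure s A = 0"
  shows "hausdorff_measure s (f ` A) = 0"
proof -
  have "hausdorff_content s \<delta> (f ` A) \<le> 0" if \<delta>: "0 < \<delta>" for \<delta>
  proof (rule ennreal_le_epsilon)
    fix e :: real assume e: "0 < e"
    have "hausdorff_content s (\<delta> / L) A = 0"
      using hausdorff_content_le_measure[of "\<delta> / L" s A] \<delta> L A by simp
    then have "hausdorff_content s (\<delta> / L) A < ennreal (e / L powr s)" using e L by simp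
    then obtain U where U: "A \<subseteq> (\<Union>i. U i)" "\<forall>i. bounded (U i) \<and> diameter (U i) \<le> \<delta> / L"
      "(\<Sum>i. diam_pow s (U i)) < ennreal (e / L powr s)"
      unfolding hausdorff_content_def Inf_less_iff by blast
    have "bounded (f ` U i) \<and> diameter (f ` U i) \<le> \<delta>" for i
    proof -
      have "L * diameter (U i) \<le> L * (\<delta> / L)" using U(2) L by (intro mult_left_mono) auto
      then show ?thesis
        using diam_pow_lipschitz_image(1,2)[OF f L s, of "U i"] U(2) L by auto
    qed
    moreover have "f ` A \<subseteq> (\<Union>i. f ` U i)" using U(1) by blast
    ultimately have "hausdorff_content s \<delta> (f ` A) \<le> (\<Sum>i. diam_pow s (f ` U i))"
      by (intro hausdorff_content_le[where U="\<lambda>i. f ` U i"])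
    also have "\<dots> \<le> (\<Sum>i. ennreal (L powr s) * diam_pow s (U i))"
      using diam_pow_lipschitz_image(3)[OF f L s] U(2) by (intro suminf_le) auto
    also have "\<dots> = ennreal (L powr s) * (\<Sum>i. diam_pow s (U i))" by simp
    also have "\<dots> \<le> ennreal (L powr s) * ennreal (e / L powr s)"
      using U(3) by (intro mult_left_mono) auto
    also have "\<dots> = ennreal e" using e L by (simp flip: ennreal_mult)
    finally show "hausdorff_content s \<delta> (f ` A) \<le> 0 + ennreal e" by simp
  qed
  then show ?thesis unfolding hausdorff_measure_def by simp
qed

text \<open>By the convention diam(U)^0 = 1 a cover of a nonempty set has total at least 1. This
  rules out the exponent 0, to which \<open>hausdorff_measure_nonzero_if_fourier_decay\<close> does
  not apply.\<close>

lemma hausdorff_measure_0_nonzero: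
  assumes "A \<noteq> {}"
  shows "hausdorff_measure 0 A \<noteq> 0"
proof -
  have "1 \<le> hausdorff_content 0 1 A"
    unfolding hausdorff_content_def
  proof (rule Inf_greatest, safe)
    fix U :: "nat \<Rightarrow> 'a set" assume U: "A \<subseteq> (\<Union>i. U i)"
    then obtain i where i: "U i \<noteq> {}" using assms by blast
    have "diam_pow 0 (U i) \<le> (\<Sum>i. diam_pow 0 (U i))"
      using sum_le_suminf[of "\<lambda>i. diam_pow 0 (U i)" "{i}"] by simp
    then show "1 \<le> (\<Sum>i. diam_pow 0 (U i))" using i by (simp add: diam_pow_def)
  qed
  also have "\<dots> \<le> hausdorff_measure 0 A" by (rule hausdorff_content_le_measure) simp
  finally show ?thesis by auto
qed

lemma hausdorff_measure_empty: "hausdorff_measure s ({} :: 'a::metric_space set) = 0"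
proof -
  have "hausdorff_content s \<delta> ({} :: 'a set) \<le> 0" if "0 < \<delta>" for \<delta>
  proof -
    have "hausdorff_content s \<delta> ({} :: 'a set) \<le> (\<Sum>i::nat. diam_pow s ({} :: 'a set))"
      using that by (intro hausdorff_content_le) (auto simp: diameter_def)
    then show ?thesis by (simp add: diam_pow_def)
  qed
  then show ?thesis unfolding hausdorff_measure_def by simp
qed

text \<open>A Frostman measure of exponent \<open>t > 1\<close> cannot exist: a bounded interval of
  full mass is covered by a multiple of 2^n intervals of length 2^(-n), each of mass at most a
  multiple of 2^(-tn).\<close>

lemma hausdorff_measure_above_1:
  fixes F :: "real set"
  assumes F: "F \<in> sets borel" and t: "1 < t"
  shows "hausdorff_measure t F = 0"
proof (rule ccontr)
  assume nz: "hausdorff_measure t F \<noteq> 0"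
  have "0 < t" using t by simp
  from frostman[OF F this nz]
  obtain \<mu> C R where \<mu>: "real_distribution \<mu>" "measure \<mu> F = 1" "0 < C" "measure \<mu> {-R..R} = 1"
    "\<And>n a b. b - a \<le> 1 / 2 ^ n \<Longrightarrow> measure \<mu> {a..b} \<le> C * 2 powr (- t * real n)"
    by blast
  interpret real_distribution \<mu> by (rule \<mu>(1))
  obtain N :: nat where "\<bar>R\<bar> + 1 \<le> real N" using real_arch_simple by blast
  then have N: "\<bar>R\<bar> \<le> real N" "1 \<le> real N" by linarith+
  have bound: "1 \<le> (3 * real N * C) * (2 powr (1 - t)) ^ n" for n
  proof -
    let ?c = "\<lambda>k. {- real N + real k / 2 ^ n .. - real N + real k / 2 ^ n + 1 / 2 ^ n}"
    \<comment> \<open>The extra index beyond \<open>2 * N * 2 ^ n\<close> catches the right end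
      point, where the floor attains that value.\<close>
    have "{-R..R} \<subseteq> (\<Union>k<2 * N * 2 ^ n + 1. ?c k)"
    proof
      fix x assume "x \<in> {-R..R}"
      then have x: "- real N \<le> x" "x \<le> real N" using N by auto
      define k where "k = nat \<lfloor>(x + real N) * 2 ^ n\<rfloor>"
      have "0 \<le> (x + real N) * 2 ^ n" using x by simp
      then have k: "real k \<le> (x + real N) * 2 ^ n" "(x + real N) * 2 ^ n \<le> real k + 1"
        by (simp_all add: k_def)
      have "(x + real N) * 2 ^ n \<le> (2 * real N) * 2 ^ n" using x by (intro mult_right_mono) auto
      with k(1) have "real k \<le> (2 * real N) * 2 ^ n" by (rule order_trans)
      then have "real k \<le> real (2 * N * 2 ^ n)" by simp
      then have "k < 2 * N * 2 ^ n + 1" by (simp only: of_nat_le_iff)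
      moreover have "x \<in> ?c k"
      proof -
        have "real k / 2 ^ n \<le> x + real N" "x + real N \<le> (real k + 1) / 2 ^ n"
          using k by (simp_all add: pos_divide_le_eq pos_le_divide_eq)
        then show ?thesis by (simp add: add_divide_distrib)
      qed
      ultimately show "x \<in> (\<Union>k<2 * N * 2 ^ n + 1. ?c k)" by blast
    qed
    then have "1 \<le> measure \<mu> (\<Union>k<2 * N * 2 ^ n + 1. ?c k)"
      unfolding \<mu>(4)[symmetric] by (intro finite_measure_mono) auto
    also have "\<dots> \<le> (\<Sum>k<2 * N * 2 ^ n + 1. measure \<mu> (?c k))"
      by (intro measure_UNION_le) auto
    also have "\<dots> \<le> real (2 * N * 2 ^ n + 1) * (C * 2 powr (- t * real n))"
      using sum_bounded_above[of "{..<2 * N * 2 ^ n + 1}" "\<lambda>k. measure \<mu> (?c k)" "C * 2 powr (- t * real n)"] \<mu>(5)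
      by simp
    finally have "1 \<le> real (2 * N * 2 ^ n + 1) * (C * 2 powr (- t * real n))" .
    also have "\<dots> \<le> (3 * real N * 2 ^ n) * (C * 2 powr (- t * real n))"
    proof (rule mult_right_mono)
      have "1 * 1 \<le> real N * 2 ^ n" using N(2) by (intro mult_mono) auto
      then show "real (2 * N * 2 ^ n + 1) \<le> 3 * real N * 2 ^ n" by simp
    qed (use \<mu>(3) in simp)
    also have "\<dots> = (3 * real N * C) * (2 powr real n * 2 powr (- t * real n))"
      by (simp add: powr_realpow)
    also have "2 powr real n * 2 powr (- t * real n) = (2 powr (1 - t)) ^ n"
      by (simp add: powr_powr left_diff_distrib flip: powr_realpow powr_add)
    finally show ?thesis .
  qed
  have "(\<lambda>n. (3 * real N * C) * (2 powr (1 - t)) ^ n) \<longlonglongrightarrow> (3 * real N * C) * 0"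
    using t by (intro tendsto_mult tendsto_const LIMSEQ_power_zero) (simp add: powr_less_one)
  then have "1 \<le> (3 * real N * C) * 0"
    by (rule LIMSEQ_le_const) (use bound in auto)
  then show False by simp
qed

abbreviation null_exponents :: "real set \<Rightarrow> real set" where
  "null_exponents F \<equiv> {s. 0 \<le> s \<and> hausdorff_measure s F = 0}"

lemma hausdorff_dim_set:
  fixes F :: "real set"
  assumes F: "F \<in> sets borel"
  shows "2 \<in> (null_exponents F)" "bdd_below (null_exponents F)"
  using hausdorff_measure_above_1[OF F, of 2] by (auto intro: bdd_belowI[of _ 0])

lemma hausdorff_dim_nonneg: "F \<in> sets borel \<Longrightarrow> 0 \<le> hausdorff_dim F"
  unfolding hausdorff_dim_def by (rule cInf_greatest) (use hausdorff_dim_set(1)[of F] in blast)+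

lemma hausdorff_dim_le: "F \<in> sets borel \<Longrightarrow> 0 \<le> s \<Longrightarrow> hausdorff_measure s F = 0 \<Longrightarrow> hausdorff_dim F \<le> s"
  unfolding hausdorff_dim_def using hausdorff_dim_set(2)[of F] by (intro cInf_lower) auto

lemma hausdorff_dim_le_1:
  assumes "F \<in> sets borel"
  shows "hausdorff_dim F \<le> 1"
proof (rule dense_ge)
  fix t :: real assume "1 < t"
  then show "hausdorff_dim F \<le> t"
    using hausdorff_dim_le[OF assms, of t] hausdorff_measure_above_1[OF assms, of t] by simp
qed

lemma hausdorff_dim_empty: "hausdorff_dim {} = 0"
proof (rule antisym)
  show "hausdorff_dim {} \<le> 0" by (rule hausdorff_dim_le) (auto simp: hausdorff_measure_empty)
qed (simp add: hausdorff_dim_nonneg)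

lemma hausdorff_dim_lipschitz_image_le:
  fixes f :: "real \<Rightarrow> real"
  assumes F: "F \<in> sets borel" and f: "\<And>x y. \<bar>f x - f y\<bar> \<le> L * \<bar>x - y\<bar>" "0 < L"
    and fF: "f ` F \<in> sets borel"
  shows "hausdorff_dim (f ` F) \<le> hausdorff_dim F"
  unfolding hausdorff_dim_def
proof (rule cInf_superset_mono)
  show "(null_exponents F) \<noteq> {}" using hausdorff_dim_set(1)[OF F] by blast
  show "bdd_below (null_exponents (f ` F))" by (rule hausdorff_dim_set(2)[OF fF])
  show "(null_exponents F) \<subseteq> (null_exponents (f ` F))"
    using hausdorff_measure_lipschitz_image[OF f] by blast
qed

section \<open>Fourier dimension and its comparison with Hausdorff dimension\<close>

definition fourier_exponents :: "real measure \<Rightarrow> real set" where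
  "fourier_exponents \<mu> =
     {s \<in> {0..1}. bounded (range (\<lambda>\<xi>. cmod (fourier_transform \<mu> \<xi>) * \<bar>\<xi>\<bar> powr (s / 2)))}"

lemma fourier_dim_measure_eq: "fourier_dim_measure \<mu> = Sup (fourier_exponents \<mu>)"
  by (simp add: fourier_dim_measure_def fourier_exponents_def)

lemma zero_in_fourier_exponents:
  assumes "real_distribution \<mu>"
  shows "0 \<in> fourier_exponents \<mu>"
proof -
  interpret real_distribution \<mu> by fact
  have "norm (cmod (fourier_transform \<mu> \<xi>) * \<bar>\<xi>\<bar> powr (0 / 2)) \<le> 1" for \<xi>
    using norm_fourier_transform_le_1[of \<xi>] by (cases "\<xi> = 0") (simp_all add: norm_mult)
  then have "bounded (range (\<lambda>\<xi>. cmod (fourier_transform \<mu> \<xi>) * \<bar>\<xi>\<bar> powr (0 / 2)))"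
    unfolding bounded_iff by blast
  then show ?thesis by (simp only: fourier_exponents_def mem_Collect_eq) simp
qed

lemma bdd_above_fourier_exponents: "bdd_above (fourier_exponents \<mu>)"
  by (rule bdd_aboveI[of _ 1]) (auto simp: fourier_exponents_def)

lemma fourier_dim_measure_le_1: "real_distribution \<mu> \<Longrightarrow> fourier_dim_measure \<mu> \<le> 1"
  unfolding fourier_dim_measure_eq
  by (rule cSup_least) (use zero_in_fourier_exponents in blast, simp add: fourier_exponents_def)

lemma le_fourier_dim_measure: "s \<in> fourier_exponents \<mu> \<Longrightarrow> s \<le> fourier_dim_measure \<mu>"
  unfolding fourier_dim_measure_eq by (intro cSup_upper bdd_above_fourier_exponents)

lemma fourier_dim_measure_le_fourier_dim:
  assumes "real_distribution \<mu>" "measure \<mu> F = 1"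
  shows "fourier_dim_measure \<mu> \<le> fourier_dim F"
proof -
  have "F \<noteq> {}" using assms(2) by auto
  moreover have "fourier_dim_measure \<mu> \<le> Sup {fourier_dim_measure \<mu> | \<mu>. real_distribution \<mu> \<and> measure \<mu> F = 1}"
    using assms by (intro cSup_upper bdd_aboveI[of _ 1]) (auto intro: fourier_dim_measure_le_1)
  ultimately show ?thesis by (simp add: fourier_dim_def)
qed

lemma ex_distribution_on:
  assumes "F \<in> sets borel" "F \<noteq> {}"
  shows "\<exists>\<mu>. real_distribution \<mu> \<and> measure \<mu> F = 1"
proof -
  obtain x where x: "x \<in> F" using assms(2) by blast
  have "real_distribution (return borel x)"
    by (simp add: real_distribution_def real_distribution_axioms_def prob_space_return)
  moreover have "measure (return borel x) F = 1" using assms(1) x by (simp add: measure_return)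
  ultimately show ?thesis by blast
qed

lemma fourier_dim_nonneg:
  assumes "F \<in> sets borel"
  shows "0 \<le> fourier_dim F"
proof (cases "F = {}")
  case False
  then obtain \<mu> where \<mu>: "real_distribution \<mu>" "measure \<mu> F = 1"
    using ex_distribution_on[OF assms] by blast
  have "0 \<le> fourier_dim_measure \<mu>" by (intro le_fourier_dim_measure zero_in_fourier_exponents \<mu>)
  also have "\<dots> \<le> fourier_dim F" by (intro fourier_dim_measure_le_fourier_dim \<mu>)
  finally show ?thesis .
qed (simp add: fourier_dim_def)

text \<open>An admissible decay exponent \<open>s\<close> above the infimum defining the Hausdorff
  dimension would lie above some \<open>r\<close> with null \<open>r\<close>-dimensional measure,
  which decay of order \<open>s\<close> forbids.\<close>

lemma fourier_dim_le_hausdorff_dim: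
  assumes F: "F \<in> sets borel"
  shows "fourier_dim F \<le> hausdorff_dim F"
proof (cases "F = {}")
  case True
  then show ?thesis by (simp add: fourier_dim_def hausdorff_dim_empty)
next
  case False
  have "s \<le> hausdorff_dim F" if \<mu>: "real_distribution \<mu>" "measure \<mu> F = 1" and s: "s \<in> fourier_exponents \<mu>" for \<mu> s
  proof (rule ccontr)
    assume "\<not> s \<le> hausdorff_dim F"
    then have "Inf (null_exponents F) < s" by (simp add: hausdorff_dim_def)
    moreover have "(null_exponents F) \<noteq> {}"
      using hausdorff_dim_set(1)[OF F] by blast
    ultimately obtain r where r: "0 \<le> r" "hausdorff_measure r F = 0" "r < s"
      using cInf_lessD[of "(null_exponents F)" s] by blast
    have "r \<noteq> 0" using r(2) hausdorff_measure_0_nonzero[OF False] by auto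
    then have "hausdorff_measure r F \<noteq> 0"
      using r s by (intro hausdorff_measure_nonzero_if_fourier_decay[OF \<mu>, of s])
        (auto simp: fourier_exponents_def)
    with r(2) show False by simp
  qed
  then have "fourier_dim_measure \<mu> \<le> hausdorff_dim F" if "real_distribution \<mu>" "measure \<mu> F = 1" for \<mu>
    unfolding fourier_dim_measure_eq using that zero_in_fourier_exponents by (intro cSup_least) blast+
  then have "Sup {fourier_dim_measure \<mu> | \<mu>. real_distribution \<mu> \<and> measure \<mu> F = 1} \<le> hausdorff_dim F"
    using ex_distribution_on[OF F False] by (intro cSup_least) auto
  then show ?thesis using False by (simp add: fourier_dim_def)
qed

theorem mainTheorem6:
  fixes F :: "real set"
  assumes "F \<in> sets borel"
  shows "\<exists>f. C1_diffeomorphism f \<and> salem_set (f ` F)"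
proof -
  define d where "d = hausdorff_dim F"
  have d: "0 \<le> d" "d \<le> 1"
    using hausdorff_dim_nonneg hausdorff_dim_le_1 assms by (auto simp: d_def)
  \<comment> \<open>The 4 gives \<open>\<eta> n \<le> d / 4\<close>, so that
    \<open>d - 3 * \<eta> n\<close>, and with it \<open>\<sigma> n\<close>, is nonnegative.\<close>
  define \<eta> where "\<eta> n = d / (real n + 4)" for n
  \<comment> \<open>The largest exponent that \<open>random_diffeo_decay\<close> permits for a
    Frostman measure of exponent \<open>d - \<eta> n\<close>. It tends to \<open>d\<close>.\<close>
  define \<sigma> where "\<sigma> n = (d - 3 * \<eta> n) / (1 + \<eta> n)" for n
  \<comment> \<open>For \<open>d = 0\<close> any \<omega> serves, since the Fourier dimension is
    nonnegative. Otherwise one \<omega> has to serve all \<open>n\<close>, which countability of the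
    family allows.\<close>
  have "\<exists>\<omega>. d = 0 \<or> (\<forall>n. \<exists>\<mu>. real_distribution \<mu> \<and> measure \<mu> F = 1 \<and>
      \<sigma> n \<in> fourier_exponents (distr \<mu> borel (random_diffeo \<omega>)))"
  proof (cases "d = 0")
    case False
    then have dpos: "0 < d" using d by simp
    have \<eta>: "0 < \<eta> n" "\<eta> n \<le> d / 4" for n
      unfolding \<eta>_def using dpos by (simp, intro frac_le) auto
    have \<sigma>: "0 \<le> \<sigma> n" "\<sigma> n \<le> 1" "\<sigma> n * (1 + \<eta> n) \<le> (d - \<eta> n) - 2 * \<eta> n" for n
      using \<eta>[of n] d by (simp_all add: \<sigma>_def)
    have "\<exists>\<mu> C R. real_distribution \<mu> \<and> measure \<mu> F = 1 \<and> 0 < C \<and> measure \<mu> {-R..R} = 1 \<and>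
       (\<forall>k a b. b - a \<le> 1 / 2 ^ k \<longrightarrow> measure \<mu> {a..b} \<le> C * 2 powr (- (d - \<eta> n) * real k))" for n
    proof -
      have t: "0 < d - \<eta> n" "d - \<eta> n < d" using \<eta>[of n] dpos by linarith+
      then have "hausdorff_measure (d - \<eta> n) F \<noteq> 0"
        using hausdorff_dim_le[OF assms, of "d - \<eta> n"] by (auto simp: d_def)
      with assms t(1) show ?thesis by (rule frostman)
    qed
    then obtain \<mu> C R where \<mu>: "\<And>n. real_distribution (\<mu> n)" "\<And>n. measure (\<mu> n) F = 1" "\<And>n. 0 < C n"
      "\<And>n. measure (\<mu> n) {-R n..R n} = 1"
      "\<And>n k a b. b - a \<le> 1 / 2 ^ k \<Longrightarrow> measure (\<mu> n) {a..b} \<le> C n * 2 powr (- (d - \<eta> n) * real k)"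
      by metis
    interpret G: prob_space gauss_field by (rule prob_space_gauss_field)
    have "AE \<omega> in gauss_field. \<sigma> n \<in> fourier_exponents (distr (\<mu> n) borel (random_diffeo \<omega>))" for n
    proof -
      interpret real_distribution "\<mu> n" by (rule \<mu>(1))
      have "AE x in \<mu> n. x \<in> {-R n..R n}" using prob_eq_1[of "{-R n..R n}"] \<mu>(4)[of n] by simp
      then have R: "AE x in \<mu> n. \<bar>x\<bar> \<le> R n" by eventually_elim auto
      have "AE \<omega> in gauss_field. bounded (range (\<lambda>\<xi>.
          cmod (fourier_transform (distr (\<mu> n) borel (random_diffeo \<omega>)) \<xi>) * \<bar>\<xi>\<bar> powr (\<sigma> n / 2)))"
        by (rule random_diffeo_decay[OF \<mu>(1) R \<mu>(3) \<mu>(5), where \<eta>="\<eta> n"])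
          (use \<eta>[of n] \<sigma>[of n] d in auto)
      then show ?thesis
        by eventually_elim (use \<sigma> in \<open>simp add: fourier_exponents_def\<close>)
    qed
    then have "AE \<omega> in gauss_field. \<forall>n. \<sigma> n \<in> fourier_exponents (distr (\<mu> n) borel (random_diffeo \<omega>))"
      by (simp add: AE_all_countable)
    \<comment> \<open>The existential statement is constant in the outer \<omega>, so holding almost
      surely in a probability space it holds outright.\<close>
    then have "AE \<omega> in gauss_field. \<exists>\<omega>. \<forall>n. \<sigma> n \<in> fourier_exponents (distr (\<mu> n) borel (random_diffeo \<omega>))"
      by eventually_elim blast
    then have "\<exists>\<omega>. \<forall>n. \<sigma> n \<in> fourier_exponents (distr (\<mu> n) borel (random_diffeo \<omega>))"
      by (simp only: G.AE_const)
    then show ?thesis using \<mu>(1,2) by blast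
  qed simp
  then obtain \<omega> where \<omega>: "d = 0 \<or> (\<forall>n. \<exists>\<mu>. real_distribution \<mu> \<and> measure \<mu> F = 1 \<and>
      \<sigma> n \<in> fourier_exponents (distr \<mu> borel (random_diffeo \<omega>)))" by blast
  define f where "f = random_diffeo \<omega>"
  interpret bounded_coeffs "\<lambda>l i. trunc l (\<omega> (l, i))" by (rule bounded_coeffs_trunc)
  have diffeo: "C1_diffeomorphism f" unfolding f_def random_diffeo_def by (rule C1_diffeomorphism_bumpy)
  have "bij f" using diffeo by (simp add: C1_diffeomorphism_def)
  have fF: "f ` F \<in> sets borel"
  proof -
    have "continuous_on UNIV (inv f)"
      using diffeo C1_diff_imp_diff differentiable_imp_continuous_on
      unfolding C1_diffeomorphism_def by blast
    then have "inv f \<in> borel_measurable borel" by (rule borel_measurable_continuous_onI)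
    then have "inv f -` F \<inter> space borel \<in> sets borel" using assms by (rule measurable_sets)
    then show ?thesis using bij_vimage_eq_inv_image[OF bij_imp_bij_inv[OF \<open>bij f\<close>]] \<open>bij f\<close>
      by (simp add: inv_inv_eq)
  qed
  have "d \<le> fourier_dim (f ` F)"
  proof (cases "d = 0")
    case True
    then show ?thesis using fourier_dim_nonneg[OF fF] by simp
  next
    case False
    have "\<sigma> n \<le> fourier_dim (f ` F)" for n
    proof -
      obtain \<mu> where \<mu>: "real_distribution \<mu>" "measure \<mu> F = 1" "\<sigma> n \<in> fourier_exponents (distr \<mu> borel f)"
        using \<omega> False unfolding f_def by blast
      interpret real_distribution \<mu> by (rule \<mu>(1))
      have f: "f \<in> borel_measurable \<mu>" using measurable_random_diffeo_section by (simp add: f_def)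
      have "f -` (f ` F) = F" using \<open>bij f\<close> by (simp add: bij_is_inj inj_vimage_image_eq)
      then have "measure (distr \<mu> borel f) (f ` F) = 1"
        using \<mu>(2) f fF by (simp add: measure_distr)
      moreover have "real_distribution (distr \<mu> borel f)" using f by (rule real_distribution_distr)
      ultimately show ?thesis
        using le_fourier_dim_measure[OF \<mu>(3)] fourier_dim_measure_le_fourier_dim by (meson order_trans)
    qed
    moreover have "\<sigma> \<longlonglongrightarrow> d"
      unfolding \<sigma>_def \<eta>_def using d(1) by real_asymp
    ultimately show ?thesis by (intro LIMSEQ_le_const2) auto
  qed
  moreover have "fourier_dim (f ` F) \<le> hausdorff_dim (f ` F)"
    by (rule fourier_dim_le_hausdorff_dim[OF fF])
  moreover have "hausdorff_dim (f ` F) \<le> d"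
    unfolding d_def
    by (rule hausdorff_dim_lipschitz_image_le[OF assms _ _ fF, of 2])
      (auto simp: f_def random_diffeo_def bumpy_lipschitz)
  ultimately have "salem_set (f ` F)" using fF by (simp add: salem_set_def)
  with diffeo show ?thesis by blast
qed

end
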